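(* Let $(\beta,B)=(1,0)$, and let $(A_N)_{N\ge2}$ be a sequence of coupling matrices such that $\limsup_{N\to\infty}\frac{\lambda_2(A_N)}{\lambda_1(A_N)}<1$ and $\limsup_{N\to\infty}N^{1/4}\max_{1\le i\le N}|R_i-1|<\infty$. If $\boldsymbol\sigma$ is a random vector from the Ising model $\mathbb P$ with parameters $(A_N,1,0)$, then $$d_{KS}\Big(N^{1/4}\overline{\boldsymbol\sigma},W\Big)\lesssim\frac{\varepsilon_N}{\sqrt N}+\frac{\varepsilon_Nr_N}{N^{1/4}}+\frac{(\log N)^2}{N^{1/4}}\sqrt{\sum_{i=1}^N(R_i-1)^2+N^{-1/2}\Big[\sum_{i=1}^N(R_i-1)\Big]^2},$$ where $$r_N:=\sqrt{(\log N)^3\max_{1\le i\le N}\sum_{j=1}^NA_N(i,j)^2}+\log N\max_{1\le i\le N}|R_i-1|,$$ $$\varepsilon_N:=\lVert A_N\rVert_F^2+\frac1N\Big[\sum_{i=1}^N(R_i-1)\Big]^2+\frac1N\sum_{i=1}^N(R_i-1)^2+\log N,$$ and $W$ is a continuous random variable on $\mathbb R$ with density proportional to $e^{-x^4/12}$.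
   Context: A coupling matrix $A_N$ is a symmetric $N\times N$ matrix with non-negative entries and zeros on the diagonal. The Ising model with parameters $(A_N,\beta,B)$, $\beta>0$, $B\in\mathbb R$, is the probability mass function on $\boldsymbol\sigma=(\sigma_1,\dots,\sigma_N)\in\{-1,1\}^N$ given by $\mathbb P(\boldsymbol\sigma)=\frac1{Z_N(\beta,B)}\exp\big(\frac\beta2\boldsymbol\sigma^\top A_N\boldsymbol\sigma+B\sum_{i=1}^N\sigma_i\big)$. Put $\overline{\boldsymbol\sigma}=\frac1N\sum_{i=1}^N\sigma_i$, $R_i=\sum_{j=1}^NA_N(i,j)$, $\lambda_1(A_N)\ge\dots\ge\lambda_N(A_N)$ the eigenvalues, $\lVert\cdot\rVert_F$ the Frobenius norm. $d_{KS}(X,Y)=\sup_{x\in\mathbb R}|\mathbb P(X\le x)-\mathbb P(Y\le x)|$. $x_N\lesssim y_N$ means there is a finite constant $C$ free of $N$ (it may depend on the sequence $(A_N)$) with $x_N\le Cy_N$ for all $N$. *)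

theory Defs
  imports "HOL-Probability.Probability" "Jordan_Normal_Form.Char_Poly"
begin

unbundle no vec_syntax

text \<open>
  Matrices and vectors are those of Jordan_Normal_Form, so indices run over \<open>{0..<N}\<close>
  in place of \<open>{1..N}\<close>.
\<close>

definition coupling_matrix :: "nat \<Rightarrow> real mat \<Rightarrow> bool" where
  "coupling_matrix N A \<longleftrightarrow>
     A \<in> carrier_mat N N \<and> transpose_mat A = A \<and>
     (\<forall>i<N. \<forall>j<N. A $$ (i, j) \<ge> 0) \<and> (\<forall>i<N. A $$ (i, i) = 0)"

definition row_sum :: "real mat \<Rightarrow> nat \<Rightarrow> real" where
  "row_sum A i = (\<Sum>j<dim_col A. A $$ (i, j))"

definition frobenius_norm :: "real mat \<Rightarrow> real" where
  "frobenius_norm A = sqrt (\<Sum>i<dim_row A. \<Sum>j<dim_col A. (A $$ (i, j))\<^sup>2)"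

text \<open>
  The \<open>k\<close>-th largest eigenvalue, \<open>k \<ge> 1\<close>, counted with multiplicity. Only the real roots of the
  characteristic polynomial are listed; for a symmetric \<open>A\<close> these are all of them.
\<close>

definition eigenvalue_desc :: "real mat \<Rightarrow> nat \<Rightarrow> real" where
  "eigenvalue_desc A k = rev (sorted_list_of_multiset (proots (char_poly A))) ! (k - 1)"

definition spin_configs :: "nat \<Rightarrow> real vec set" where
  "spin_configs N = {\<sigma> \<in> carrier_vec N. \<forall>i<N. \<sigma> $ i \<in> {-1, 1}}"

definition ising_weight :: "real mat \<Rightarrow> real \<Rightarrow> real \<Rightarrow> real vec \<Rightarrow> real" where
  "ising_weight A \<beta> B \<sigma> =
     exp (\<beta> / 2 * (\<sigma> \<bullet> (A *\<^sub>v \<sigma>)) + B * (\<Sum>i<dim_row A. \<sigma> $ i))"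

definition ising_Z :: "real mat \<Rightarrow> real \<Rightarrow> real \<Rightarrow> real" where
  "ising_Z A \<beta> B = (\<Sum>\<sigma>\<in>spin_configs (dim_row A). ising_weight A \<beta> B \<sigma>)"

definition ising_pmf :: "real mat \<Rightarrow> real \<Rightarrow> real \<Rightarrow> real vec pmf" where
  "ising_pmf A \<beta> B = embed_pmf (\<lambda>\<sigma>.
     if \<sigma> \<in> spin_configs (dim_row A) then ising_weight A \<beta> B \<sigma> / ising_Z A \<beta> B else 0)"

lemma spin_configs_finite: "finite (spin_configs N)"
proof -
  have "spin_configs N \<subseteq> vec N ` ({..<N} \<rightarrow>\<^sub>E {-1, 1})"
  proof
    fix \<sigma> assume s: "\<sigma> \<in> spin_configs N"
    have "\<sigma> = vec N (restrict (\<lambda>i. \<sigma> $ i) {..<N})"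
      using s by (intro eq_vecI) (auto simp: spin_configs_def)
    moreover have "restrict (\<lambda>i. \<sigma> $ i) {..<N} \<in> {..<N} \<rightarrow>\<^sub>E {-1, 1}"
      using s by (auto simp: spin_configs_def)
    ultimately show "\<sigma> \<in> vec N ` ({..<N} \<rightarrow>\<^sub>E {-1, 1})" by blast
  qed
  moreover have "finite ({..<N} \<rightarrow>\<^sub>E {-1, 1 :: real})"
    by (intro finite_PiE) auto
  ultimately show ?thesis by (meson finite_imageI finite_subset)
qed

lemma spin_configs_nonempty: "spin_configs N \<noteq> {}"
proof -
  have "vec N (\<lambda>_. 1) \<in> spin_configs N" by (auto simp: spin_configs_def)
  thus ?thesis by blast
qed

lemma ising_Z_pos: "ising_Z A \<beta> B > 0"
  unfolding ising_Z_def ising_weight_def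
  by (intro sum_pos spin_configs_finite spin_configs_nonempty) auto

lemma pmf_ising_pmf:
  "pmf (ising_pmf A \<beta> B) \<sigma> =
     (if \<sigma> \<in> spin_configs (dim_row A) then ising_weight A \<beta> B \<sigma> / ising_Z A \<beta> B else 0)"
  unfolding ising_pmf_def
proof (rule pmf_embed_pmf)
  let ?S = "spin_configs (dim_row A)"
  let ?f = "\<lambda>\<sigma>. if \<sigma> \<in> ?S then ising_weight A \<beta> B \<sigma> / ising_Z A \<beta> B else 0"
  show nn: "0 \<le> ?f x" for x
    using ising_Z_pos[of A \<beta> B] by (auto simp: ising_weight_def)
  have "(\<integral>\<^sup>+x. ennreal (?f x) \<partial>count_space UNIV) = (\<Sum>x\<in>?S. ennreal (?f x))"
    by (rule nn_integral_count_space'[OF spin_configs_finite]) auto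
  also have "\<dots> = ennreal (\<Sum>x\<in>?S. ?f x)"
    by (rule sum_ennreal) (rule nn)
  also have "(\<Sum>x\<in>?S. ?f x) = (\<Sum>x\<in>?S. ising_weight A \<beta> B x) / ising_Z A \<beta> B"
    by (simp add: sum_divide_distrib)
  also have "\<dots> = 1"
    using ising_Z_pos[of A \<beta> B] by (simp add: ising_Z_def)
  finally show "(\<integral>\<^sup>+x. ennreal (?f x) \<partial>count_space UNIV) = 1" by simp
qed

definition mean_spin :: "nat \<Rightarrow> real vec \<Rightarrow> real" where
  "mean_spin N \<sigma> = (\<Sum>i<N. \<sigma> $ i) / real N"

text \<open>\<open>X\<close> is a random variable on \<open>P\<close>, and \<open>Y\<close> one on \<open>Q\<close>.\<close>

definition KS_dist :: "'a measure \<Rightarrow> ('a \<Rightarrow> real) \<Rightarrow> 'b measure \<Rightarrow> ('b \<Rightarrow> real) \<Rightarrow> real" where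
  "KS_dist P X Q Y =
     (SUP x. \<bar>measure P {\<omega> \<in> space P. X \<omega> \<le> x} - measure Q {\<omega> \<in> space Q. Y \<omega> \<le> x}\<bar>)"

definition max_row_dev :: "nat \<Rightarrow> real mat \<Rightarrow> real" where
  "max_row_dev N A = (MAX i\<in>{..<N}. \<bar>row_sum A i - 1\<bar>)"

definition r_err :: "nat \<Rightarrow> real mat \<Rightarrow> real" where
  "r_err N A =
     sqrt ((ln (real N)) ^ 3 * (MAX i\<in>{..<N}. \<Sum>j<N. (A $$ (i, j))\<^sup>2))
     + ln (real N) * max_row_dev N A"

definition eps_err :: "nat \<Rightarrow> real mat \<Rightarrow> real" where
  "eps_err N A =
     (frobenius_norm A)\<^sup>2 + 1 / real N * (\<Sum>i<N. row_sum A i - 1)\<^sup>2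
     + 1 / real N * (\<Sum>i<N. (row_sum A i - 1)\<^sup>2) + ln (real N)"

end

theory Submission
  imports Defs "HOL-Real_Asymp.Real_Asymp"
begin

unbundle no inner_syntax

text \<open>
  Put \<open>t\<^sub>i(\<sigma>) = tanh (A \<sigma>)\<^sub>i\<close>, the mean of \<open>\<sigma>\<^sub>i\<close> given the other spins, and let \<open>X\<close> be the
  mean spin, \<open>t'\<close> the mean of the \<open>t\<^sub>i\<close>, and \<open>T = N\<^sup>1\<^sup>/\<^sup>4 X\<close>. Flipping one spin at a time shows that
  the expectation of \<open>N\<^sup>3\<^sup>/\<^sup>4 (X - t') f(T)\<close> is, up to small terms, that of \<open>f'(T)\<close>. At the critical
  temperature \<open>N\<^sup>3\<^sup>/\<^sup>4 (X - t') = T\<^sup>3/3 + Rem\<close>, so \<open>T\<close> nearly satisfies the Stein equation of the density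
  \<open>exp (- x\<^sup>4/12)\<close>, and inserting the solution whose right hand side is an indicator
  bounds the distance of the distribution functions.

  The remainder is small because the field \<open>A \<sigma>\<close> is nearly constant in \<open>i\<close>. By the spectral gap its centred
  part is dominated, in mean square, by \<open>A\<close> applied to the noise \<open>\<sigma> - t\<close>, whose size is
  the Frobenius norm of \<open>A\<close>. A maximum principle for \<open>(1 + A)/2\<close> gives the corresponding
  bound in the supremum norm. The inner product of the row deviations with \<open>\<sigma>\<close>
  is replaced by one of a Neumann series with the noise.
\<close>

section \<open>The two largest eigenvalues of a symmetric matrix\<close>

text \<open>The estimates are circular. The fourth moment of \<open>T\<close> is controlled by the
  energy \<open>U\<close> of the centred field, but unequal row sums couple the centred field back
  to the mean, so the second moment of \<open>U\<close> involves the fourth moment of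
  \<open>T\<close> again. The loop closes because \<open>U\<close> is measured in units of
  \<open>e\<close>, and \<open>e \<ge> L \<ge> D ^ 40\<close>: the feedback returns with a factor
  \<open>1 / D ^ 22\<close>. No prior concentration of the magnetization enters; all moments come
  from one antisymmetry, that of weight times residual under a spin flip
  (\<open>wt_res_flip\<close>). Only an upper bound for the quadratic form on mean-zero vectors is
  at hand, and eigenvalues near -1 are possible. This is why tanh is used through cocoercivity and
  not merely as a Lipschitz map. The factor \<open>(ln N)^3\<close> under the root arises from about
  \<open>ln N\<close> averaging steps, each driven by a noise field whose supremum over the sites
  costs a further \<open>sqrt (ln N)\<close>. A claimed rate of at least 1 makes the assertion
  trivial; the opposite case supplies the smallness of \<open>e\<close>, \<open>e * r0\<close> and
  \<open>\<nu>\<close> assumed in \<open>critical\<close>.\<close>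

lemma symmetric_real_eigenvalue_exists:
  fixes A :: "real mat"
  assumes A: "A \<in> carrier_mat n n" and sym: "transpose_mat A = A" and n: "n \<noteq> 0"
  shows "\<exists>\<mu>. eigenvalue A \<mu>"
proof -
  define C where "C = map_mat complex_of_real A"
  have C: "C \<in> carrier_mat n n" using A by (simp add: C_def)
  have "degree (char_poly C) = n" using degree_monic_char_poly[OF C] by simp
  then have "\<not> constant (poly (char_poly C))" using n by (simp add: constant_degree)
  then obtain z where z: "poly (char_poly C) z = 0"
    using fundamental_theorem_of_algebra by blast
  then have "eigenvalue C z" using eigenvalue_root_char_poly[OF C] by simp
  then obtain v where v: "v \<in> carrier_vec n" "v \<noteq> 0\<^sub>v n" "C *\<^sub>v v = z \<cdot>\<^sub>v v"
    using C by (auto simp: eigenvalue_def eigenvector_def)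
  define S where "S = (\<Sum>i<n. v $ i * cnj (v $ i))"
  have symm: "A $$ (i, j) = A $$ (j, i)" if "i < n" "j < n" for i j
    using that A arg_cong[OF sym, of "\<lambda>M. M $$ (i, j)"] by simp
  have comp: "z * v $ i = (\<Sum>j<n. complex_of_real (A $$ (i, j)) * v $ j)" if "i < n" for i
  proof -
    have "z * v $ i = (C *\<^sub>v v) $ i" using v that by simp
    also have "\<dots> = (\<Sum>j<n. complex_of_real (A $$ (i, j)) * v $ j)"
      using that C v(1) A by (simp add: scalar_prod_def C_def lessThan_atLeast0 )
    finally show ?thesis .
  qed
  \<comment> \<open>Symmetry makes the Hermitian form of \<open>v\<close> its own conjugate. Since
    \<open>S\<close> is positive, \<open>z\<close> equals its conjugate and is a real root.\<close>
  have "z * S = (\<Sum>i<n. (z * v $ i) * cnj (v $ i))"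
    by (simp add: S_def sum_distrib_left mult.assoc)
  also have "\<dots> = (\<Sum>i<n. \<Sum>j<n. complex_of_real (A $$ (i, j)) * v $ j * cnj (v $ i))"
    by (simp add: comp sum_distrib_right)
  also have "\<dots> = (\<Sum>j<n. \<Sum>i<n. complex_of_real (A $$ (i, j)) * v $ j * cnj (v $ i))"
    by (rule sum.swap)
  also have "\<dots> = (\<Sum>j<n. v $ j * cnj (z * v $ j))"
  proof (rule sum.cong[OF refl])
    fix j assume "j \<in> {..<n}"
    then have j: "j < n" by simp
    show "(\<Sum>i<n. complex_of_real (A $$ (i, j)) * v $ j * cnj (v $ i)) = v $ j * cnj (z * v $ j)"
      unfolding comp[OF j] cnj_sum sum_distrib_left
      by (rule sum.cong[OF refl]) (use symm j in auto)
  qed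
  also have "\<dots> = cnj z * S" by (simp add: S_def sum_distrib_left mult_ac)
  finally have zS: "z * S = cnj z * S" .
  have "S = complex_of_real (\<Sum>i<n. (cmod (v $ i))\<^sup>2)"
    by (simp add: S_def complex_norm_square[symmetric])
  moreover have "(\<Sum>i<n. (cmod (v $ i))\<^sup>2) \<noteq> 0"
  proof
    assume "(\<Sum>i<n. (cmod (v $ i))\<^sup>2) = 0"
    then have "\<forall>i<n. v $ i = 0" by (subst (asm) sum_nonneg_eq_0_iff) auto
    with v(1,2) show False by (metis carrier_vecD eq_vecI index_zero_vec)
  qed
  ultimately have "S \<noteq> 0" by (metis of_real_eq_0_iff)
  with zS have "z = cnj z" by simp
  then have zr: "z = complex_of_real (Re z)" by (simp add: complex_eq_iff)
  have "char_poly C = map_poly complex_of_real (char_poly A)"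
    unfolding C_def by (rule of_real_hom.char_poly_hom[OF A])
  then have "complex_of_real (poly (char_poly A) (Re z)) = 0"
    using z zr by (metis of_real_hom.poly_map_poly)
  then have "eigenvalue A (Re z)" using eigenvalue_root_char_poly[OF A] by simp
  then show ?thesis by blast
qed

text \<open>The reflection along \<open>w = v - e\<close> exchanges the first unit vector and
  \<open>v\<close>. For a unit vector \<open>v\<close> the squared length of \<open>w\<close> is
  \<open>-2 * w 0\<close>, so the usual factor \<open>2 / |w|^2\<close> becomes
  \<open>- 1 / w 0\<close>; if \<open>w 0 = 0\<close>, then \<open>w\<close> vanishes and the
  identity serves.\<close>

lemma householder_exists:
  fixes v :: "real vec"
  assumes v: "v \<in> carrier_vec (Suc k)" and unit: "v \<bullet> v = 1"
  shows "\<exists>W \<in> carrier_mat (Suc k) (Suc k). transpose_mat W = W \<and> W * W = 1\<^sub>m (Suc k) \<and> col W 0 = v"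
proof -
  define e where "e i = (if i = 0 then 1 else 0 :: real)" for i :: nat
  define w where "w i = v $ i - e i" for i
  have vv: "(\<Sum>i<Suc k. v $ i * v $ i) = 1"
    using unit v by (simp add: scalar_prod_def lessThan_atLeast0)
  have "(\<Sum>i<Suc k. w i * w i) = (\<Sum>i<Suc k. v $ i * v $ i - 2 * (e i * v $ i) + e i * e i)"
    by (intro sum.cong) (auto simp: w_def algebra_simps)
  also have "\<dots> = 1 - 2 * (\<Sum>i<Suc k. e i * v $ i) + (\<Sum>i<Suc k. e i * e i)"
    by (simp add: sum.distrib sum_subtractf sum_distrib_left vv del: sum.lessThan_Suc)
  also have "(\<Sum>i<Suc k. e i * v $ i) = v $ 0"
    by (simp add: e_def sum.lessThan_Suc_shift del: sum.lessThan_Suc)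
  also have "(\<Sum>i<Suc k. e i * e i) = 1"
    by (simp add: e_def sum.lessThan_Suc_shift del: sum.lessThan_Suc)
  finally have ww: "(\<Sum>i<Suc k. w i * w i) = - 2 * w 0" by (simp add: w_def e_def)
  show ?thesis
  proof (cases "w 0 = 0")
    case True
    then have "(\<Sum>i<Suc k. w i * w i) = 0" using ww by simp
    then have "\<forall>i\<in>{..<Suc k}. w i * w i = 0"
      by (subst (asm) sum_nonneg_eq_0_iff) (auto simp del: sum.lessThan_Suc)
    then have "v $ i = e i" if "i < Suc k" for i using that by (auto simp: w_def)
    then have "col (1\<^sub>m (Suc k)) 0 = v" using v by (intro eq_vecI) (auto simp: e_def)
    then show ?thesis by (intro bexI[of _ "1\<^sub>m (Suc k)"]) auto
  next
    case False
    define \<beta> where "\<beta> = - 1 / w 0"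
    define W where "W = mat (Suc k) (Suc k) (\<lambda>(i, j). (if i = j then 1 else 0) - \<beta> * w i * w j)"
    have b: "\<beta> * w 0 = - 1" using False by (simp add: \<beta>_def)
    have bb: "\<beta> * (\<Sum>i<Suc k. w i * w i) = 2" unfolding ww using False by (simp add: \<beta>_def)
    have "(\<Sum>l<Suc k. ((if i = l then 1 else 0) - \<beta> * w i * w l) * ((if l = j then 1 else 0) - \<beta> * w l * w j))
        = (if i = j then 1 else 0)" if "i < Suc k" "j < Suc k" for i j
    proof -
      have "(\<Sum>l<Suc k. ((if i = l then 1 else 0) - \<beta> * w i * w l) * ((if l = j then 1 else 0) - \<beta> * w l * w j))
         = (\<Sum>l<Suc k. (if i = l then (if l = j then 1 else 0) - \<beta> * w l * w j else 0)
              - (if l = j then \<beta> * w i * w l else 0) + \<beta> * \<beta> * w i * w j * (w l * w l))"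
        by (intro sum.cong refl) (auto simp: algebra_simps)
      also have "\<dots> = ((if i = j then 1 else 0) - \<beta> * w i * w j) - \<beta> * w i * w j
           + \<beta> * w i * w j * (\<beta> * (\<Sum>l<Suc k. w l * w l))"
        using that by (simp add: sum.distrib sum_subtractf sum_distrib_left[symmetric] sum.delta sum.delta'
            del: sum.lessThan_Suc)
      also have "\<dots> = (if i = j then 1 else 0)" by (simp add: bb del: sum.lessThan_Suc)
      finally show ?thesis .
    qed
    then have "W * W = 1\<^sub>m (Suc k)"
      by (intro eq_matI) (auto simp: W_def scalar_prod_def lessThan_atLeast0)
    moreover have "col W 0 = v"
    proof (rule eq_vecI)
      fix i assume "i < dim_vec v"
      then have i: "i < Suc k" using v by simp
      have "col W 0 $ i = e i - (\<beta> * w 0) * w i" using i by (simp add: W_def e_def)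
      then show "col W 0 $ i = v $ i" by (simp only: b) (simp add: w_def)
    qed (use v in \<open>simp add: W_def\<close>)
    moreover have "transpose_mat W = W" by (rule eq_matI) (auto simp: W_def)
    moreover have "W \<in> carrier_mat (Suc k) (Suc k)" by (simp add: W_def)
    ultimately show ?thesis by blast
  qed
qed

definition diag_of :: "real list \<Rightarrow> real mat" where
  "diag_of d = mat (length d) (length d) (\<lambda>(i, j). if i = j then d ! i else 0)"

text \<open>Deflation: conjugating with a reflection whose first column is a unit eigenvector clears
  the first row and column outside the corner, and the remaining block is symmetric of size
  \<open>k\<close>.\<close>

lemma real_spectral_theorem:
  fixes A :: "real mat"
  assumes "A \<in> carrier_mat n n" and "transpose_mat A = A"
  shows "\<exists>P d. P \<in> carrier_mat n n \<and> length d = n \<and> transpose_mat P * P = 1\<^sub>m n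
    \<and> A = P * diag_of d * transpose_mat P"
  using assms
proof (induction n arbitrary: A)
  case 0
  then show ?case by (intro exI[of _ "1\<^sub>m 0"] exI[of _ "[]"]) (auto simp: diag_of_def)
next
  case (Suc k)
  note A = Suc.prems(1) and sym = Suc.prems(2)
  obtain \<mu> v0 where v0: "v0 \<in> carrier_vec (Suc k)" "v0 \<noteq> 0\<^sub>v (Suc k)" "A *\<^sub>v v0 = \<mu> \<cdot>\<^sub>v v0"
    using symmetric_real_eigenvalue_exists[OF A sym] A by (auto simp: eigenvalue_def eigenvector_def)
  define r where "r = sqrt (v0 \<bullet> v0)"
  have "v0 \<bullet> v0 \<noteq> 0"
  proof
    assume "v0 \<bullet> v0 = 0"
    then have "(\<Sum>i<Suc k. v0 $ i * v0 $ i) = 0"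
      using v0(1) by (simp add: scalar_prod_def lessThan_atLeast0)
    then have "\<forall>i\<in>{..<Suc k}. v0 $ i * v0 $ i = 0"
      by (subst (asm) sum_nonneg_eq_0_iff) (auto simp del: sum.lessThan_Suc)
    with v0(1,2) show False by (metis carrier_vecD eq_vecI index_zero_vec lessThan_iff mult_eq_0_iff)
  qed
  moreover have "v0 \<bullet> v0 \<ge> 0" by (simp add: scalar_prod_def sum_nonneg)
  ultimately have "v0 \<bullet> v0 > 0" by simp
  then have r: "r > 0" "r * r = v0 \<bullet> v0" by (auto simp: r_def)
  define v where "v = (1 / r) \<cdot>\<^sub>v v0"
  have v: "v \<in> carrier_vec (Suc k)" using v0 by (simp add: v_def)
  have vu: "v \<bullet> v = 1" using v0(1) r \<open>v0 \<bullet> v0 \<noteq> 0\<close> by (simp add: v_def field_simps)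
  have Av: "A *\<^sub>v v = \<mu> \<cdot>\<^sub>v v"
    using v0 A by (simp add: v_def mult_mat_vec smult_smult_assoc mult.commute)
  obtain W where W: "W \<in> carrier_mat (Suc k) (Suc k)" "transpose_mat W = W"
    "W * W = 1\<^sub>m (Suc k)" "col W 0 = v"
    using householder_exists[OF v vu] by blast
  define B where "B = W * A * W"
  have B: "B \<in> carrier_mat (Suc k) (Suc k)" using W A by (simp add: B_def)
  have Bsym: "transpose_mat B = B"
    using W A sym by (simp add: B_def transpose_mult[of _ "Suc k" "Suc k" _ "Suc k"]
        assoc_mult_mat[of _ "Suc k" "Suc k" _ "Suc k" _ "Suc k"])
  have AB: "A = W * B * W"
  proof -
    have "W * B * W = (W * W) * A * (W * W)"
      using W(1) A by (simp add: B_def assoc_mult_mat[of _ "Suc k" "Suc k" _ "Suc k" _ "Suc k"])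
    then show ?thesis using W A by simp
  qed
  have col0: "col B 0 = \<mu> \<cdot>\<^sub>v unit_vec (Suc k) 0"
  proof -
    have "col B 0 = col (W * (A * W)) 0"
      using W(1) A by (simp add: B_def assoc_mult_mat[of _ "Suc k" "Suc k" _ "Suc k" _ "Suc k"])
    also have "\<dots> = W *\<^sub>v col (A * W) 0"
      by (rule col_mult2[of _ "Suc k" "Suc k" _ "Suc k"]) (use W(1) A in auto)
    also have "col (A * W) 0 = A *\<^sub>v col W 0"
      by (rule col_mult2[of _ "Suc k" "Suc k" _ "Suc k"]) (use W(1) A in auto)
    finally have "col B 0 = W *\<^sub>v (A *\<^sub>v col W 0)" .
    also have "\<dots> = \<mu> \<cdot>\<^sub>v (W *\<^sub>v col W 0)" using W v Av by (simp add: mult_mat_vec)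
    also have "W *\<^sub>v col W 0 = col (W * W) 0"
      by (rule col_mult2[of _ "Suc k" "Suc k" _ "Suc k", symmetric]) (use W(1) in auto)
    finally show ?thesis using W(3) by simp
  qed
  have Bi0: "B $$ (i, 0) = (if i = 0 then \<mu> else 0)" if "i < Suc k" for i
    using arg_cong[OF col0, of "\<lambda>x. x $ i"] that B by auto
  have B0i: "B $$ (0, i) = (if i = 0 then \<mu> else 0)" if "i < Suc k" for i
    using Bi0[OF that] that B arg_cong[OF Bsym, of "\<lambda>M. M $$ (i, 0)"] by simp
  define A3 where "A3 = mat k k (\<lambda>(i, j). B $$ (Suc i, Suc j))"
  have A3: "A3 \<in> carrier_mat k k" by (simp add: A3_def)
  have "transpose_mat A3 = A3"
  proof (rule eq_matI)
    fix i j assume "i < dim_row A3" "j < dim_col A3"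
    then show "transpose_mat A3 $$ (i, j) = A3 $$ (i, j)"
      using B arg_cong[OF Bsym, of "\<lambda>M. M $$ (Suc i, Suc j)"] by (simp add: A3_def)
  qed (auto simp: A3_def)
  from Suc.IH[OF A3 this] obtain P3 d3 where P3: "P3 \<in> carrier_mat k k" "length d3 = k"
    "transpose_mat P3 * P3 = 1\<^sub>m k" "A3 = P3 * diag_of d3 * transpose_mat P3" by blast
  define Z where "Z = four_block_mat (1\<^sub>m 1) (0\<^sub>m 1 k) (0\<^sub>m k 1) P3"
  have Z: "Z \<in> carrier_mat (Suc k) (Suc k)"
    using four_block_carrier_mat[of "1\<^sub>m 1" 1 1 P3 k k] P3(1) by (simp add: Z_def)
  have ZT: "transpose_mat Z = four_block_mat (1\<^sub>m 1) (0\<^sub>m 1 k) (0\<^sub>m k 1) (transpose_mat P3)"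
    unfolding Z_def using P3(1) by (subst transpose_four_block_mat) auto
  have D: "diag_of (\<mu> # d3) = four_block_mat (mat 1 1 (\<lambda>_. \<mu>)) (0\<^sub>m 1 k) (0\<^sub>m k 1) (diag_of d3)"
    by (rule eq_matI) (auto simp: diag_of_def P3(2) nth_Cons')
  have D3: "diag_of d3 \<in> carrier_mat k k" using P3(2) by (simp add: diag_of_def)
  have BD: "B = Z * diag_of (\<mu> # d3) * transpose_mat Z"
  proof -
    have "B = four_block_mat (mat 1 1 (\<lambda>_. \<mu>)) (0\<^sub>m 1 k) (0\<^sub>m k 1) A3"
      by (rule eq_matI) (use B Bi0 B0i in \<open>auto simp: A3_def not_less_eq less_Suc_eq_0_disj\<close>)
    also have "\<dots> = Z * diag_of (\<mu> # d3) * transpose_mat Z"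
    proof -
      have e1: "Z * diag_of (\<mu> # d3) = four_block_mat (mat 1 1 (\<lambda>_. \<mu>)) (0\<^sub>m 1 k) (0\<^sub>m k 1) (P3 * diag_of d3)"
        unfolding Z_def D
        by (subst mult_four_block_mat[of _ 1 1 _ k _ k _ _ 1 _ k]) (use P3(1) D3 in auto)
      show ?thesis unfolding e1 ZT
        by (subst mult_four_block_mat[of _ 1 1 _ k _ k _ _ 1 _ k]) (use P3(1,4) D3 in auto)
    qed
    finally show ?thesis .
  qed
  have ZZ: "transpose_mat Z * Z = 1\<^sub>m (Suc k)"
    unfolding ZT unfolding Z_def
    by (subst mult_four_block_mat[of _ 1 1 _ k _ k _ _ 1 _ k]) (use P3(1,3) four_block_one_mat[of 1 k] in auto)
  have DD: "diag_of (\<mu> # d3) \<in> carrier_mat (Suc k) (Suc k)" by (simp add: diag_of_def P3(2))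
  have P: "W * Z \<in> carrier_mat (Suc k) (Suc k)" using W Z by simp
  have PT: "transpose_mat (W * Z) = transpose_mat Z * W"
    using W Z by (simp add: transpose_mult[of _ "Suc k" "Suc k" _ "Suc k"])
  have ZTc: "transpose_mat Z \<in> carrier_mat (Suc k) (Suc k)" using Z by simp
  note assoc = assoc_mult_mat[of _ "Suc k" "Suc k" _ "Suc k" _ "Suc k"]
  have "transpose_mat (W * Z) * (W * Z) = transpose_mat Z * ((W * W) * Z)"
    unfolding PT using W(1) Z ZTc by (simp add: assoc del: transpose_carrier_mat)
  then have orth: "transpose_mat (W * Z) * (W * Z) = 1\<^sub>m (Suc k)" using W Z ZZ by simp
  have "A = (W * Z) * diag_of (\<mu> # d3) * transpose_mat (W * Z)"
    unfolding PT using AB W(1) Z ZTc DD unfolding BD by (simp add: assoc)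
  then show ?case using P orth P3(2) by (intro exI[of _ "W * Z"] exI[of _ "\<mu> # d3"]) auto
qed

lemma char_poly_diag_of: "char_poly (diag_of d) = (\<Prod>a\<leftarrow>d. [:- a, 1:])"
proof -
  have "diag_mat (diag_of d) = d"
    by (rule nth_equalityI) (auto simp: diag_of_def diag_mat_def)
  moreover have "upper_triangular (diag_of d)" by (auto simp: diag_of_def)
  ultimately show ?thesis
    using char_poly_upper_triangular[of "diag_of d" "length d"] by (simp add: diag_of_def)
qed

lemma proots_linear_factors: "proots (\<Prod>a\<leftarrow>d. [:- a, 1:]) = mset (d :: real list)"
proof (induction d)
  case (Cons a d)
  have "(\<Prod>a\<leftarrow>d. [:- a, 1:]) \<noteq> 0" by (auto simp: prod_list_zero_iff)
  then have "proots ([:- a, 1:] * (\<Prod>a\<leftarrow>d. [:- a, 1:])) = {#a#} + mset d"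
    using Cons.IH by (subst proots_mult) (auto simp del: mult_pCons_left)
  then show ?case by (simp del: mult_pCons_left)
qed simp

text \<open>In eigenvector coordinates the form is a weighted sum of squares, with one weight the
  largest eigenvalue and every other weight at most the second largest. Only the top eigenvector
  \<open>q\<close> is exported, which is all that the comparison with the constant vector
  needs.\<close>

lemma symmetric_two_eigenvalue_bound:
  fixes A :: "real mat"
  assumes A: "A \<in> carrier_mat n n" and sym: "transpose_mat A = A" and n: "n \<ge> 2"
  obtains q where "q \<in> carrier_vec n" "q \<bullet> q = 1"
    "q \<bullet> (A *\<^sub>v q) = eigenvalue_desc A 1"
    "eigenvalue_desc A 2 \<le> eigenvalue_desc A 1"
    "\<And>x. x \<in> carrier_vec n \<Longrightarrow> x \<bullet> (A *\<^sub>v x) \<le>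
       eigenvalue_desc A 2 * (x \<bullet> x) + (eigenvalue_desc A 1 - eigenvalue_desc A 2) * (q \<bullet> x)\<^sup>2"
proof -
  obtain P d where P: "P \<in> carrier_mat n n" and d: "length d = n"
    and PTP: "transpose_mat P * P = 1\<^sub>m n" and AP: "A = P * diag_of d * transpose_mat P"
    using real_spectral_theorem[OF A sym] by blast
  have PT: "transpose_mat P \<in> carrier_mat n n" using P by simp
  have D: "diag_of d \<in> carrier_mat n n" by (simp add: diag_of_def d)
  have PPT: "P * transpose_mat P = 1\<^sub>m n"
    using mat_mult_left_right_inverse[OF PT P PTP] .
  have "similar_mat_wit A (diag_of d) P (transpose_mat P)"
    by (rule similar_mat_witI[of _ _ n]) (use P PT D A PTP PPT AP in auto)
  then have "char_poly A = char_poly (diag_of d)"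
    by (intro char_poly_similar) (auto simp: similar_mat_def)
  then have pr: "proots (char_poly A) = mset d" by (simp add: char_poly_diag_of proots_linear_factors)
  define s where "s = rev (sorted_list_of_multiset (proots (char_poly A)))"
  have ms: "mset d = mset s" by (simp add: s_def pr)
  have ls: "length s = n" using ms d by (metis size_mset)
  have l1: "eigenvalue_desc A 1 = s ! 0" and l2: "eigenvalue_desc A 2 = s ! 1"
    by (simp_all add: eigenvalue_desc_def s_def)
  have desc: "s ! j \<le> s ! i" if "i \<le> j" "j < n" for i j
    using that ls unfolding s_def
    by (metis sorted_rev_nth_mono rev_rev_ident sorted_sorted_list_of_multiset)
  \<comment> \<open>The sorted eigenvalues are a permutation of the diagonal, so one index
    \<open>i0\<close> can be singled out even when the top eigenvalue is repeated.\<close>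
  obtain p where p: "p permutes {..<length s}" "permute_list p s = d"
    using mset_eq_permutation[OF ms] by blast
  obtain i0 where i0': "p i0 = 0" using permutes_surj[OF p(1)] by (metis surjD)
  then have i0: "i0 < n" "p i0 = 0"
    using permutes_in_image[OF p(1), of i0] ls n by auto
  have di: "d ! i = s ! p i" if "i < n" for i
    using that p ls by (metis permute_list_nth)
  have d0: "d ! i0 = s ! 0" using di[OF i0(1)] i0(2) by simp
  have d1: "d ! i \<le> s ! 1" if "i < n" "i \<noteq> i0" for i
  proof -
    have "p i \<noteq> 0" using that(2) i0(2) p(1) by (metis permutes_inj injD)
    moreover have "p i < n" using that(1) p(1) ls by (metis lessThan_iff permutes_in_image)
    ultimately show ?thesis using di[OF that(1)] desc[of 1 "p i"] by simp
  qed
  define q where "q = col P i0"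
  have q: "q \<in> carrier_vec n" using P by (auto simp: q_def)
  have form: "x \<bullet> (A *\<^sub>v x) = (\<Sum>i<n. d ! i * ((transpose_mat P *\<^sub>v x) $ i)\<^sup>2)"
    if x: "x \<in> carrier_vec n" for x
  proof -
    define y where "y = transpose_mat P *\<^sub>v x"
    have y: "y \<in> carrier_vec n" using PT x by (auto simp: y_def)
    have "A *\<^sub>v x = P *\<^sub>v (diag_of d *\<^sub>v y)"
      unfolding AP y_def using P PT D x
      by (simp add: assoc_mult_mat_vec[of _ n n _ n])
    then have "x \<bullet> (A *\<^sub>v x) = y \<bullet> (diag_of d *\<^sub>v y)"
      unfolding y_def using transpose_vec_mult_scalar[OF P _ x, of "diag_of d *\<^sub>v y"] D y
      by (simp add: y_def)
    also have "\<dots> = (\<Sum>i<n. y $ i * (\<Sum>j<n. (if i = j then d ! i else 0) * y $ j))"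
      using y D d by (simp add: scalar_prod_def diag_of_def lessThan_atLeast0)
    also have "\<dots> = (\<Sum>i<n. d ! i * (y $ i)\<^sup>2)"
    proof (rule sum.cong[OF refl])
      fix i assume "i \<in> {..<n}"
      then have "(\<Sum>j<n. (if i = j then d ! i else 0) * y $ j) = d ! i * y $ i"
        by (simp add: if_distrib[of "\<lambda>c. c * _"] cong: if_cong)
      then show "y $ i * (\<Sum>j<n. (if i = j then d ! i else 0) * y $ j) = d ! i * (y $ i)\<^sup>2"
        by (simp add: power2_eq_square)
    qed
    finally show ?thesis by (simp add: y_def)
  qed
  have nrm: "x \<bullet> x = (\<Sum>i<n. ((transpose_mat P *\<^sub>v x) $ i)\<^sup>2)" if x: "x \<in> carrier_vec n" for x
  proof -
    have "x = P *\<^sub>v (transpose_mat P *\<^sub>v x)"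
      using P PT x PPT by (metis assoc_mult_mat_vec one_mult_mat_vec)
    then have "x \<bullet> x = (transpose_mat P *\<^sub>v x) \<bullet> (transpose_mat P *\<^sub>v x)"
      using transpose_vec_mult_scalar[OF P _ x, of "transpose_mat P *\<^sub>v x"] PT x
      by (metis mult_mat_vec_carrier transpose_vec_mult_scalar P)
    also have "\<dots> = (\<Sum>i<n. ((transpose_mat P *\<^sub>v x) $ i)\<^sup>2)"
      using P x by (simp add: scalar_prod_def lessThan_atLeast0 power2_eq_square)
    finally show ?thesis .
  qed
  have yi0: "(transpose_mat P *\<^sub>v x) $ i0 = q \<bullet> x" for x
    using P i0(1) by (simp add: q_def)
  have yq: "transpose_mat P *\<^sub>v q = unit_vec n i0"
  proof -
    have "transpose_mat P *\<^sub>v q = col (transpose_mat P * P) i0"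
      unfolding q_def by (rule col_mult2[of _ n n _ n, symmetric]) (use P PT i0(1) in auto)
    then show ?thesis using i0(1) by (simp add: PTP)
  qed
  have "q \<bullet> q = 1" using nrm[OF q] i0(1)
    by (simp add: yq if_distrib[of "\<lambda>c. c\<^sup>2"] unit_vec_def cong: if_cong)
  moreover have "q \<bullet> (A *\<^sub>v q) = s ! 0" using form[OF q] i0(1) d0
    by (simp add: yq if_distrib[of "\<lambda>c. c\<^sup>2"] if_distrib[of "\<lambda>c. _ * c"] unit_vec_def cong: if_cong)
  moreover have "s ! 1 \<le> s ! 0" using desc[of 0 1] n by simp
  moreover have "x \<bullet> (A *\<^sub>v x) \<le> s ! 1 * (x \<bullet> x) + (s ! 0 - s ! 1) * (q \<bullet> x)\<^sup>2"
    if x: "x \<in> carrier_vec n" for x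
  proof -
    let ?y = "\<lambda>i. ((transpose_mat P *\<^sub>v x) $ i)\<^sup>2"
    have "(\<Sum>i<n. d ! i * ?y i) \<le> (\<Sum>i<n. s ! 1 * ?y i + (if i = i0 then (s ! 0 - s ! 1) * ?y i0 else 0))"
    proof (rule sum_mono)
      fix i assume "i \<in> {..<n}"
      then show "d ! i * ?y i \<le> s ! 1 * ?y i + (if i = i0 then (s ! 0 - s ! 1) * ?y i0 else 0)"
        using d1[of i] d0 by (auto simp: algebra_simps mult_right_mono)
    qed
    also have "\<dots> = s ! 1 * (x \<bullet> x) + (s ! 0 - s ! 1) * (q \<bullet> x)\<^sup>2"
      using i0(1) by (simp add: sum.distrib nrm[OF x] sum_distrib_left yi0)
    finally show ?thesis by (simp add: form[OF x])
  qed
  ultimately show ?thesis using that q l1 l2 by simp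
qed

section \<open>The hyperbolic tangent\<close>

text \<open>At the critical temperature the linear parts of the mean-field equation cancel and this
  defect, of size \<open>x^3/3\<close>, is the entire drift.\<close>

definition tanh_defect :: "real \<Rightarrow> real" where "tanh_defect x = x - tanh x"

lemma tanh_defect_minus: "tanh_defect (- x) = - tanh_defect x"
  by (simp add: tanh_defect_def)

lemma has_real_derivative_tanh_real:
  "(tanh has_real_derivative 1 - (tanh x)\<^sup>2) (at (x :: real) within S)"
  by (rule derivative_eq_intros refl | simp)+

lemma has_real_derivative_tanh_defect:
  "(tanh_defect has_real_derivative (tanh x)\<^sup>2) (at x within S)"
  unfolding tanh_defect_def by (rule derivative_eq_intros has_real_derivative_tanh_real refl | simp)+

lemma real_mvt:
  fixes f f' :: "real \<Rightarrow> real" and x y :: real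
  assumes "\<And>x. (f has_real_derivative f' x) (at x)"
  obtains z where "min x y \<le> z" "z \<le> max x y" "f x - f y = (x - y) * f' z"
proof (cases x y rule: linorder_cases)
  case less
  with MVT2[of x y f f'] assms obtain z where "x < z" "z < y" "f y - f x = (y - x) * f' z" by auto
  then show ?thesis using less by (intro that[of z]) (auto simp: algebra_simps)
next
  case equal
  then show ?thesis by (intro that[of x]) auto
next
  case greater
  with MVT2[of y x f f'] assms obtain z where "y < z" "z < x" "f x - f y = (x - y) * f' z" by auto
  then show ?thesis using greater by (intro that[of z]) auto
qed

lemma tanh_sq_le_one: "(tanh (x :: real))\<^sup>2 \<le> 1"
proof -
  have "\<bar>tanh x\<bar> \<le> 1"
    using tanh_real_lt_1[of x] tanh_real_gt_neg1[of x] by (simp add: abs_le_iff)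
  then show ?thesis by (simp add: abs_square_le_1)
qed

text \<open>Keeping the mean value slope explicit yields the Lipschitz bound and cocoercivity at
  once.\<close>

lemma tanh_monotone_nonexpansive:
  fixes x y :: real
  obtains s where "0 \<le> s" "s \<le> 1" "tanh x - tanh y = s * (x - y)"
proof -
  obtain z where "tanh x - tanh y = (x - y) * (1 - (tanh z)\<^sup>2)"
    using real_mvt[OF has_real_derivative_tanh_real[of _ UNIV]] by metis
  then show ?thesis using tanh_sq_le_one[of z]
    by (intro that[of "1 - (tanh z)\<^sup>2"]) (auto simp: mult.commute)
qed

lemma tanh_lipschitz: "\<bar>tanh x - tanh y\<bar> \<le> \<bar>x - y\<bar>" for x y :: real
proof -
  obtain s where "0 \<le> s" "s \<le> 1" "tanh x - tanh y = s * (x - y)"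
    using tanh_monotone_nonexpansive .
  then show ?thesis by (simp add: abs_mult mult_left_le_one_le)
qed

lemma tanh_cocoercive: "(tanh x - tanh y)\<^sup>2 \<le> (x - y) * (tanh x - tanh y)" for x y :: real
proof -
  obtain s where s: "0 \<le> s" "s \<le> 1" "tanh x - tanh y = s * (x - y)"
    using tanh_monotone_nonexpansive .
  have "s * s * (x - y)\<^sup>2 \<le> s * (x - y)\<^sup>2"
    using s(1,2) by (intro mult_right_mono) (auto simp: mult_left_le_one_le)
  then show ?thesis by (simp add: s(3) power2_eq_square algebra_simps)
qed

lemma abs_tanh_le: "\<bar>tanh x\<bar> \<le> \<bar>x\<bar>" for x :: real
  using tanh_lipschitz[of x 0] by simp

lemma tanh_sq_le: "(tanh x)\<^sup>2 \<le> x\<^sup>2" for x :: real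
  using abs_tanh_le[of x] by (simp add: abs_le_square_iff)

lemma tanh_defect_mvt:
  obtains z where "min x y \<le> z" "z \<le> max x y"
    "tanh_defect x - tanh_defect y = (x - y) * (tanh z)\<^sup>2"
  using real_mvt[OF has_real_derivative_tanh_defect[of _ UNIV]] by metis

lemma tanh_defect_lipschitz: "\<bar>tanh_defect x - tanh_defect y\<bar> \<le> \<bar>x - y\<bar>"
proof -
  obtain z where "tanh_defect x - tanh_defect y = (x - y) * (tanh z)\<^sup>2"
    by (rule tanh_defect_mvt)
  then show ?thesis using tanh_sq_le_one[of z] by (simp add: abs_mult mult_left_le)
qed

lemma tanh_defect_diff_le:
  "\<bar>tanh_defect x - tanh_defect y\<bar> \<le> \<bar>x - y\<bar> * (2 * y\<^sup>2 + 2 * (x - y)\<^sup>2)"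
proof -
  obtain z where z: "min x y \<le> z" "z \<le> max x y"
    "tanh_defect x - tanh_defect y = (x - y) * (tanh z)\<^sup>2"
    by (rule tanh_defect_mvt)
  have "\<bar>z\<bar> \<le> \<bar>y\<bar> + \<bar>x - y\<bar>" using z(1,2) by auto
  then have "z\<^sup>2 \<le> (\<bar>y\<bar> + \<bar>x - y\<bar>)\<^sup>2" by (metis abs_ge_zero power2_abs power_mono)
  also have "\<dots> \<le> 2 * y\<^sup>2 + 2 * (x - y)\<^sup>2"
    using sum_squares_bound[of "\<bar>y\<bar>" "\<bar>x - y\<bar>"] by (simp add: power2_sum)
  finally have "(tanh z)\<^sup>2 \<le> 2 * y\<^sup>2 + 2 * (x - y)\<^sup>2" using tanh_sq_le[of z] by linarith
  then show ?thesis by (simp add: z(3) abs_mult mult_left_mono)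
qed

text \<open>The linear term stays exact because it cancels when summed over the centred
  field.\<close>

lemma tanh_defect_taylor:
  "\<bar>tanh_defect (y + d) - tanh_defect y - (tanh y)\<^sup>2 * d\<bar> \<le> 2 * \<bar>y\<bar> * d\<^sup>2 + \<bar>d\<bar> ^ 3"
proof -
  obtain z where z: "min (y + d) y \<le> z" "z \<le> max (y + d) y"
    "tanh_defect (y + d) - tanh_defect y = (y + d - y) * (tanh z)\<^sup>2"
    by (rule tanh_defect_mvt)
  have "\<bar>(tanh z)\<^sup>2 - (tanh y)\<^sup>2\<bar> = \<bar>tanh z - tanh y\<bar> * \<bar>tanh z + tanh y\<bar>"
    by (simp add: abs_mult[symmetric] power2_eq_square algebra_simps)
  also have "\<dots> \<le> \<bar>z - y\<bar> * (\<bar>z\<bar> + \<bar>y\<bar>)"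
    using tanh_lipschitz[of z y] abs_tanh_le[of z] abs_tanh_le[of y] by (intro mult_mono) linarith+
  also have "\<dots> \<le> \<bar>d\<bar> * (2 * \<bar>y\<bar> + \<bar>d\<bar>)"
    using z(1,2) by (intro mult_mono) auto
  finally have b: "\<bar>(tanh z)\<^sup>2 - (tanh y)\<^sup>2\<bar> \<le> \<bar>d\<bar> * (2 * \<bar>y\<bar> + \<bar>d\<bar>)" .
  have "tanh_defect (y + d) - tanh_defect y - (tanh y)\<^sup>2 * d = d * ((tanh z)\<^sup>2 - (tanh y)\<^sup>2)"
    unfolding z(3) by (simp add: algebra_simps)
  then have "\<bar>tanh_defect (y + d) - tanh_defect y - (tanh y)\<^sup>2 * d\<bar> = \<bar>d\<bar> * \<bar>(tanh z)\<^sup>2 - (tanh y)\<^sup>2\<bar>"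
    by (simp add: abs_mult)
  also have "\<dots> \<le> \<bar>d\<bar> * (\<bar>d\<bar> * (2 * \<bar>y\<bar> + \<bar>d\<bar>))" using b by (intro mult_left_mono) auto
  also have "\<dots> = 2 * \<bar>y\<bar> * d\<^sup>2 + \<bar>d\<bar> ^ 3"
    by (simp add: power2_eq_square power3_eq_cube algebra_simps)
  finally show ?thesis .
qed

lemma tanh_defect_le_cubic:
  fixes x :: real
  assumes "0 \<le> x" shows "tanh_defect x \<le> x ^ 3 / 3"
proof -
  have "(\<lambda>x. x ^ 3 / 3 - tanh_defect x) 0 \<le> (\<lambda>x. x ^ 3 / 3 - tanh_defect x) x"
  proof (rule DERIV_nonneg_imp_nondecreasing[OF assms], rule exI, rule conjI)
    fix z :: real
    show "((\<lambda>x. x ^ 3 / 3 - tanh_defect x) has_real_derivative (z\<^sup>2 - (tanh z)\<^sup>2)) (at z)"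
      by (rule derivative_eq_intros has_real_derivative_tanh_defect refl | simp)+
    show "0 \<le> z\<^sup>2 - (tanh z)\<^sup>2" using tanh_sq_le[of z] by simp
  qed
  then show ?thesis by (simp add: tanh_defect_def)
qed

lemma tanh_ge_cubic:
  fixes x :: real
  assumes "0 \<le> x" shows "x - x ^ 3 / 3 \<le> tanh x"
  using tanh_defect_le_cubic[OF assms] by (simp add: tanh_defect_def)

lemma tanh_sq_ge: "x\<^sup>2 - 2 / 3 * x ^ 4 \<le> (tanh x)\<^sup>2" for x :: real
proof -
  have "x\<^sup>2 - 2 / 3 * x ^ 4 \<le> (tanh x)\<^sup>2" if "0 \<le> x" for x :: real
  proof -
    have "x\<^sup>2 - (tanh x)\<^sup>2 = (x - tanh x) * (x + tanh x)" by (simp add: power2_eq_square algebra_simps)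
    also have "\<dots> \<le> (x ^ 3 / 3) * (2 * x)"
      using tanh_defect_le_cubic[OF that] abs_tanh_le[of x] that
      by (intro mult_mono) (auto simp: tanh_defect_def)
    also have "\<dots> = 2 / 3 * x ^ 4" by (simp add: power4_eq_xxxx power3_eq_cube)
    finally show ?thesis by simp
  qed
  from this[of "\<bar>x\<bar>"] show ?thesis by (simp add: tanh_real_abs)
qed

lemma tanh_defect_cubic: "\<bar>tanh_defect x - x ^ 3 / 3\<bar> \<le> \<bar>x\<bar> ^ 5"
proof -
  have main: "\<bar>tanh_defect x - x ^ 3 / 3\<bar> \<le> x ^ 5" if "0 \<le> x" for x
  proof -
    \<comment> \<open>The derivative is the expression that \<open>tanh_sq_ge\<close> makes
      nonnegative; 2/15 is 2/3 divided by 5.\<close>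
    have "(\<lambda>x. tanh_defect x - x ^ 3 / 3 + 2 / 15 * x ^ 5) 0 \<le> (\<lambda>x. tanh_defect x - x ^ 3 / 3 + 2 / 15 * x ^ 5) x"
    proof (rule DERIV_nonneg_imp_nondecreasing[OF that], rule exI, rule conjI)
      fix z
      show "((\<lambda>x. tanh_defect x - x ^ 3 / 3 + 2 / 15 * x ^ 5) has_real_derivative ((tanh z)\<^sup>2 - z\<^sup>2 + 2 / 3 * z ^ 4)) (at z)"
        by (rule derivative_eq_intros has_real_derivative_tanh_defect refl | simp)+
      show "0 \<le> (tanh z)\<^sup>2 - z\<^sup>2 + 2 / 3 * z ^ 4" using tanh_sq_ge[of z] by simp
    qed
    then have "x ^ 3 / 3 - tanh_defect x \<le> 2 / 15 * x ^ 5" by (simp add: tanh_defect_def)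
    moreover have "0 \<le> x ^ 5" using that by simp
    ultimately show ?thesis using tanh_defect_le_cubic[OF that] by linarith
  qed
  show ?thesis
  proof (cases "0 \<le> x")
    case False
    then show ?thesis using main[of "- x"] by (simp add: tanh_defect_minus abs_if split: if_splits)
  qed (use main in simp)
qed

text \<open>Coercivity for the fourth moment of the magnetization. On \<open>[0, 1]\<close> one has
  \<open>tanh z >= 2/3 z\<close>, hence \<open>tanh^2 >= 4/9 z^2 >= 3/7 z^2\<close>, and integration
  gives 1/7.\<close>

lemma tanh_defect_lower: assumes "\<bar>x\<bar> \<le> 1" shows "x ^ 4 / 7 \<le> x * tanh_defect x"
proof -
  have main: "x ^ 3 / 7 \<le> tanh_defect x" if "0 \<le> x" "x \<le> 1" for x
  proof -
    have "(\<lambda>x. tanh_defect x - x ^ 3 / 7) 0 \<le> (\<lambda>x. tanh_defect x - x ^ 3 / 7) x"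
    proof (rule DERIV_nonneg_imp_nondecreasing[OF that(1)], rule exI, rule conjI)
      fix z assume z: "0 \<le> z" "z \<le> x"
      show "((\<lambda>x. tanh_defect x - x ^ 3 / 7) has_real_derivative ((tanh z)\<^sup>2 - 3 / 7 * z\<^sup>2)) (at z)"
        by (rule derivative_eq_intros has_real_derivative_tanh_defect refl | simp)+
      have "z\<^sup>2 \<le> 1" using z that by (simp add: power_le_one)
      then have "z * z\<^sup>2 \<le> z" using z mult_left_le[of "z\<^sup>2" z] by simp
      then have "2 / 3 * z \<le> tanh z" using tanh_ge_cubic[OF z(1)] by (simp add: power3_eq_cube power2_eq_square mult.assoc)
      then have "(2 / 3 * z)\<^sup>2 \<le> (tanh z)\<^sup>2" using z(1) by (intro power_mono) auto
      then have "4 / 9 * z\<^sup>2 \<le> (tanh z)\<^sup>2" by (simp add: power_mult_distrib power_divide)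
      then show "0 \<le> (tanh z)\<^sup>2 - 3 / 7 * z\<^sup>2"
        using zero_le_power2[of z] by linarith
    qed
    then show ?thesis by (simp add: tanh_defect_def)
  qed
  show ?thesis
  proof (cases "0 \<le> x")
    case True
    then have "x * (x ^ 3 / 7) \<le> x * tanh_defect x" using main[of x] assms by (intro mult_left_mono) auto
    then show ?thesis by (simp add: power4_eq_xxxx power3_eq_cube)
  next
    case False
    then have "(- x) * ((- x) ^ 3 / 7) \<le> (- x) * tanh_defect (- x)" using main[of "- x"] assms by (intro mult_left_mono) auto
    then show ?thesis by (simp add: tanh_defect_minus power4_eq_xxxx power3_eq_cube)
  qed
qed

section \<open>Coupling operators\<close>

text \<open>Vectors are functions on \<open>nat\<close> of which only the values below
  \<open>N\<close> count, so the algebra carries no dimension side conditions.\<close>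

definition ip :: "nat \<Rightarrow> (nat \<Rightarrow> real) \<Rightarrow> (nat \<Rightarrow> real) \<Rightarrow> real" where
  "ip N x y = (\<Sum>i<N. x i * y i)"

definition nm :: "nat \<Rightarrow> (nat \<Rightarrow> real) \<Rightarrow> real" where
  "nm N x = sqrt (ip N x x)"

definition avg :: "nat \<Rightarrow> (nat \<Rightarrow> real) \<Rightarrow> real" where
  "avg N x = (\<Sum>i<N. x i) / real N"

definition cen :: "nat \<Rightarrow> (nat \<Rightarrow> real) \<Rightarrow> nat \<Rightarrow> real" where
  "cen N x i = x i - avg N x"

lemma ip_commute: "ip N x y = ip N y x"
  by (simp add: ip_def mult.commute)

lemma ip_cong: "(\<And>i. i < N \<Longrightarrow> x i = x' i) \<Longrightarrow> (\<And>i. i < N \<Longrightarrow> y i = y' i) \<Longrightarrow> ip N x y = ip N x' y'"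
  by (simp add: ip_def)

lemma ip_add_left: "ip N (\<lambda>i. x i + y i) z = ip N x z + ip N y z"
  by (simp add: ip_def algebra_simps sum.distrib)

lemma ip_diff_left: "ip N (\<lambda>i. x i - y i) z = ip N x z - ip N y z"
  by (simp add: ip_def algebra_simps sum_subtractf)

lemma ip_scale_left: "ip N (\<lambda>i. c * x i) z = c * ip N x z"
  by (simp add: ip_def sum_distrib_left mult_ac)

lemma ip_add_right: "ip N z (\<lambda>i. x i + y i) = ip N z x + ip N z y"
  by (simp add: ip_def algebra_simps sum.distrib)

lemma ip_diff_right: "ip N z (\<lambda>i. x i - y i) = ip N z x - ip N z y"
  by (simp add: ip_def algebra_simps sum_subtractf)

lemma ip_scale_right: "ip N z (\<lambda>i. c * x i) = c * ip N z x"
  by (simp add: ip_def sum_distrib_left mult_ac)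

lemma ip_const_right: "ip N x (\<lambda>i. c) = c * (\<Sum>i<N. x i)"
  by (simp add: ip_def sum_distrib_left mult_ac)

lemma ip_const_left: "ip N (\<lambda>i. c) x = c * (\<Sum>i<N. x i)"
  by (simp add: ip_def sum_distrib_left)

lemma ip_sum_left: "ip N (\<lambda>i. \<Sum>k\<in>K. f k i) z = (\<Sum>k\<in>K. ip N (f k) z)"
  unfolding ip_def sum_distrib_right by (rule sum.swap)

lemma ip_self_nonneg [simp]: "0 \<le> ip N x x"
  by (simp add: ip_def sum_nonneg)

lemma ip_self_eq: "ip N x x = (\<Sum>i<N. (x i)\<^sup>2)"
  by (simp add: ip_def power2_eq_square)

lemma nm_L2_set: "nm N x = L2_set x {..<N}"
  by (simp add: nm_def ip_self_eq L2_set_def)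

lemma nm_nonneg [simp]: "0 \<le> nm N x" by (simp add: nm_def)

lemma nm_sq: "(nm N x)\<^sup>2 = ip N x x" by (simp add: nm_def)

lemma sum_abs_mult_le_nm: "(\<Sum>i<N. \<bar>x i\<bar> * \<bar>y i\<bar>) \<le> nm N x * nm N y"
  unfolding nm_L2_set by (rule L2_set_mult_ineq)

lemma abs_ip_le: "\<bar>ip N x y\<bar> \<le> nm N x * nm N y"
proof -
  have "\<bar>ip N x y\<bar> \<le> (\<Sum>i<N. \<bar>x i\<bar> * \<bar>y i\<bar>)"
    unfolding ip_def using sum_abs[of "\<lambda>i. x i * y i" "{..<N}"] by (simp add: abs_mult)
  then show ?thesis using sum_abs_mult_le_nm[of x y N] by linarith
qed

lemma nm_triangle: "nm N (\<lambda>i. x i + y i) \<le> nm N x + nm N y"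
  unfolding nm_L2_set by (rule L2_set_triangle_ineq)

lemma nm_const: "nm N (\<lambda>_. c) = sqrt (real N) * \<bar>c\<bar>"
  unfolding nm_L2_set by (subst L2_set_constant) auto

lemma component_le_nm: "i < N \<Longrightarrow> \<bar>x i\<bar> \<le> nm N x"
  using member_le_L2_set[of "{..<N}" i "\<lambda>i. \<bar>x i\<bar>"] by (simp add: nm_L2_set L2_set_def)

lemma nm_mono: "(\<And>i. i < N \<Longrightarrow> \<bar>x i\<bar> \<le> y i) \<Longrightarrow> nm N x \<le> nm N y"
  unfolding nm_def ip_self_eq
  by (intro real_sqrt_le_mono sum_mono) (metis lessThan_iff abs_ge_zero order_trans power2_abs power_mono)

lemma nm_bounded:
  assumes "0 \<le> c" "\<And>i. i < N \<Longrightarrow> \<bar>x i\<bar> \<le> c"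
  shows "nm N x \<le> sqrt (real N) * c"
  using nm_mono[of N x "\<lambda>_. c"] nm_const[of N c] assms by simp

lemma sum_abs_le_nm: "(\<Sum>i<N. \<bar>x i\<bar>) \<le> sqrt (real N) * nm N x"
  using sum_abs_mult_le_nm[of "\<lambda>_. 1" x N] by (simp add: nm_const)

lemma sum_cen: "(\<Sum>i<N. cen N x i) = 0"
  by (cases "N = 0") (simp_all add: cen_def sum_subtractf avg_def)

lemma ip_cen_left: "ip N (cen N x) y = ip N (cen N x) (cen N y)"
  unfolding cen_def[of N y, abs_def] ip_diff_right ip_const_right by (simp add: sum_cen)

text \<open>The covariance formula: centred products see only differences of entries. Any inequality
  valid for all pairs of entries therefore passes to centred vectors.\<close>

lemma ip_cen_cen_pairs:
  "real N * ip N (cen N x) (cen N y) = (\<Sum>i<N. \<Sum>j<N. (x i - x j) * (y i - y j)) / 2"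
proof (cases "N = 0")
  case False
  have "(\<Sum>i<N. \<Sum>j<N. (x i - x j) * (y i - y j))
     = (\<Sum>i<N. \<Sum>j<N. x i * y i - x i * y j - x j * y i + x j * y j)"
    by (intro sum.cong) (auto simp: algebra_simps)
  also have "\<dots> = 2 * real N * ip N x y - 2 * (\<Sum>i<N. x i) * (\<Sum>i<N. y i)"
    by (simp add: sum.distrib sum_subtractf sum_distrib_left[symmetric] sum_distrib_right[symmetric] ip_def)
  finally have e: "(\<Sum>i<N. \<Sum>j<N. (x i - x j) * (y i - y j)) / 2
     = real N * ip N x y - (\<Sum>i<N. x i) * (\<Sum>i<N. y i)" by simp
  have "ip N (cen N x) (cen N y) = ip N x (cen N y)"
    by (metis ip_cen_left ip_commute)
  also have "\<dots> = ip N x y - avg N y * (\<Sum>i<N. x i)"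
    unfolding cen_def[abs_def] ip_diff_right ip_const_right by simp
  finally show ?thesis unfolding e using False by (simp add: avg_def field_simps)
qed (simp add: ip_def)

lemma nm_cen_le: "nm N (cen N x) \<le> nm N x"
proof -
  have "ip N (cen N x) (cen N x) = ip N x x - real N * (avg N x)\<^sup>2"
  proof (cases "N = 0")
    case False
    have "ip N (cen N x) (cen N x) = ip N x (cen N x)" by (metis ip_cen_left ip_commute)
    also have "\<dots> = ip N x x - avg N x * (\<Sum>i<N. x i)"
      unfolding cen_def[abs_def] ip_diff_right ip_const_right by simp
    finally show ?thesis using False by (simp add: avg_def power2_eq_square field_simps)
  qed (simp add: ip_def)
  then show ?thesis unfolding nm_def by (intro real_sqrt_le_mono) simp
qed

lemma nm_cen_lipschitz:
  assumes "\<And>i j. i < N \<Longrightarrow> j < N \<Longrightarrow> \<bar>y i - y j\<bar> \<le> \<bar>x i - x j\<bar>"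
  shows "nm N (cen N y) \<le> nm N (cen N x)"
proof (cases "N = 0")
  case False
  have "(\<Sum>i<N. \<Sum>j<N. (y i - y j) * (y i - y j)) \<le> (\<Sum>i<N. \<Sum>j<N. (x i - x j) * (x i - x j))"
    using assms by (intro sum_mono) (simp add: power2_eq_square[symmetric] abs_le_square_iff[symmetric])
  then have "real N * ip N (cen N y) (cen N y) \<le> real N * ip N (cen N x) (cen N x)"
    by (simp only: ip_cen_cen_pairs)
  then show ?thesis using False by (simp add: nm_def)
qed (simp add: nm_def ip_def)

text \<open>Cocoercivity of tanh, applied to each pair of entries and summed, survives the
  centring.\<close>

lemma ip_cen_tanh_cocoercive:
  defines "th \<equiv> \<lambda>x :: nat \<Rightarrow> real. \<lambda>i. tanh (x i)"
  shows "ip N (cen N (th x)) (cen N (th x)) \<le> ip N (cen N x) (cen N (th x))"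
proof (cases "N = 0")
  case False
  have "(\<Sum>i<N. \<Sum>j<N. (th x i - th x j) * (th x i - th x j)) \<le> (\<Sum>i<N. \<Sum>j<N. (x i - x j) * (th x i - th x j))"
    unfolding th_def using tanh_cocoercive by (intro sum_mono) (simp add: power2_eq_square)
  then have "real N * ip N (cen N (th x)) (cen N (th x)) \<le> real N * ip N (cen N x) (cen N (th x))"
    by (simp only: ip_cen_cen_pairs)
  then show ?thesis using False by simp
qed (simp add: ip_def)

section \<open>Symmetric non-negative couplings as operators\<close>

locale coupling =
  fixes N :: nat and a :: "nat \<Rightarrow> nat \<Rightarrow> real"
  assumes N_pos: "0 < N"
    and a_sym: "i < N \<Longrightarrow> j < N \<Longrightarrow> a i j = a j i"
    and a_nonneg: "i < N \<Longrightarrow> j < N \<Longrightarrow> 0 \<le> a i j"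
    and a_diag: "i < N \<Longrightarrow> a i i = 0"
begin

definition A :: "(nat \<Rightarrow> real) \<Rightarrow> nat \<Rightarrow> real" where
  "A x i = (\<Sum>j<N. a i j * x j)"

definition R :: "nat \<Rightarrow> real" where "R i = (\<Sum>j<N. a i j)"

definition c :: "nat \<Rightarrow> real" where "c i = R i - 1"

lemma A_add: "A (\<lambda>i. x i + y i) i = A x i + A y i"
  by (simp add: A_def algebra_simps sum.distrib)

lemma A_diff: "A (\<lambda>i. x i - y i) i = A x i - A y i"
  by (simp add: A_def algebra_simps sum_subtractf)

lemma A_scale: "A (\<lambda>i. s * x i) i = s * A x i"
  by (simp add: A_def sum_distrib_left mult_ac)

lemma A_const: "A (\<lambda>_. s) i = s * (1 + c i)"
  by (simp add: A_def c_def R_def sum_distrib_left mult_ac)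

lemma A_sum: "A (\<lambda>i. \<Sum>k\<in>K. f k i) i = (\<Sum>k\<in>K. A (f k) i)"
  unfolding A_def sum_distrib_left by (rule sum.swap)

lemma A_cong: "(\<And>j. j < N \<Longrightarrow> x j = y j) \<Longrightarrow> A x i = A y i"
  by (simp add: A_def)

lemma A_mono: "(\<And>j. j < N \<Longrightarrow> x j \<le> y j) \<Longrightarrow> i < N \<Longrightarrow> A x i \<le> A y i"
  unfolding A_def by (intro sum_mono mult_left_mono) (auto simp: a_nonneg)

lemma abs_A_le: "i < N \<Longrightarrow> \<bar>A x i\<bar> \<le> A (\<lambda>j. \<bar>x j\<bar>) i"
  unfolding A_def by (rule order_trans[OF sum_abs]) (auto intro!: sum_mono simp: abs_mult a_nonneg)

lemma ip_A_sym: "ip N x (A y) = ip N (A x) y"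
proof -
  have "ip N x (A y) = (\<Sum>i<N. \<Sum>j<N. x i * (a i j * y j))"
    by (simp add: ip_def A_def sum_distrib_left)
  also have "\<dots> = (\<Sum>j<N. \<Sum>i<N. x i * (a i j * y j))" by (rule sum.swap)
  also have "\<dots> = (\<Sum>j<N. \<Sum>i<N. a j i * x i * y j)"
    by (intro sum.cong) (use a_sym in \<open>auto simp: mult_ac\<close>)
  finally show ?thesis by (simp add: ip_def A_def sum_distrib_right)
qed

lemma sum_A: "(\<Sum>i<N. A x i) = (\<Sum>i<N. x i) + ip N c x"
proof -
  have "(\<Sum>i<N. A x i) = ip N (\<lambda>_. 1) (A x)" by (simp add: ip_def)
  also have "\<dots> = ip N (A (\<lambda>_. 1)) x" by (rule ip_A_sym)
  finally show ?thesis by (simp add: ip_def A_const algebra_simps sum.distrib)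
qed

text \<open>Schur's test: \<open>2 |w i * u j| <= (w i)^2 + (u j)^2\<close>, weighted by
  \<open>a i j\<close>. By symmetry row sums and column sums coincide, so one bound serves both
  squares.\<close>

lemma schur_test:
  assumes "\<And>i. i < N \<Longrightarrow> R i \<le> \<rho>"
  shows "\<bar>ip N w (A u)\<bar> \<le> \<rho> * (ip N w w + ip N u u) / 2"
proof -
  have "\<bar>ip N w (A u)\<bar> = \<bar>\<Sum>i<N. \<Sum>j<N. a i j * (w i * u j)\<bar>"
    by (simp add: ip_def A_def sum_distrib_left mult_ac)
  also have "\<dots> \<le> (\<Sum>i<N. \<Sum>j<N. \<bar>a i j * (w i * u j)\<bar>)"
    by (intro order_trans[OF sum_abs] sum_mono sum_abs)
  also have "\<dots> \<le> (\<Sum>i<N. \<Sum>j<N. a i j * (w i * w i) / 2 + a i j * (u j * u j) / 2)"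
  proof (intro sum_mono)
    fix i j assume ij: "i \<in> {..<N}" "j \<in> {..<N}"
    have "\<bar>w i * u j\<bar> \<le> (w i * w i + u j * u j) / 2"
      using sum_squares_bound[of "\<bar>w i\<bar>" "\<bar>u j\<bar>"] by (simp add: abs_mult power2_eq_square)
    then have "a i j * \<bar>w i * u j\<bar> \<le> a i j * ((w i * w i + u j * u j) / 2)"
      using ij a_nonneg by (intro mult_left_mono) auto
    then show "\<bar>a i j * (w i * u j)\<bar> \<le> a i j * (w i * w i) / 2 + a i j * (u j * u j) / 2"
      using ij a_nonneg by (simp add: abs_mult algebra_simps add_divide_distrib)
  qed
  also have "\<dots> = (\<Sum>i<N. \<Sum>j<N. a i j * (w i * w i) / 2) + (\<Sum>i<N. \<Sum>j<N. a i j * (u j * u j) / 2)"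
    by (simp add: sum.distrib)
  also have "(\<Sum>i<N. \<Sum>j<N. a i j * (u j * u j) / 2) = (\<Sum>j<N. \<Sum>i<N. a j i * (u j * u j) / 2)"
    by (subst sum.swap) (intro sum.cong, use a_sym in auto)
  also have "(\<Sum>i<N. \<Sum>j<N. a i j * (w i * w i) / 2) = (\<Sum>i<N. R i * (w i * w i) / 2)"
    by (simp add: R_def sum_distrib_right sum_divide_distrib)
  also have "(\<Sum>i<N. \<Sum>j<N. a i j * (u i * u i) / 2) = (\<Sum>i<N. R i * (u i * u i) / 2)"
    by (simp add: R_def sum_distrib_right sum_divide_distrib)
  also have "(\<Sum>i<N. R i * (w i * w i) / 2) + (\<Sum>i<N. R i * (u i * u i) / 2)
      \<le> (\<Sum>i<N. \<rho> * (w i * w i) / 2) + (\<Sum>i<N. \<rho> * (u i * u i) / 2)"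
    using assms by (intro add_mono sum_mono divide_right_mono mult_right_mono) auto
  also have "\<dots> = \<rho> * (ip N w w + ip N u u) / 2"
    by (simp add: ip_def sum_distrib_left sum_divide_distrib add_divide_distrib algebra_simps)
  finally show ?thesis .
qed

lemma nm_A_le:
  assumes "\<And>i. i < N \<Longrightarrow> R i \<le> \<rho>" "0 < \<rho>"
  shows "nm N (A u) \<le> \<rho> * nm N u"
proof -
  \<comment> \<open>The test vector is \<open>A u\<close> itself; the scale
    \<open>1 / \<rho>\<close> balances the two squares.\<close>
  have "ip N (A u) (A u) / \<rho> = ip N (\<lambda>i. (1 / \<rho>) * A u i) (A u)"
    unfolding ip_scale_left by simp
  also have "\<dots> \<le> \<rho> * (ip N (\<lambda>i. (1 / \<rho>) * A u i) (\<lambda>i. (1 / \<rho>) * A u i) + ip N u u) / 2"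
    using schur_test[of \<rho> "\<lambda>i. (1 / \<rho>) * A u i" u] assms(1) by simp
  also have "\<dots> = ip N (A u) (A u) / \<rho> / 2 + \<rho> * ip N u u / 2"
    unfolding ip_scale_left ip_scale_right using assms(2) by (simp add: field_simps)
  finally have "ip N (A u) (A u) \<le> \<rho>\<^sup>2 * ip N u u"
    using assms(2) by (simp add: field_simps power2_eq_square)
  then have "sqrt (ip N (A u) (A u)) \<le> sqrt (\<rho>\<^sup>2 * ip N u u)" by (rule real_sqrt_le_mono)
  then show ?thesis using assms(2) by (simp add: nm_def real_sqrt_mult)
qed

end

section \<open>The spectral gap\<close>

text \<open>The gap is one-sided and refers to vectors of mean zero, although \<open>A\<close> need
  not preserve them. The bound \<open>\<kappa> \<le> \<delta> / 4\<close> makes the error from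
  unequal row sums smaller than the gap.\<close>

locale gapped = coupling +
  fixes \<kappa> \<delta> :: real
  assumes c_bound: "i < N \<Longrightarrow> \<bar>c i\<bar> \<le> \<kappa>"
    and \<kappa>_le: "\<kappa> \<le> \<delta> / 4"
    and \<delta>_pos: "0 < \<delta>" and \<delta>_le: "\<delta> \<le> 1"
    and gap: "(\<Sum>i<N. x i) = 0 \<Longrightarrow> ip N x (A x) \<le> (1 - \<delta>) * ip N x x"
begin

lemma \<kappa>_nonneg: "0 \<le> \<kappa>"
  using c_bound[of 0] N_pos by linarith

lemma R_le: "i < N \<Longrightarrow> R i \<le> 1 + \<kappa>"
  using c_bound[of i] by (simp add: c_def abs_le_iff)

lemma R_le_2: "i < N \<Longrightarrow> R i \<le> 2"
  using R_le[of i] \<kappa>_le \<delta>_le by simp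

lemma nm_A_le_2: "nm N (A u) \<le> 2 * nm N u"
  by (rule nm_A_le) (auto simp: R_le_2)

lemma nm_c: "nm N c \<le> sqrt (real N) * \<kappa>"
  using c_bound \<kappa>_nonneg by (intro nm_bounded) auto

text \<open>Averaging with the identity shifts the spectrum: an eigenvalue of \<open>A\<close> near \<open>-1\<close>, which the
  hypotheses allow, does no harm to the contraction of \<open>Qc\<close>.\<close>

definition Q :: "(nat \<Rightarrow> real) \<Rightarrow> nat \<Rightarrow> real" where
  "Q x i = (x i + A x i) / 2"

definition Qc :: "(nat \<Rightarrow> real) \<Rightarrow> nat \<Rightarrow> real" where
  "Qc x = cen N (Q x)"

lemma avg_Q: "avg N (Q x) = avg N x + ip N c x / (2 * real N)"
  using N_pos by (simp add: avg_def Q_def sum_divide_distrib[symmetric] sum.distrib sum_A field_simps)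

lemma ip_Q: "ip N y (Q x) = (ip N y x + ip N y (A x)) / 2"
  by (simp add: ip_def Q_def sum_divide_distrib[symmetric] sum.distrib algebra_simps)

lemma Q_mono: "(\<And>j. j < N \<Longrightarrow> x j \<le> y j) \<Longrightarrow> i < N \<Longrightarrow> Q x i \<le> Q y i"
  using A_mono[of x y i] by (simp add: Q_def add_mono)

text \<open>On mean-zero vectors the form of \<open>Q\<close> is at most
  \<open>1 - \<delta> / 2\<close> by the gap, and everywhere at least \<open>- \<kappa> / 2\<close>
  by Schur's test. Polarization turns this two-sided bound into a norm bound for the recentred
  operator.\<close>

lemma nm_Qc_le:
  assumes x: "(\<Sum>i<N. x i) = 0"
  shows "nm N (Qc x) \<le> (1 - \<delta> / 2) * nm N x"
proof -
  define \<theta> where "\<theta> = 1 - \<delta> / 2"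
  have \<theta>: "0 < \<theta>" "\<kappa> / 2 \<le> \<theta>" using \<delta>_pos \<delta>_le \<kappa>_le by (auto simp: \<theta>_def)
  have up: "ip N z (Q z) \<le> \<theta> * ip N z z" if "(\<Sum>i<N. z i) = 0" for z
    using gap[OF that] by (simp add: ip_Q \<theta>_def field_simps)
  have lo: "- \<theta> * ip N z z \<le> ip N z (Q z)" for z
  proof -
    have "\<bar>ip N z (A z)\<bar> \<le> (1 + \<kappa>) * (ip N z z + ip N z z) / 2"
      by (rule schur_test) (rule R_le)
    then have "- (\<kappa> / 2) * ip N z z \<le> ip N z (Q z)" by (simp add: ip_Q abs_le_iff field_simps)
    moreover have "(\<kappa> / 2) * ip N z z \<le> \<theta> * ip N z z"
      using \<theta>(2) by (intro mult_right_mono) auto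
    ultimately show ?thesis by simp
  qed
  have pol: "ip N y (Q x) \<le> \<theta> * (ip N x x + ip N y y) / 2" if y: "(\<Sum>i<N. y i) = 0" for y
  proof -
    let ?p = "\<lambda>i. x i + y i" and ?m = "\<lambda>i. x i - y i"
    have As: "ip N x (A y) = ip N y (A x)" by (metis ip_A_sym ip_commute)
    have Ap: "ip N z (A ?p) = ip N z (A x) + ip N z (A y)" for z
      by (simp add: ip_add_right[symmetric] A_add[abs_def])
    have Am: "ip N z (A ?m) = ip N z (A x) - ip N z (A y)" for z
      by (simp add: ip_diff_right[symmetric] A_diff[abs_def])
    have "4 * ip N y (Q x) = ip N ?p (Q ?p) - ip N ?m (Q ?m)"
      unfolding ip_Q Ap Am ip_add_left ip_diff_left ip_add_right ip_diff_right
      using As ip_commute[of N x y] by (simp add: field_simps)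
    also have "\<dots> \<le> \<theta> * ip N ?p ?p + \<theta> * ip N ?m ?m"
      using up[of ?p] lo[of ?m] x y by (simp add: sum.distrib)
    also have "\<dots> = 2 * \<theta> * (ip N x x + ip N y y)"
      unfolding ip_add_left ip_diff_left ip_add_right ip_diff_right by (simp add: algebra_simps)
    finally show ?thesis by simp
  qed
  \<comment> \<open>Recentring is an orthogonal projection, so pairing \<open>Q x\<close> with
    \<open>Qc x\<close> already gives the squared norm of \<open>Qc x\<close>.\<close>
  let ?y = "\<lambda>i. (1 / \<theta>) * Qc x i"
  have "ip N ?y (Q x) = ip N (Qc x) (Qc x) / \<theta>"
    unfolding ip_scale_left unfolding Qc_def by (subst (1) ip_cen_left) simp
  moreover have "(\<Sum>i<N. ?y i) = 0"
    by (simp add: Qc_def sum_cen sum_divide_distrib[symmetric])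
  moreover have "ip N ?y ?y = ip N (Qc x) (Qc x) / \<theta>\<^sup>2"
    unfolding ip_scale_left ip_scale_right by (simp add: power2_eq_square)
  ultimately have "ip N (Qc x) (Qc x) / \<theta> \<le> \<theta> * (ip N x x + ip N (Qc x) (Qc x) / \<theta>\<^sup>2) / 2"
    using pol[of ?y] by simp
  then have "ip N (Qc x) (Qc x) \<le> \<theta>\<^sup>2 * ip N x x"
    using \<theta>(1) by (simp add: field_simps power2_eq_square)
  then have "sqrt (ip N (Qc x) (Qc x)) \<le> sqrt (\<theta>\<^sup>2 * ip N x x)" by (rule real_sqrt_le_mono)
  then show ?thesis using \<theta>(1) by (simp add: nm_def real_sqrt_mult \<theta>_def)
qed

lemma abs_ip_c_le:
  assumes "\<And>i. i < N \<Longrightarrow> \<bar>x i\<bar> \<le> s"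
  shows "\<bar>ip N c x\<bar> \<le> real N * (\<kappa> * s)"
proof -
  have "\<bar>ip N c x\<bar> \<le> (\<Sum>i<N. \<bar>c i * x i\<bar>)" unfolding ip_def by (rule sum_abs)
  also have "\<dots> \<le> (\<Sum>i<N. \<kappa> * s)"
    using assms c_bound \<kappa>_nonneg by (intro sum_mono) (auto simp: abs_mult intro!: mult_mono)
  finally show ?thesis by simp
qed

text \<open>In the supremum norm there is no contraction, only slow growth: one
  \<open>\<kappa> / 2\<close> comes from the row sums, another from subtracting the mean that
  \<open>Q\<close> creates.\<close>

lemma Qc_sup:
  assumes x: "(\<Sum>i<N. x i) = 0" and s: "\<And>i. i < N \<Longrightarrow> \<bar>x i\<bar> \<le> s" and i: "i < N"
  shows "\<bar>Qc x i\<bar> \<le> (1 + \<kappa>) * s"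
proof -
  have s0: "0 \<le> s" using s[OF i] by linarith
  have "\<bar>A x i\<bar> \<le> A (\<lambda>j. \<bar>x j\<bar>) i" by (rule abs_A_le[OF i])
  also have "\<dots> \<le> A (\<lambda>_. s) i" using s i by (intro A_mono)
  also have "\<dots> \<le> s * (1 + \<kappa>)" using c_bound[OF i] s0 by (simp add: A_const mult_left_mono)
  finally have "\<bar>A x i\<bar> \<le> s * (1 + \<kappa>)" .
  then have "\<bar>Q x i\<bar> \<le> s * (1 + \<kappa> / 2)" using s[OF i] by (simp add: Q_def abs_le_iff field_simps)
  moreover have "\<bar>avg N (Q x)\<bar> \<le> \<kappa> / 2 * s"
  proof -
    have "avg N x = 0" using x by (simp add: avg_def)
    then show ?thesis using abs_ip_c_le[of x s] s N_pos by (simp add: avg_Q field_simps abs_mult)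
  qed
  ultimately have "\<bar>Q x i - avg N (Q x)\<bar> \<le> s * (1 + \<kappa> / 2) + \<kappa> / 2 * s" by linarith
  then show ?thesis by (simp add: Qc_def cen_def algebra_simps)
qed

section \<open>Iterates of the recentred operator\<close>

definition it :: "(nat \<Rightarrow> real) \<Rightarrow> nat \<Rightarrow> nat \<Rightarrow> real" where
  "it x k = (Qc ^^ k) (cen N x)"

lemma it_0: "it x 0 = cen N x" and it_Suc: "it x (Suc k) = Qc (it x k)"
  by (simp_all add: it_def)

lemma sum_it: "(\<Sum>i<N. it x k i) = 0"
  by (cases k) (simp_all add: it_0 it_Suc Qc_def sum_cen)

lemma avg_it: "avg N (it x k) = 0"
  by (simp add: avg_def sum_it)

lemma nm_it: "nm N (it x k) \<le> (1 - \<delta> / 2) ^ k * nm N (cen N x)"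
proof (induction k)
  case (Suc k)
  have "nm N (it x (Suc k)) \<le> (1 - \<delta> / 2) * nm N (it x k)"
    unfolding it_Suc by (rule nm_Qc_le[OF sum_it])
  also have "\<dots> \<le> (1 - \<delta> / 2) * ((1 - \<delta> / 2) ^ k * nm N (cen N x))"
    using Suc.IH \<delta>_le by (intro mult_left_mono) auto
  finally show ?case by simp
qed (simp add: it_0)

lemma it_sup:
  assumes "\<And>i. i < N \<Longrightarrow> \<bar>cen N x i\<bar> \<le> s" "i < N"
  shows "\<bar>it x k i\<bar> \<le> (1 + \<kappa>) ^ k * s"
  using assms(2)
proof (induction k arbitrary: i)
  case (Suc k)
  have "\<bar>Qc (it x k) i\<bar> \<le> (1 + \<kappa>) * ((1 + \<kappa>) ^ k * s)"
    by (rule Qc_sup[OF sum_it Suc.IH Suc.prems])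
  then show ?case by (simp add: it_Suc)
qed (use assms in \<open>simp add: it_0\<close>)

lemma geometric_le: "(\<Sum>k<l. (1 - \<delta> / 2) ^ k) \<le> 2 / \<delta>"
proof -
  have "(\<Sum>k<l. (1 - \<delta> / 2) ^ k) = (1 - (1 - \<delta> / 2) ^ l) / (\<delta> / 2)"
    using \<delta>_pos by (subst sum_gp_strict) auto
  also have "\<dots> \<le> 1 / (\<delta> / 2)"
    using \<delta>_pos \<delta>_le by (intro divide_right_mono) auto
  finally show ?thesis by simp
qed

text \<open>Iterating \<open>w \<le> Q w + h / 2\<close>: the part of \<open>w\<close> orthogonal to constants decays
  geometrically, so after logarithmically many steps only the mean of \<open>w\<close> remains.\<close>

lemma subharmonic_sup_bound:
  assumes w0: "\<And>i. i < N \<Longrightarrow> 0 \<le> w i" and sub: "\<And>i. i < N \<Longrightarrow> w i \<le> A w i + h" and h: "0 \<le> h"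
    and l1: "(1 - \<delta> / 2) ^ l \<le> 1 / sqrt (real N)" and l2: "(1 + \<kappa>) ^ l \<le> 3" and i: "i < N"
  shows "w i \<le> 3 * avg N w + 2 * real l * h + 2 * nm N (cen N w) / sqrt (real N)"
proof -
  \<comment> \<open>\<open>b k\<close> bounds the mean created when \<open>Q\<close> acts on the
    \<open>k\<close>-th centred iterate. The constant part of the majorant is \<open>s k\<close>:
    each step multiplies it by at most \<open>1 + \<kappa>\<close> and adds \<open>b k\<close> and
    \<open>h / 2\<close>.\<close>
  define b where "b k = (1 - \<delta> / 2) ^ k * (\<kappa> * nm N (cen N w) / (2 * sqrt (real N)))" for k
  define s where "s k = (1 + \<kappa>) ^ k * (avg N w + real k * h / 2 + (\<Sum>j<k. b j))" for k
  have b0: "0 \<le> b k" for k using \<delta>_le \<kappa>_nonneg by (simp add: b_def)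
  have a0: "0 \<le> avg N w" unfolding avg_def using w0 by (intro divide_nonneg_nonneg sum_nonneg) auto
  have s0: "0 \<le> s k" for k using a0 b0 h \<kappa>_nonneg by (simp add: s_def sum_nonneg)
  have step: "w i \<le> s k + it w k i" if "i < N" for i k
    using that
  proof (induction k arbitrary: i)
    case 0
    then show ?case by (simp add: s_def it_0 cen_def)
  next
    case (Suc k)
    have "2 * w i \<le> 2 * Q w i + h" using sub[OF Suc.prems] by (simp add: Q_def field_simps)
    also have "Q w i \<le> Q (\<lambda>i. s k + it w k i) i" using Suc by (intro Q_mono) auto
    also have "Q (\<lambda>i. s k + it w k i) i = s k * (1 + c i / 2) + Q (it w k) i"
      by (simp add: Q_def A_add A_const field_simps)
    also have "s k * (1 + c i / 2) \<le> s k * (1 + \<kappa>)"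
      using c_bound[OF Suc.prems] s0[of k] \<kappa>_nonneg by (intro mult_left_mono) auto
    also have "Q (it w k) i = it w (Suc k) i + ip N c (it w k) / (2 * real N)"
      by (simp add: it_Suc Qc_def cen_def avg_Q avg_it)
    also have "ip N c (it w k) / (2 * real N) \<le> b k"
    proof -
      have "ip N c (it w k) \<le> nm N c * nm N (it w k)" using abs_ip_le[of N c "it w k"] by linarith
      also have "\<dots> \<le> (sqrt (real N) * \<kappa>) * ((1 - \<delta> / 2) ^ k * nm N (cen N w))"
        using nm_c nm_it \<kappa>_nonneg by (intro mult_mono) auto
      finally have "ip N c (it w k) / (2 * real N) \<le> (sqrt (real N) * \<kappa>) * ((1 - \<delta> / 2) ^ k * nm N (cen N w)) / (2 * real N)"
        by (intro divide_right_mono) auto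
      also have "\<dots> = b k"
        unfolding b_def using N_pos real_sqrt_mult_self[of "real N"] by (simp add: field_simps)
      finally show ?thesis .
    qed
    finally have "w i \<le> s k * (1 + \<kappa>) + b k + h / 2 + it w (Suc k) i" by simp
    moreover have "s k * (1 + \<kappa>) + (b k + h / 2) \<le> s (Suc k)"
    proof -
      have "1 * (b k + h / 2) \<le> (1 + \<kappa>) ^ Suc k * (b k + h / 2)"
        using \<kappa>_nonneg b0 h by (intro mult_right_mono one_le_power) auto
      then show ?thesis by (simp add: s_def algebra_simps add_divide_distrib)
    qed
    ultimately show ?case by linarith
  qed
  \<comment> \<open>The geometric series costs \<open>1 / \<delta>\<close>, which
    \<open>\<kappa> \<le> \<delta> / 4\<close> repays. Three quarters from here and one from the
    last iterate stay below the factor 2 of the claim.\<close>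
  have "(\<Sum>j<l. b j) \<le> (2 / \<delta>) * (\<kappa> * nm N (cen N w) / (2 * sqrt (real N)))"
    unfolding b_def sum_distrib_right[symmetric]
    using \<kappa>_nonneg by (intro mult_right_mono geometric_le) auto
  also have "\<dots> = (\<kappa> / \<delta>) * (nm N (cen N w) / sqrt (real N))" by simp
  also have "\<dots> \<le> (1 / 4) * (nm N (cen N w) / sqrt (real N))"
    using \<kappa>_le \<delta>_pos by (intro mult_right_mono) (auto simp: field_simps)
  finally have bs: "(\<Sum>j<l. b j) \<le> (1 / 4) * (nm N (cen N w) / sqrt (real N))" .
  have "s l \<le> 3 * (avg N w + real l * h / 2 + (\<Sum>j<l. b j))"
    unfolding s_def using l2 a0 b0 h by (intro mult_right_mono) (auto simp: sum_nonneg)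
  moreover have "it w l i \<le> nm N (cen N w) / sqrt (real N)"
  proof -
    have "it w l i \<le> nm N (it w l)" using component_le_nm[OF i, of "it w l"] by linarith
    also have "\<dots> \<le> (1 - \<delta> / 2) ^ l * nm N (cen N w)" by (rule nm_it)
    also have "\<dots> \<le> 1 / sqrt (real N) * nm N (cen N w)" using l1 by (intro mult_right_mono) auto
    finally show ?thesis by simp
  qed
  moreover have "0 \<le> real l * h" using h by simp
  moreover have "0 \<le> nm N (cen N w) / sqrt (real N)" by simp
  moreover have "2 * nm N (cen N w) / sqrt (real N) = 2 * (nm N (cen N w) / sqrt (real N))" by simp
  moreover have "3 * (avg N w + real l * h / 2 + (\<Sum>j<l. b j)) = 3 * avg N w + 3 / 2 * (real l * h) + 3 * (\<Sum>j<l. b j)"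
    by (simp add: algebra_simps)
  moreover have "2 * real l * h = 2 * (real l * h)" by simp
  ultimately show ?thesis using step[OF i, of l] bs by linarith
qed

text \<open>An approximate solution of \<open>(1 - A) b = 2 (cen c)\<close>, as a truncated Neumann series.\<close>

definition neu :: "nat \<Rightarrow> nat \<Rightarrow> real" where
  "neu l i = (\<Sum>k<l. it c k i)"

lemma sum_neu: "(\<Sum>i<N. neu l i) = 0"
  unfolding neu_def by (subst sum.swap) (simp add: sum_it)

lemma nm_neu: "nm N (neu l) \<le> 2 / \<delta> * nm N c"
proof -
  have "nm N (neu l) \<le> (\<Sum>k<l. (1 - \<delta> / 2) ^ k * nm N c)"
  proof (induction l)
    case 0
    show ?case by (simp add: neu_def nm_def ip_def)
  next
    case (Suc l)
    have "nm N (neu (Suc l)) \<le> nm N (neu l) + nm N (it c l)"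
      unfolding neu_def by simp (rule nm_triangle)
    also have "nm N (it c l) \<le> (1 - \<delta> / 2) ^ l * nm N c"
      using \<delta>_le by (intro order_trans[OF nm_it] mult_left_mono nm_cen_le) auto
    finally show ?case using Suc by simp
  qed
  also have "\<dots> \<le> 2 / \<delta> * nm N c"
    unfolding sum_distrib_right[symmetric] using geometric_le by (intro mult_right_mono) auto
  finally show ?thesis .
qed

lemma neu_sup:
  assumes "i < N" and "(1 + \<kappa>) ^ l \<le> 3"
  shows "\<bar>neu l i\<bar> \<le> 6 * real l * \<kappa>"
proof -
  have ac: "\<bar>avg N c\<bar> \<le> \<kappa>"
  proof -
    have "\<bar>\<Sum>i<N. c i\<bar> \<le> (\<Sum>i<N. \<kappa>)" using c_bound by (intro order_trans[OF sum_abs] sum_mono) auto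
    then show ?thesis using N_pos by (simp add: avg_def field_simps)
  qed
  have cc: "\<bar>cen N c j\<bar> \<le> 2 * \<kappa>" if "j < N" for j
    using c_bound[OF that] ac by (simp add: cen_def abs_le_iff)
  have "\<bar>neu l i\<bar> \<le> (\<Sum>k<l. \<bar>it c k i\<bar>)" unfolding neu_def by (rule sum_abs)
  also have "\<dots> \<le> (\<Sum>k<l. 6 * \<kappa>)"
  proof (rule sum_mono)
    fix k assume k: "k \<in> {..<l}"
    have "\<bar>it c k i\<bar> \<le> (1 + \<kappa>) ^ k * (2 * \<kappa>)" using cc assms(1) by (rule it_sup)
    also have "\<dots> \<le> 3 * (2 * \<kappa>)"
    proof (rule mult_right_mono)
      have "(1 + \<kappa>) ^ k \<le> (1 + \<kappa>) ^ l" using k \<kappa>_nonneg by (intro power_increasing) auto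
      then show "(1 + \<kappa>) ^ k \<le> 3" using assms(2) by linarith
    qed (use \<kappa>_nonneg in simp)
    finally show "\<bar>it c k i\<bar> \<le> 6 * \<kappa>" by simp
  qed
  finally show ?thesis by simp
qed

text \<open>Up to a constant, \<open>it c k - it c (Suc k)\<close> is half of
  \<open>(1 - A) (it c k)\<close>. Telescoping represents the centred \<open>c\<close> by
  \<open>(1 - A) (neu l)\<close> and a small tail, and self-adjointness moves \<open>1 - A\<close>
  onto \<open>y\<close>. For a spin vector this difference is noise plus a cubic defect, whereas
  \<open>c\<close> itself pairs with the full spin vector.\<close>

lemma ip_c_neu:
  "2 * ip N c y = 2 * avg N c * (\<Sum>i<N. y i) + ip N (neu l) (\<lambda>i. y i - A y i)
     + 2 * ip N (it c l) y + ip N c (neu l) * avg N y"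
proof -
  have d: "2 * (it c k i - it c (Suc k) i) = it c k i - A (it c k) i + ip N (it c k) c / real N" for k i
    using N_pos by (simp add: it_Suc Qc_def cen_def Q_def[of _ i] avg_Q avg_it ip_commute[of N c] field_simps)
  have e: "2 * (cen N c i - it c l i) = neu l i - A (neu l) i + ip N c (neu l) / real N" for i
  proof -
    have "2 * (cen N c i - it c l i) = (\<Sum>k<l. 2 * (it c k i - it c (Suc k) i))"
      unfolding sum_distrib_left[symmetric] sum_lessThan_telescope'[of "\<lambda>k. it c k i" l] it_0 ..
    also have "\<dots> = (\<Sum>k<l. it c k i) - (\<Sum>k<l. A (it c k) i) + (\<Sum>k<l. ip N (it c k) c / real N)"
      unfolding d by (simp only: sum.distrib sum_subtractf)
    also have "(\<Sum>k<l. ip N (it c k) c / real N) = ip N c (neu l) / real N"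
      unfolding sum_divide_distrib[symmetric] neu_def[abs_def] ip_commute[of N c] ip_sum_left ..
    finally show ?thesis by (simp add: neu_def[abs_def] A_sum)
  qed
  have f: "2 * c i = 2 * avg N c + 2 * it c l i + (neu l i - A (neu l) i) + ip N c (neu l) / real N" for i
    using e[of i] by (simp add: cen_def)
  have "2 * ip N c y = ip N (\<lambda>i. 2 * c i) y" by (rule ip_scale_left[symmetric])
  also have "\<dots> = ip N (\<lambda>i. 2 * avg N c) y + 2 * ip N (it c l) y + (ip N (neu l) y - ip N (A (neu l)) y)
      + ip N (\<lambda>i. ip N c (neu l) / real N) y"
    unfolding f ip_add_left ip_diff_left ip_scale_left ..
  also have "ip N (A (neu l)) y = ip N (neu l) (A y)" by (rule ip_A_sym[symmetric])
  finally show ?thesis unfolding ip_diff_right ip_const_left by (simp add: avg_def)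
qed

end

section \<open>The Ising expectation and its Stein identity\<close>

context coupling
begin

definition Om :: "(nat \<Rightarrow> real) set" where
  "Om = PiE {..<N} (\<lambda>_. {-1, 1})"

definition wt :: "(nat \<Rightarrow> real) \<Rightarrow> real" where
  "wt \<sigma> = exp (ip N \<sigma> (A \<sigma>) / 2)"

definition Z :: real where "Z = (\<Sum>\<sigma>\<in>Om. wt \<sigma>)"

text \<open>The Gibbs expectation at inverse temperature 1 without external field. As a finite sum
  it raises no integrability questions.\<close>

definition Ex :: "((nat \<Rightarrow> real) \<Rightarrow> real) \<Rightarrow> real" where
  "Ex f = (\<Sum>\<sigma>\<in>Om. wt \<sigma> * f \<sigma>) / Z"

definition flip :: "nat \<Rightarrow> (nat \<Rightarrow> real) \<Rightarrow> nat \<Rightarrow> real" where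
  "flip i \<sigma> = \<sigma>(i := - \<sigma> i)"

definition t :: "(nat \<Rightarrow> real) \<Rightarrow> nat \<Rightarrow> real" where
  "t \<sigma> i = tanh (A \<sigma> i)"

definition res :: "(nat \<Rightarrow> real) \<Rightarrow> nat \<Rightarrow> real" where
  "res \<sigma> i = \<sigma> i - t \<sigma> i"

lemma finite_Om: "finite Om"
  unfolding Om_def by (intro finite_PiE) auto

lemma Om_spin: "\<sigma> \<in> Om \<Longrightarrow> i < N \<Longrightarrow> \<sigma> i = -1 \<or> \<sigma> i = 1"
  by (auto simp: Om_def PiE_iff)

lemma Om_sq: "\<sigma> \<in> Om \<Longrightarrow> i < N \<Longrightarrow> \<sigma> i * \<sigma> i = 1"
  using Om_spin by fastforce

lemma Om_abs: "\<sigma> \<in> Om \<Longrightarrow> i < N \<Longrightarrow> \<bar>\<sigma> i\<bar> = 1"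
  using Om_spin by fastforce

lemma Om_nonempty: "Om \<noteq> {}"
  by (auto simp: Om_def PiE_eq_empty_iff)

lemma Z_pos: "0 < Z"
  unfolding Z_def by (intro sum_pos finite_Om Om_nonempty) (simp add: wt_def)

lemma Ex_add: "Ex (\<lambda>\<sigma>. f \<sigma> + g \<sigma>) = Ex f + Ex g"
  by (simp add: Ex_def algebra_simps sum.distrib add_divide_distrib)

lemma Ex_diff: "Ex (\<lambda>\<sigma>. f \<sigma> - g \<sigma>) = Ex f - Ex g"
  by (simp add: Ex_def algebra_simps sum_subtractf diff_divide_distrib)

lemma Ex_cmult: "Ex (\<lambda>\<sigma>. s * f \<sigma>) = s * Ex f"
  by (simp add: Ex_def sum_distrib_left mult_ac)

lemma Ex_const: "Ex (\<lambda>_. s) = s"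
  using Z_pos by (simp add: Ex_def sum_distrib_right[symmetric] Z_def[symmetric])

lemma Ex_sum: "Ex (\<lambda>\<sigma>. \<Sum>k\<in>K. f k \<sigma>) = (\<Sum>k\<in>K. Ex (f k))"
  unfolding Ex_def sum_distrib_left by (subst sum.swap) (simp add: sum_divide_distrib)

lemma Ex_cong: "(\<And>\<sigma>. \<sigma> \<in> Om \<Longrightarrow> f \<sigma> = g \<sigma>) \<Longrightarrow> Ex f = Ex g"
  by (simp add: Ex_def)

lemma Ex_mono: "(\<And>\<sigma>. \<sigma> \<in> Om \<Longrightarrow> f \<sigma> \<le> g \<sigma>) \<Longrightarrow> Ex f \<le> Ex g"
  unfolding Ex_def using Z_pos
  by (intro divide_right_mono sum_mono mult_left_mono) (auto simp: wt_def)

lemma Ex_nonneg: "(\<And>\<sigma>. \<sigma> \<in> Om \<Longrightarrow> 0 \<le> f \<sigma>) \<Longrightarrow> 0 \<le> Ex f"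
  using Ex_mono[of "\<lambda>_. 0" f] by (simp add: Ex_const)

lemma abs_Ex_le: "\<bar>Ex f\<bar> \<le> Ex (\<lambda>\<sigma>. \<bar>f \<sigma>\<bar>)"
proof -
  have "Ex f \<le> Ex (\<lambda>\<sigma>. \<bar>f \<sigma>\<bar>)" by (rule Ex_mono) simp
  moreover have "Ex (\<lambda>\<sigma>. (-1) * f \<sigma>) \<le> Ex (\<lambda>\<sigma>. \<bar>f \<sigma>\<bar>)" by (rule Ex_mono) simp
  ultimately show ?thesis unfolding Ex_cmult by simp
qed

lemma Ex_abs_sq_le: "(Ex (\<lambda>\<sigma>. \<bar>f \<sigma>\<bar>))\<^sup>2 \<le> Ex (\<lambda>\<sigma>. (f \<sigma>)\<^sup>2)"
proof -
  let ?e = "Ex (\<lambda>\<sigma>. \<bar>f \<sigma>\<bar>)"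
  have "0 \<le> Ex (\<lambda>\<sigma>. (\<bar>f \<sigma>\<bar> - ?e)\<^sup>2)" by (rule Ex_nonneg) simp
  also have "(\<lambda>\<sigma>. (\<bar>f \<sigma>\<bar> - ?e)\<^sup>2) = (\<lambda>\<sigma>. ((f \<sigma>)\<^sup>2 - (2 * ?e) * \<bar>f \<sigma>\<bar>) + ?e\<^sup>2)"
    by (simp add: power2_diff algebra_simps)
  finally show ?thesis by (simp only: Ex_add Ex_diff Ex_cmult Ex_const) (simp add: power2_eq_square)
qed

lemma flip_in: "\<sigma> \<in> Om \<Longrightarrow> i < N \<Longrightarrow> flip i \<sigma> \<in> Om"
  by (auto simp: Om_def PiE_iff flip_def extensional_def)

lemma flip_flip [simp]: "flip i (flip i \<sigma>) = \<sigma>"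
  by (auto simp: flip_def)

lemma bij_flip: "i < N \<Longrightarrow> bij_betw (flip i) Om Om"
  by (rule bij_betw_byWitness[of _ "flip i"]) (auto simp: flip_in)

lemma flip_eq: "flip i \<sigma> = (\<lambda>j. \<sigma> j + (-2 * \<sigma> i) * (if j = i then 1 else 0))"
  by (auto simp: flip_def)

lemma A_unit: "i < N \<Longrightarrow> A (\<lambda>j. if j = i then 1 else 0) k = a k i"
  by (simp add: A_def if_distrib[of "\<lambda>x. _ * x"] cong: if_cong)

lemma ip_unit: "i < N \<Longrightarrow> ip N (\<lambda>j. if j = i then 1 else 0) x = x i"
  by (simp add: ip_def if_distrib[of "\<lambda>y. y * _"] cong: if_cong)

lemma A_flip: "i < N \<Longrightarrow> A (flip i \<sigma>) k = A \<sigma> k - 2 * \<sigma> i * a k i"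
  unfolding flip_eq A_add A_scale by (simp add: A_unit)

lemma A_flip_same: "i < N \<Longrightarrow> A (flip i \<sigma>) i = A \<sigma> i"
  by (simp add: A_flip a_diag)

lemma t_flip_same: "i < N \<Longrightarrow> t (flip i \<sigma>) i = t \<sigma> i"
  by (simp add: t_def A_flip_same)

lemma wt_flip: assumes "i < N" shows "wt (flip i \<sigma>) = wt \<sigma> * exp (-2 * \<sigma> i * A \<sigma> i)"
proof -
  let ?e = "\<lambda>j. if j = i then 1 else 0 :: real"
  let ?s = "-2 * \<sigma> i"
  have Afl: "A (flip i \<sigma>) = (\<lambda>k. A \<sigma> k + ?s * A ?e k)"
    unfolding flip_eq A_add[abs_def] A_scale ..
  have "ip N (flip i \<sigma>) (A (flip i \<sigma>)) = ip N \<sigma> (A \<sigma>) + ?s * ip N \<sigma> (A ?e)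
      + ?s * (ip N ?e (A \<sigma>) + ?s * ip N ?e (A ?e))"
    unfolding Afl unfolding flip_eq ip_add_left ip_scale_left ip_add_right ip_scale_right ..
  also have "ip N \<sigma> (A ?e) = ip N ?e (A \<sigma>)" by (metis ip_A_sym ip_commute)
  also have "ip N ?e (A \<sigma>) = A \<sigma> i" using assms by (rule ip_unit)
  also have "ip N ?e (A ?e) = 0" using assms by (simp add: ip_unit A_unit a_diag)
  finally have "ip N (flip i \<sigma>) (A (flip i \<sigma>)) / 2 = ip N \<sigma> (A \<sigma>) / 2 + (-2 * \<sigma> i * A \<sigma> i)" by simp
  then show ?thesis by (simp only: wt_def exp_add)
qed

lemma exp_tanh_reflect: "exp (-2 * x) * (1 + tanh x) = 1 - tanh x" for x :: real
proof -
  have "1 + exp (-2 * x) > 0" by (simp add: add_pos_pos)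
  then show ?thesis unfolding tanh_real_altdef by (simp add: field_simps)
qed

text \<open>Detailed balance for one spin. Since \<open>a i i = 0\<close>, the field at
  \<open>i\<close> does not see the flip, and the ratio of the two weights is that of
  \<open>1 - tanh\<close> to \<open>1 + tanh\<close>. Every later moment bound goes back to this
  sign change.\<close>

lemma wt_res_flip:
  assumes "\<sigma> \<in> Om" "i < N"
  shows "wt (flip i \<sigma>) * res (flip i \<sigma>) i = - (wt \<sigma> * res \<sigma> i)"
proof -
  have r: "res (flip i \<sigma>) i = - (\<sigma> i + t \<sigma> i)"
    unfolding res_def t_flip_same[OF assms(2)] by (simp add: flip_def)
  have "exp (-2 * \<sigma> i * A \<sigma> i) * (\<sigma> i + t \<sigma> i) = res \<sigma> i"
    using Om_spin[OF assms]
  proof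
    assume s: "\<sigma> i = 1"
    show ?thesis using exp_tanh_reflect[of "A \<sigma> i"] by (simp add: s res_def t_def)
  next
    assume s: "\<sigma> i = - 1"
    show ?thesis using exp_tanh_reflect[of "- A \<sigma> i"] by (simp add: s res_def t_def algebra_simps)
  qed
  then show ?thesis unfolding r wt_flip[OF assms(2)] by (metis mult.assoc mult_minus_right)
qed

lemma Ex_res_flip:
  assumes i: "i < N"
  shows "Ex (\<lambda>\<sigma>. res \<sigma> i * F (flip i \<sigma>)) = - Ex (\<lambda>\<sigma>. res \<sigma> i * F \<sigma>)"
proof -
  have "(\<Sum>\<sigma>\<in>Om. wt \<sigma> * (res \<sigma> i * F \<sigma>)) = (\<Sum>\<sigma>\<in>Om. wt (flip i \<sigma>) * (res (flip i \<sigma>) i * F (flip i \<sigma>)))"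
    by (rule sum.reindex_bij_betw[OF bij_flip[OF i], symmetric])
  also have "\<dots> = (\<Sum>\<sigma>\<in>Om. - (wt \<sigma> * (res \<sigma> i * F (flip i \<sigma>))))"
    by (intro sum.cong refl) (simp only: mult.assoc[symmetric] wt_res_flip[OF _ i] mult_minus_left)
  finally show ?thesis by (simp add: Ex_def sum_negf)
qed

text \<open>In absolute value the antisymmetry becomes invariance, so a moment at the flipped
  configuration can be traded for the same moment at the original one.\<close>

lemma Ex_abs_res_flip:
  assumes i: "i < N"
  shows "Ex (\<lambda>\<sigma>. \<bar>res \<sigma> i\<bar> * F (flip i \<sigma>)) = Ex (\<lambda>\<sigma>. \<bar>res \<sigma> i\<bar> * F \<sigma>)"
proof -
  have e: "wt (flip i \<sigma>) * \<bar>res (flip i \<sigma>) i\<bar> = wt \<sigma> * \<bar>res \<sigma> i\<bar>" if "\<sigma> \<in> Om" for \<sigma>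
    using arg_cong[OF wt_res_flip[OF that i], of abs] by (simp add: abs_mult wt_def)
  have "(\<Sum>\<sigma>\<in>Om. wt \<sigma> * (\<bar>res \<sigma> i\<bar> * F \<sigma>)) = (\<Sum>\<sigma>\<in>Om. wt (flip i \<sigma>) * (\<bar>res (flip i \<sigma>) i\<bar> * F (flip i \<sigma>)))"
    by (rule sum.reindex_bij_betw[OF bij_flip[OF i], symmetric])
  also have "\<dots> = (\<Sum>\<sigma>\<in>Om. wt \<sigma> * (\<bar>res \<sigma> i\<bar> * F (flip i \<sigma>)))"
    by (intro sum.cong refl) (simp only: mult.assoc[symmetric] e)
  finally show ?thesis by (simp add: Ex_def)
qed

text \<open>Integration by parts on the cube: the residual is odd under the flip, hence only the odd
  part of \<open>F\<close> contributes.\<close>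

lemma stein_identity:
  assumes "i < N"
  shows "Ex (\<lambda>\<sigma>. res \<sigma> i * F \<sigma>) = Ex (\<lambda>\<sigma>. res \<sigma> i * (F \<sigma> - F (flip i \<sigma>))) / 2"
  using Ex_res_flip[OF assms, of F] by (simp add: right_diff_distrib Ex_diff)

lemma abs_t_le_1: "\<bar>t \<sigma> i\<bar> \<le> 1"
  using tanh_sq_le_one[of "A \<sigma> i"] by (simp add: t_def abs_square_le_1)

lemma abs_res_le: "\<sigma> \<in> Om \<Longrightarrow> i < N \<Longrightarrow> \<bar>res \<sigma> i\<bar> \<le> 2"
  using Om_abs[of \<sigma> i] abs_t_le_1[of \<sigma> i] unfolding res_def by linarith

lemma stein_identity_bound:
  assumes "i < N"
  shows "Ex (\<lambda>\<sigma>. res \<sigma> i * F \<sigma>) \<le> Ex (\<lambda>\<sigma>. \<bar>F \<sigma> - F (flip i \<sigma>)\<bar>)"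
proof -
  have "Ex (\<lambda>\<sigma>. res \<sigma> i * (F \<sigma> - F (flip i \<sigma>))) \<le> Ex (\<lambda>\<sigma>. 2 * \<bar>F \<sigma> - F (flip i \<sigma>)\<bar>)"
  proof (rule Ex_mono)
    fix \<sigma> assume "\<sigma> \<in> Om"
    then have "\<bar>res \<sigma> i\<bar> * \<bar>F \<sigma> - F (flip i \<sigma>)\<bar> \<le> 2 * \<bar>F \<sigma> - F (flip i \<sigma>)\<bar>"
      using assms by (intro mult_right_mono abs_res_le) auto
    then show "res \<sigma> i * (F \<sigma> - F (flip i \<sigma>)) \<le> 2 * \<bar>F \<sigma> - F (flip i \<sigma>)\<bar>"
      by (metis abs_ge_self abs_mult order_trans)
  qed
  then have "Ex (\<lambda>\<sigma>. res \<sigma> i * (F \<sigma> - F (flip i \<sigma>))) / 2 \<le> Ex (\<lambda>\<sigma>. \<bar>F \<sigma> - F (flip i \<sigma>)\<bar>)"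
    unfolding Ex_cmult by simp
  then show ?thesis by (subst stein_identity[OF assms])
qed

lemma Ex_spin_t:
  assumes "i < N" "\<And>\<sigma>. \<sigma> \<in> Om \<Longrightarrow> F (flip i \<sigma>) = F \<sigma>"
  shows "Ex (\<lambda>\<sigma>. \<sigma> i * F \<sigma>) = Ex (\<lambda>\<sigma>. t \<sigma> i * F \<sigma>)"
proof -
  have "Ex (\<lambda>\<sigma>. res \<sigma> i * (F \<sigma> - F (flip i \<sigma>))) = Ex (\<lambda>_. 0)"
    by (rule Ex_cong) (simp add: assms)
  then have "Ex (\<lambda>\<sigma>. res \<sigma> i * F \<sigma>) = 0" by (subst stein_identity[OF assms(1)]) (simp add: Ex_const)
  then show ?thesis by (simp add: res_def left_diff_distrib Ex_diff)
qed

section \<open>Moments of linear functionals of the noise\<close>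

lemma abs_power_diff_le:
  "\<bar>x ^ Suc n - y ^ Suc n\<bar> \<le> real (Suc n) * \<bar>x - y\<bar> * (\<bar>x\<bar> ^ n + \<bar>y\<bar> ^ n)" for x y :: real
proof -
  have "x ^ Suc n - y ^ Suc n = (x - y) * (\<Sum>p<Suc n. x ^ p * y ^ (n - p))" by (rule diff_power_eq_sum)
  then have e: "\<bar>x ^ Suc n - y ^ Suc n\<bar> = \<bar>x - y\<bar> * \<bar>\<Sum>p<Suc n. x ^ p * y ^ (n - p)\<bar>"
    by (simp only: abs_mult)
  have "\<bar>\<Sum>p<Suc n. x ^ p * y ^ (n - p)\<bar> \<le> (\<Sum>p<Suc n. \<bar>x\<bar> ^ n + \<bar>y\<bar> ^ n)"
  proof (intro order_trans[OF sum_abs] sum_mono)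
    fix p assume "p \<in> {..<Suc n}"
    then have p: "p + (n - p) = n" by simp
    let ?M = "max \<bar>x\<bar> \<bar>y\<bar>"
    have "\<bar>x ^ p * y ^ (n - p)\<bar> \<le> ?M ^ p * ?M ^ (n - p)"
      unfolding abs_mult power_abs by (intro mult_mono power_mono) auto
    also have "\<dots> = ?M ^ n" unfolding power_add[symmetric] p ..
    also have "\<dots> \<le> \<bar>x\<bar> ^ n + \<bar>y\<bar> ^ n" by (simp add: max_def)
    finally show "\<bar>x ^ p * y ^ (n - p)\<bar> \<le> \<bar>x\<bar> ^ n + \<bar>y\<bar> ^ n" .
  qed
  then have "\<bar>x ^ Suc n - y ^ Suc n\<bar> \<le> \<bar>x - y\<bar> * (\<Sum>p<Suc n. \<bar>x\<bar> ^ n + \<bar>y\<bar> ^ n)"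
    unfolding e by (rule mult_left_mono) simp
  also have "(\<Sum>p<Suc n. \<bar>x\<bar> ^ n + \<bar>y\<bar> ^ n) = real (Suc n) * (\<bar>x\<bar> ^ n + \<bar>y\<bar> ^ n)" by simp
  finally show ?thesis by (simp only: mult_ac)
qed

text \<open>The flip moves the spin at \<open>i\<close> by 2 and, tanh being 1-Lipschitz, each
  conditional mean \<open>t \<sigma> j\<close> by at most \<open>2 * a i j\<close>.\<close>

lemma noise_flip:
  assumes "\<sigma> \<in> Om" "i < N"
  shows "\<bar>ip N b (res \<sigma>) - ip N b (res (flip i \<sigma>))\<bar> \<le> 2 * (\<bar>b i\<bar> + A (\<lambda>j. \<bar>b j\<bar>) i)"
proof -
  have d: "\<bar>res \<sigma> j - res (flip i \<sigma>) j\<bar> \<le> 2 * (if j = i then 1 else 0) + 2 * a i j" if "j < N" for j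
  proof -
    have "\<bar>t \<sigma> j - t (flip i \<sigma>) j\<bar> \<le> \<bar>A \<sigma> j - A (flip i \<sigma>) j\<bar>" unfolding t_def by (rule tanh_lipschitz)
    also have "\<dots> = 2 * a i j"
      using that assms Om_abs[OF assms] a_nonneg a_sym by (simp add: A_flip abs_mult)
    finally have "\<bar>t \<sigma> j - t (flip i \<sigma>) j\<bar> \<le> 2 * a i j" .
    moreover have "\<bar>\<sigma> j - flip i \<sigma> j\<bar> = 2 * (if j = i then 1 else 0)"
      using Om_abs[OF assms] by (auto simp: flip_def)
    ultimately show ?thesis unfolding res_def by linarith
  qed
  have "\<bar>ip N b (res \<sigma>) - ip N b (res (flip i \<sigma>))\<bar> = \<bar>\<Sum>j<N. b j * (res \<sigma> j - res (flip i \<sigma>) j)\<bar>"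
    by (simp add: ip_def sum_subtractf right_diff_distrib)
  also have "\<dots> \<le> (\<Sum>j<N. \<bar>b j\<bar> * (2 * (if j = i then 1 else 0) + 2 * a i j))"
  proof (intro order_trans[OF sum_abs] sum_mono)
    fix j assume "j \<in> {..<N}"
    then show "\<bar>b j * (res \<sigma> j - res (flip i \<sigma>) j)\<bar> \<le> \<bar>b j\<bar> * (2 * (if j = i then 1 else 0) + 2 * a i j)"
      unfolding abs_mult using d[of j] by (intro mult_left_mono) auto
  qed
  also have "\<dots> = 2 * (\<bar>b i\<bar> + A (\<lambda>j. \<bar>b j\<bar>) i)"
    using assms(2) by (simp add: A_def algebra_simps sum.distrib sum_distrib_left if_distrib[of "\<lambda>x. _ * x"] cong: if_cong)
  finally show ?thesis .
qed

end

context gapped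
begin

text \<open>Sub-Gaussian growth by recursion on the exponent: one factor of the functional is
  expanded over the sites, and the Stein identity replaces the remaining odd power by its flip
  difference, lowering the degree by one more. With row sums at most 2, Schur's test gives the
  factor \<open>1 + 2\<close> in front of \<open>ip N b b\<close>, and
  \<open>12 * (2p + 1) <= 24 * (p + 1)\<close>.\<close>

lemma noise_moment:
  "Ex (\<lambda>\<sigma>. (ip N b (res \<sigma>)) ^ (2 * p)) \<le> (24 * real p * ip N b b) ^ p"
proof -
  have step: "Ex (\<lambda>\<sigma>. (ip N b (res \<sigma>)) ^ (2 * Suc p)) \<le> 24 * real (Suc p) * ip N b b * Ex (\<lambda>\<sigma>. (ip N b (res \<sigma>)) ^ (2 * p))" for p
  proof -
    let ?X = "\<lambda>\<sigma>. ip N b (res \<sigma>)"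
    let ?g = "\<lambda>i. \<bar>b i\<bar> + A (\<lambda>j. \<bar>b j\<bar>) i"
    let ?n = "2 * p"
    have g0: "0 \<le> ?g i" if "i < N" for i
      using that by (auto simp: A_def intro!: add_nonneg_nonneg sum_nonneg mult_nonneg_nonneg a_nonneg)
    have term_i: "b i * Ex (\<lambda>\<sigma>. res \<sigma> i * ?X \<sigma> ^ Suc ?n) \<le> 4 * real (Suc ?n) * (\<bar>b i\<bar> * ?g i) * Ex (\<lambda>\<sigma>. ?X \<sigma> ^ ?n)"
      if i: "i < N" for i
    proof -
      have "\<bar>Ex (\<lambda>\<sigma>. res \<sigma> i * ?X \<sigma> ^ Suc ?n)\<bar> = \<bar>Ex (\<lambda>\<sigma>. res \<sigma> i * (?X \<sigma> ^ Suc ?n - ?X (flip i \<sigma>) ^ Suc ?n))\<bar> / 2"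
        by (subst stein_identity[OF i]) simp
      also have "\<dots> \<le> Ex (\<lambda>\<sigma>. \<bar>res \<sigma> i * (?X \<sigma> ^ Suc ?n - ?X (flip i \<sigma>) ^ Suc ?n)\<bar>) / 2"
        by (intro divide_right_mono abs_Ex_le) auto
      also have "\<dots> \<le> Ex (\<lambda>\<sigma>. (2 * real (Suc ?n) * ?g i) * (\<bar>res \<sigma> i\<bar> * ?X \<sigma> ^ ?n + \<bar>res \<sigma> i\<bar> * ?X (flip i \<sigma>) ^ ?n)) / 2"
      proof (intro divide_right_mono Ex_mono)
        fix \<sigma> assume s: "\<sigma> \<in> Om"
        have "\<bar>?X \<sigma> ^ Suc ?n - ?X (flip i \<sigma>) ^ Suc ?n\<bar>
            \<le> real (Suc ?n) * \<bar>?X \<sigma> - ?X (flip i \<sigma>)\<bar> * (\<bar>?X \<sigma>\<bar> ^ ?n + \<bar>?X (flip i \<sigma>)\<bar> ^ ?n)"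
          by (rule abs_power_diff_le)
        also have "\<dots> \<le> real (Suc ?n) * (2 * ?g i) * (\<bar>?X \<sigma>\<bar> ^ ?n + \<bar>?X (flip i \<sigma>)\<bar> ^ ?n)"
          using noise_flip[OF s i] by (intro mult_right_mono mult_left_mono) auto
        finally have "\<bar>?X \<sigma> ^ Suc ?n - ?X (flip i \<sigma>) ^ Suc ?n\<bar>
            \<le> real (Suc ?n) * (2 * ?g i) * (?X \<sigma> ^ ?n + ?X (flip i \<sigma>) ^ ?n)" by (simp only: power_even_abs even_mult_iff even_numeral simp_thms)
        then have "\<bar>res \<sigma> i\<bar> * \<bar>?X \<sigma> ^ Suc ?n - ?X (flip i \<sigma>) ^ Suc ?n\<bar> \<le>
            \<bar>res \<sigma> i\<bar> * (real (Suc ?n) * (2 * ?g i) * (?X \<sigma> ^ ?n + ?X (flip i \<sigma>) ^ ?n))"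
          by (rule mult_left_mono) simp
        then show "\<bar>res \<sigma> i * (?X \<sigma> ^ Suc ?n - ?X (flip i \<sigma>) ^ Suc ?n)\<bar> \<le>
            (2 * real (Suc ?n) * ?g i) * (\<bar>res \<sigma> i\<bar> * ?X \<sigma> ^ ?n + \<bar>res \<sigma> i\<bar> * ?X (flip i \<sigma>) ^ ?n)"
          unfolding abs_mult by (simp only: mult_ac distrib_left)
      qed simp
      also have "\<dots> = (2 * real (Suc ?n) * ?g i) * Ex (\<lambda>\<sigma>. \<bar>res \<sigma> i\<bar> * ?X \<sigma> ^ ?n)"
        unfolding Ex_cmult Ex_add Ex_abs_res_flip[OF i, of "\<lambda>\<sigma>. ?X \<sigma> ^ ?n"] by simp
      also have "\<dots> \<le> (2 * real (Suc ?n) * ?g i) * Ex (\<lambda>\<sigma>. 2 * ?X \<sigma> ^ ?n)"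
      proof (intro mult_left_mono Ex_mono)
        fix \<sigma> assume "\<sigma> \<in> Om"
        then show "\<bar>res \<sigma> i\<bar> * ?X \<sigma> ^ ?n \<le> 2 * ?X \<sigma> ^ ?n"
          using abs_res_le[of \<sigma> i] i by (intro mult_right_mono) (auto simp: power_mult)
      qed (use g0[OF i] in simp)
      finally have "\<bar>Ex (\<lambda>\<sigma>. res \<sigma> i * ?X \<sigma> ^ Suc ?n)\<bar> \<le> 4 * real (Suc ?n) * ?g i * Ex (\<lambda>\<sigma>. ?X \<sigma> ^ ?n)"
        unfolding Ex_cmult by (simp only: mult_ac)
      then have "\<bar>b i\<bar> * \<bar>Ex (\<lambda>\<sigma>. res \<sigma> i * ?X \<sigma> ^ Suc ?n)\<bar> \<le> \<bar>b i\<bar> * (4 * real (Suc ?n) * ?g i * Ex (\<lambda>\<sigma>. ?X \<sigma> ^ ?n))"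
        by (rule mult_left_mono) simp
      moreover have "b i * Ex (\<lambda>\<sigma>. res \<sigma> i * ?X \<sigma> ^ Suc ?n) \<le> \<bar>b i\<bar> * \<bar>Ex (\<lambda>\<sigma>. res \<sigma> i * ?X \<sigma> ^ Suc ?n)\<bar>"
        unfolding abs_mult[symmetric] by (rule abs_ge_self)
      ultimately show ?thesis by (simp only: mult_ac)
    qed
    have E0: "0 \<le> Ex (\<lambda>\<sigma>. ?X \<sigma> ^ ?n)" by (rule Ex_nonneg) (simp add: power_mult)
    have "Ex (\<lambda>\<sigma>. ?X \<sigma> ^ (2 * Suc p)) = Ex (\<lambda>\<sigma>. \<Sum>i<N. b i * (res \<sigma> i * ?X \<sigma> ^ Suc ?n))"
    proof (rule Ex_cong)
      fix \<sigma>
      have "?X \<sigma> ^ (2 * Suc p) = ?X \<sigma> * ?X \<sigma> ^ Suc ?n" by simp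
      also have "\<dots> = (\<Sum>i<N. b i * (res \<sigma> i * ?X \<sigma> ^ Suc ?n))"
        unfolding ip_def[of N b "res \<sigma>"] sum_distrib_right by (simp only: mult.assoc)
      finally show "?X \<sigma> ^ (2 * Suc p) = (\<Sum>i<N. b i * (res \<sigma> i * ?X \<sigma> ^ Suc ?n))" .
    qed
    also have "\<dots> = (\<Sum>i<N. b i * Ex (\<lambda>\<sigma>. res \<sigma> i * ?X \<sigma> ^ Suc ?n))"
      unfolding Ex_sum Ex_cmult ..
    also have "\<dots> \<le> (\<Sum>i<N. 4 * real (Suc ?n) * (\<bar>b i\<bar> * ?g i) * Ex (\<lambda>\<sigma>. ?X \<sigma> ^ ?n))"
      using term_i by (intro sum_mono) auto
    also have "\<dots> = 4 * real (Suc ?n) * (\<Sum>i<N. \<bar>b i\<bar> * ?g i) * Ex (\<lambda>\<sigma>. ?X \<sigma> ^ ?n)"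
      by (simp add: sum_distrib_left sum_distrib_right mult_ac)
    also have "\<dots> \<le> 4 * real (Suc ?n) * (3 * ip N b b) * Ex (\<lambda>\<sigma>. ?X \<sigma> ^ ?n)"
    proof (intro mult_right_mono[OF _ E0] mult_left_mono)
      have "(\<Sum>i<N. \<bar>b i\<bar> * ?g i) = ip N b b + ip N (\<lambda>i. \<bar>b i\<bar>) (A (\<lambda>j. \<bar>b j\<bar>))"
        by (simp add: ip_def algebra_simps sum.distrib)
      also have "ip N (\<lambda>i. \<bar>b i\<bar>) (A (\<lambda>j. \<bar>b j\<bar>)) \<le> 2 * (ip N (\<lambda>i. \<bar>b i\<bar>) (\<lambda>i. \<bar>b i\<bar>) + ip N (\<lambda>i. \<bar>b i\<bar>) (\<lambda>i. \<bar>b i\<bar>)) / 2"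
        by (rule order_trans[OF abs_ge_self schur_test[OF R_le_2]])
      finally show "(\<Sum>i<N. \<bar>b i\<bar> * ?g i) \<le> 3 * ip N b b" by (simp add: ip_def)
    qed simp
    also have "\<dots> \<le> 24 * real (Suc p) * ip N b b * Ex (\<lambda>\<sigma>. ?X \<sigma> ^ ?n)"
    proof (rule mult_right_mono[OF _ E0])
      have "4 * real (Suc ?n) * (3 * ip N b b) = (12 * real (Suc ?n)) * ip N b b" by simp
      also have "\<dots> \<le> (24 * real (Suc p)) * ip N b b" by (intro mult_right_mono) auto
      finally show "4 * real (Suc ?n) * (3 * ip N b b) \<le> 24 * real (Suc p) * ip N b b" .
    qed
    finally show ?thesis .
  qed
  \<comment> \<open>Each step of the recursion uses the final \<open>p\<close> in place of
    \<open>Suc k\<close>, so the product is a pure power.\<close>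
  have "Ex (\<lambda>\<sigma>. (ip N b (res \<sigma>)) ^ (2 * k)) \<le> (24 * real p * ip N b b) ^ k" if "k \<le> p" for k
    using that
  proof (induction k)
    case 0
    show ?case by (simp add: Ex_const)
  next
    case (Suc k)
    have "24 * real (Suc k) * ip N b b * Ex (\<lambda>\<sigma>. (ip N b (res \<sigma>)) ^ (2 * k)) \<le> 24 * real p * ip N b b * (24 * real p * ip N b b) ^ k"
    proof (rule mult_mono)
      show "24 * real (Suc k) * ip N b b \<le> 24 * real p * ip N b b"
        using Suc.prems by (intro mult_right_mono) auto
      show "Ex (\<lambda>\<sigma>. (ip N b (res \<sigma>)) ^ (2 * k)) \<le> (24 * real p * ip N b b) ^ k"
        using Suc by simp
      show "0 \<le> Ex (\<lambda>\<sigma>. (ip N b (res \<sigma>)) ^ (2 * k))" by (rule Ex_nonneg) (simp add: power_mult)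
    qed simp
    then show ?case using step[of k] by simp
  qed
  then show ?thesis by simp
qed

lemma noise_second_moment: "Ex (\<lambda>\<sigma>. (ip N b (res \<sigma>))\<^sup>2) \<le> 24 * ip N b b"
  using noise_moment[of b 1] by simp

end

lemma avg_diff: "avg N (\<lambda>i. x i - y i) = avg N x - avg N y"
  by (simp add: avg_def sum_subtractf diff_divide_distrib)

lemma avg_scale: "avg N (\<lambda>i. s * x i) = s * avg N x"
  by (simp add: avg_def sum_distrib_left)

lemma abs_avg_le: "\<bar>avg N x\<bar> \<le> nm N x / sqrt (real N)"
proof (cases "N = 0")
  case False
  have "\<bar>\<Sum>i<N. x i\<bar> \<le> sqrt (real N) * nm N x" using sum_abs[of x "{..<N}"] sum_abs_le_nm[where x = x and N = N] by linarith
  then have "\<bar>avg N x\<bar> \<le> sqrt (real N) * nm N x / real N"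
    by (simp add: avg_def divide_right_mono)
  also have "\<dots> = nm N x / sqrt (real N)"
    using False real_sqrt_mult_self[of "real N"] by (simp add: field_simps)
  finally show ?thesis .
qed (simp add: avg_def)

lemma abs_avg_bound: "(\<And>i. i < N \<Longrightarrow> \<bar>x i\<bar> \<le> s) \<Longrightarrow> 0 \<le> s \<Longrightarrow> \<bar>avg N x\<bar> \<le> s"
proof (cases "N = 0")
  case False
  assume "\<And>i. i < N \<Longrightarrow> \<bar>x i\<bar> \<le> s"
  then have "\<bar>\<Sum>i<N. x i\<bar> \<le> (\<Sum>i<N. s)" by (intro order_trans[OF sum_abs] sum_mono) auto
  then show ?thesis using False by (simp add: avg_def field_simps)
qed (simp add: avg_def)

text \<open>A Young inequality by comparing \<open>x\<close> with \<open>\<tau> * s\<close>;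
  \<open>\<tau>\<close> is the share of the quartic term that will be absorbed.\<close>

lemma weighted_cube_le:
  fixes x s \<tau> :: real
  assumes "0 < \<tau>" "0 \<le> x" "0 \<le> s"
  shows "x * s ^ 3 \<le> \<tau> * s ^ 4 + x ^ 4 / \<tau> ^ 3"
proof (cases "x \<le> \<tau> * s")
  case True
  then have "x * s ^ 3 \<le> (\<tau> * s) * s ^ 3" using assms by (intro mult_right_mono) auto
  also have "\<dots> = \<tau> * s ^ 4" by (simp add: power_numeral_reduce)
  finally show ?thesis using assms by (simp add: add_increasing2)
next
  case False
  then have "s \<le> x / \<tau>" using assms by (simp add: field_simps)
  then have "x * s ^ 3 \<le> x * (x / \<tau>) ^ 3" using assms by (intro mult_left_mono power_mono) auto
  also have "\<dots> = x ^ 4 / \<tau> ^ 3" by (simp add: power_divide power_numeral_reduce)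
  finally show ?thesis using assms by (simp add: add_increasing)
qed

lemma power4_sum_le: "(x + y) ^ 4 \<le> 8 * (x ^ 4 + y ^ 4)" for x y :: real
proof -
  have "(x + y)\<^sup>2 \<le> 2 * (x\<^sup>2 + y\<^sup>2)" using sum_squares_bound[of x y] by (simp add: power2_sum)
  then have "((x + y)\<^sup>2)\<^sup>2 \<le> (2 * (x\<^sup>2 + y\<^sup>2))\<^sup>2" by (intro power_mono) auto
  also have "\<dots> = 4 * (x\<^sup>2 + y\<^sup>2)\<^sup>2" unfolding power_mult_distrib by simp
  also have "(x\<^sup>2 + y\<^sup>2)\<^sup>2 \<le> 2 * ((x\<^sup>2)\<^sup>2 + (y\<^sup>2)\<^sup>2)"
    using sum_squares_bound[of "x\<^sup>2" "y\<^sup>2"] by (simp add: power2_sum)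
  finally show ?thesis by (simp add: power_mult[symmetric])
qed

section \<open>The centred field\<close>

context coupling
begin

definition mb :: "(nat \<Rightarrow> real) \<Rightarrow> real" where "mb \<sigma> = avg N (A \<sigma>)"
definition u :: "(nat \<Rightarrow> real) \<Rightarrow> nat \<Rightarrow> real" where "u \<sigma> = cen N (A \<sigma>)"
definition U :: "(nat \<Rightarrow> real) \<Rightarrow> real" where "U \<sigma> = ip N (u \<sigma>) (u \<sigma>)"
definition tb :: "(nat \<Rightarrow> real) \<Rightarrow> real" where "tb \<sigma> = avg N (t \<sigma>)"
definition alpha :: "nat \<Rightarrow> real" where "alpha i = (\<Sum>j<N. (a i j)\<^sup>2)"
text \<open>The squared Frobenius norm of the coupling matrix.\<close>

definition Fr :: real where "Fr = (\<Sum>i<N. alpha i)"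

lemma U_nonneg [simp]: "0 \<le> U \<sigma>" by (simp add: U_def)

lemma sqrt_U: "sqrt (U \<sigma>) = nm N (u \<sigma>)" by (simp add: U_def nm_def)

lemma sum_u: "(\<Sum>i<N. u \<sigma> i) = 0" by (simp add: u_def sum_cen)

lemma A_eq_u: "A \<sigma> i = mb \<sigma> + u \<sigma> i" by (simp add: u_def mb_def cen_def)

lemma alpha_nonneg: "0 \<le> alpha i" by (simp add: alpha_def sum_nonneg)

lemma Fr_nonneg: "0 \<le> Fr" by (simp add: Fr_def sum_nonneg alpha_nonneg)

lemma alpha_le_R: "i < N \<Longrightarrow> alpha i \<le> (R i)\<^sup>2"
proof -
  assume i: "i < N"
  have "alpha i \<le> (\<Sum>j<N. a i j * R i)" unfolding alpha_def
  proof (rule sum_mono)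
    fix j assume j: "j \<in> {..<N}"
    have "a i j \<le> R i" unfolding R_def using j i a_nonneg by (intro member_le_sum) auto
    then show "(a i j)\<^sup>2 \<le> a i j * R i"
      unfolding power2_eq_square using i j a_nonneg by (intro mult_left_mono) auto
  qed
  then show ?thesis by (simp add: sum_distrib_right[symmetric] R_def power2_eq_square)
qed

text \<open>The energy identity. The noise on the left has a small expectation by the Stein
  identity, the first two terms on the right dominate a multiple of \<open>U\<close> by
  \<open>contraction\<close>, and the last term is the price of unequal row sums.\<close>

lemma ip_res_A_u:
  "ip N (res \<sigma>) (A (u \<sigma>)) = U \<sigma> - ip N (cen N (t \<sigma>)) (A (u \<sigma>)) - tb \<sigma> * ip N c (u \<sigma>)"
proof -
  have tv: "t \<sigma> i = cen N (t \<sigma>) i + tb \<sigma>" for i by (simp add: cen_def tb_def)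
  have "ip N (t \<sigma>) (A (u \<sigma>)) = ip N (\<lambda>i. cen N (t \<sigma>) i + tb \<sigma>) (A (u \<sigma>))"
    by (rule ip_cong) (rule tv, rule refl)
  also have "\<dots> = ip N (cen N (t \<sigma>)) (A (u \<sigma>)) + tb \<sigma> * ip N c (u \<sigma>)"
    unfolding ip_add_left ip_const_left sum_A sum_u by simp
  finally have e1: "ip N (t \<sigma>) (A (u \<sigma>)) = ip N (cen N (t \<sigma>)) (A (u \<sigma>)) + tb \<sigma> * ip N c (u \<sigma>)" .
  have "ip N \<sigma> (A (u \<sigma>)) = ip N (A \<sigma>) (u \<sigma>)" by (rule ip_A_sym)
  also have "\<dots> = ip N (u \<sigma>) (A \<sigma>)" by (rule ip_commute)
  also have "\<dots> = U \<sigma>" unfolding U_def u_def by (rule ip_cen_left)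
  finally show ?thesis using e1 unfolding res_def[abs_def] ip_diff_left by simp
qed

lemma u_flip:
  assumes "i < N"
  shows "u (flip i \<sigma>) k = u \<sigma> k - 2 * \<sigma> i * cen N (\<lambda>k. a k i) k"
proof -
  have "A (flip i \<sigma>) = (\<lambda>k. A \<sigma> k - 2 * \<sigma> i * a k i)" using A_flip[OF assms] by blast
  then show ?thesis unfolding u_def cen_def by (simp add: avg_diff avg_scale algebra_simps)
qed

text \<open>A flip changes \<open>u\<close> along a single centred column, of squared length
  \<open>P \<le> alpha i\<close>, so both factors change explicitly. The constants come from
  \<open>(|y| + 2P) (4|y| + 4P) <= 10 y^2 + 14 P^2\<close>.\<close>

lemma energy_flip:
  assumes s: "\<sigma> \<in> Om" and i: "i < N"
  defines "y \<equiv> A (u \<sigma>) i"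
  shows "\<bar>A (u \<sigma>) i * U \<sigma> - A (u (flip i \<sigma>)) i * U (flip i \<sigma>)\<bar>
    \<le> 2 * alpha i * U \<sigma> + 10 * y\<^sup>2 + 14 * (alpha i)\<^sup>2"
proof -
  let ?e = "\<lambda>k. a k i" and ?s = "2 * \<sigma> i"
  let ?p = "cen N ?e"
  define P where "P = ip N ?p ?p"
  have P0: "0 \<le> P" by (simp add: P_def)
  have Pa: "P \<le> alpha i"
  proof -
    have "P = (nm N ?p)\<^sup>2" by (simp add: P_def nm_sq)
    also have "\<dots> \<le> (nm N ?e)\<^sup>2" by (intro power_mono nm_cen_le) auto
    also have "\<dots> = alpha i" using i a_sym by (simp add: nm_sq ip_self_eq alpha_def)
    finally show ?thesis .
  qed
  have Ai: "A x i = ip N ?e x" for x using i a_sym by (simp add: A_def ip_def)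
  have uf: "u (flip i \<sigma>) = (\<lambda>k. u \<sigma> k - ?s * ?p k)" using u_flip[OF i] by blast
  have pe: "ip N ?e ?p = P" unfolding P_def by (subst ip_commute) (rule ip_cen_left)
  have Af: "A (u (flip i \<sigma>)) i = y - ?s * P"
    unfolding uf A_diff A_scale y_def Ai pe ..
  have up: "ip N (u \<sigma>) ?p = y"
    unfolding y_def Ai u_def by (subst ip_commute[of N ?e]) (rule ip_cen_left[symmetric])
  have "U (flip i \<sigma>) = U \<sigma> - 2 * ?s * y + ?s * ?s * P"
    unfolding U_def uf ip_diff_left ip_diff_right ip_scale_left ip_scale_right
    using up ip_commute[of N ?p "u \<sigma>"] by (simp add: P_def algebra_simps)
  also have "?s * ?s = 4" using Om_sq[OF s i] by simp
  finally have Uf: "U (flip i \<sigma>) = U \<sigma> - 2 * ?s * y + 4 * P" by simp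
  have "y * U \<sigma> - (y - ?s * P) * (U \<sigma> - 2 * ?s * y + 4 * P)
      = ?s * P * U \<sigma> + (y - ?s * P) * (2 * ?s * y - 4 * P)" by (simp add: algebra_simps)
  also have "\<bar>\<dots>\<bar> \<le> \<bar>?s * P * U \<sigma>\<bar> + \<bar>(y - ?s * P) * (2 * ?s * y - 4 * P)\<bar>" by (rule abs_triangle_ineq)
  also have "\<bar>?s * P * U \<sigma>\<bar> = 2 * P * U \<sigma>" using Om_abs[OF s i] P0 by (simp add: abs_mult)
  also have "\<bar>(y - ?s * P) * (2 * ?s * y - 4 * P)\<bar> \<le> (\<bar>y\<bar> + 2 * P) * (4 * \<bar>y\<bar> + 4 * P)"
    unfolding abs_mult
  proof (rule mult_mono)
    have "\<bar>?s * P\<bar> = 2 * P" "\<bar>2 * ?s * y\<bar> = 4 * \<bar>y\<bar>" using Om_abs[OF s i] P0 by (simp_all add: abs_mult)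
    then show "\<bar>y - ?s * P\<bar> \<le> \<bar>y\<bar> + 2 * P" "\<bar>2 * ?s * y - 4 * P\<bar> \<le> 4 * \<bar>y\<bar> + 4 * P"
      using P0 by linarith+
  qed (use P0 in auto)
  also have "\<dots> \<le> 10 * y\<^sup>2 + 14 * P\<^sup>2"
    using sum_squares_bound[of "\<bar>y\<bar>" P] by (simp add: power2_eq_square algebra_simps)
  also have "2 * P * U \<sigma> + (10 * y\<^sup>2 + 14 * P\<^sup>2) \<le> 2 * alpha i * U \<sigma> + (10 * y\<^sup>2 + 14 * (alpha i)\<^sup>2)"
    using P0 Pa by (intro add_mono mult_right_mono mult_left_mono power_mono) auto
  finally show ?thesis by (simp add: Af Uf y_def)
qed

lemma tb_le: "\<bar>tb \<sigma>\<bar> \<le> \<bar>mb \<sigma>\<bar> + nm N (u \<sigma>) / sqrt (real N)"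
proof -
  have "tb \<sigma> - tanh (mb \<sigma>) = avg N (\<lambda>i. t \<sigma> i - tanh (mb \<sigma>))"
    using N_pos by (simp add: avg_diff tb_def) (simp add: avg_def)
  then have "\<bar>tb \<sigma> - tanh (mb \<sigma>)\<bar> \<le> nm N (\<lambda>i. t \<sigma> i - tanh (mb \<sigma>)) / sqrt (real N)"
    using abs_avg_le[of N "\<lambda>i. t \<sigma> i - tanh (mb \<sigma>)"] by simp
  also have "\<dots> \<le> nm N (\<lambda>i. \<bar>u \<sigma> i\<bar>) / sqrt (real N)"
    using tanh_lipschitz by (intro divide_right_mono nm_mono) (auto simp: t_def A_eq_u intro: order_trans[OF tanh_lipschitz])
  also have "nm N (\<lambda>i. \<bar>u \<sigma> i\<bar>) = nm N (u \<sigma>)" by (simp add: nm_def ip_def)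
  finally show ?thesis using abs_tanh_le[of "mb \<sigma>"] by linarith
qed

end

context gapped
begin

text \<open>By cocoercivity the reflected vector \<open>2 v - u\<close>, with \<open>v\<close> the
  centred conditional means, is no longer than \<open>u\<close>. Thus \<open>v\<close> is the
  average of \<open>u\<close>, on which the gap acts, and of a vector on which Schur's test loses
  only \<open>1 + \<kappa>\<close>. The lower end of the spectrum does not matter.\<close>

lemma contraction: "ip N (cen N (t \<sigma>)) (A (u \<sigma>)) \<le> (1 - \<delta> / 4) * U \<sigma>"
proof -
  let ?v = "cen N (t \<sigma>)"
  let ?w = "\<lambda>i. 2 * ?v i - u \<sigma> i"
  have t: "t \<sigma> = (\<lambda>i. tanh (A \<sigma> i))" by (simp add: t_def[abs_def])
  have coc: "ip N ?v ?v \<le> ip N (u \<sigma>) ?v" unfolding t u_def by (rule ip_cen_tanh_cocoercive)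
  have "ip N ?w ?w = 4 * ip N ?v ?v - 4 * ip N (u \<sigma>) ?v + U \<sigma>"
    unfolding ip_diff_left ip_diff_right ip_scale_left ip_scale_right U_def
    using ip_commute[of N ?v "u \<sigma>"] by simp
  with coc have w: "ip N ?w ?w \<le> U \<sigma>" by simp
  have "ip N ?w (A (u \<sigma>)) \<le> (1 + \<kappa>) * (ip N ?w ?w + U \<sigma>) / 2"
    unfolding U_def by (rule order_trans[OF abs_ge_self schur_test[OF R_le]])
  also have "\<dots> \<le> (1 + \<kappa>) * (U \<sigma> + U \<sigma>) / 2"
    using w \<kappa>_nonneg by (intro divide_right_mono mult_left_mono add_mono) auto
  finally have "ip N ?w (A (u \<sigma>)) \<le> (1 + \<kappa>) * U \<sigma>" by simp
  moreover have "ip N (u \<sigma>) (A (u \<sigma>)) \<le> (1 - \<delta>) * U \<sigma>"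
    unfolding U_def by (rule gap[OF sum_u])
  moreover have "ip N ?w (A (u \<sigma>)) = 2 * ip N ?v (A (u \<sigma>)) - ip N (u \<sigma>) (A (u \<sigma>))"
    unfolding ip_diff_left ip_scale_left ..
  ultimately have "2 * ip N ?v (A (u \<sigma>)) \<le> (1 + \<kappa>) * U \<sigma> + (1 - \<delta>) * U \<sigma>" by simp
  also have "\<dots> = (2 + \<kappa> - \<delta>) * U \<sigma>" by (simp add: algebra_simps)
  also have "\<dots> \<le> (2 - \<delta> / 2) * U \<sigma>"
    using \<kappa>_le \<delta>_pos by (intro mult_right_mono) auto
  finally show ?thesis by (simp add: field_simps)
qed

lemma sum_alpha_sq: "(\<Sum>i<N. (alpha i)\<^sup>2) \<le> 4 * Fr"
proof -
  have "(\<Sum>i<N. (alpha i)\<^sup>2) \<le> (\<Sum>i<N. 4 * alpha i)"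
  proof (rule sum_mono)
    fix i assume i: "i \<in> {..<N}"
    have R0: "0 \<le> R i" unfolding R_def using i a_nonneg by (intro sum_nonneg) auto
    have "alpha i \<le> (R i)\<^sup>2" using i by (intro alpha_le_R) simp
    also have "\<dots> \<le> 2\<^sup>2" using R_le_2[of i] i R0 by (intro power_mono) auto
    finally show "(alpha i)\<^sup>2 \<le> 4 * alpha i"
      unfolding power2_eq_square using alpha_nonneg by (intro mult_right_mono) auto
  qed
  then show ?thesis by (simp add: Fr_def sum_distrib_left)
qed

text \<open>The energy identity is weighted with \<open>U\<close> in order to reach the second
  moment. The squares \<open>(A (u \<sigma>) i)^2\<close> produced by the flips sum to at most
  \<open>4 U\<close>.\<close>

lemma Ex_energy_res:
  "Ex (\<lambda>\<sigma>. ip N (res \<sigma>) (A (u \<sigma>)) * U \<sigma>) \<le> Ex (\<lambda>\<sigma>. 2 * Fr * U \<sigma> + 40 * U \<sigma> + 56 * Fr)"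
proof -
  have "Ex (\<lambda>\<sigma>. ip N (res \<sigma>) (A (u \<sigma>)) * U \<sigma>) = (\<Sum>i<N. Ex (\<lambda>\<sigma>. res \<sigma> i * (A (u \<sigma>) i * U \<sigma>)))"
    unfolding Ex_sum[symmetric] ip_def sum_distrib_right by (simp only: mult.assoc)
  also have "\<dots> \<le> (\<Sum>i<N. Ex (\<lambda>\<sigma>. 2 * alpha i * U \<sigma> + 10 * (A (u \<sigma>) i)\<^sup>2 + 14 * (alpha i)\<^sup>2))"
  proof (rule sum_mono)
    fix i assume "i \<in> {..<N}"
    then have i: "i < N" by simp
    show "Ex (\<lambda>\<sigma>. res \<sigma> i * (A (u \<sigma>) i * U \<sigma>)) \<le> Ex (\<lambda>\<sigma>. 2 * alpha i * U \<sigma> + 10 * (A (u \<sigma>) i)\<^sup>2 + 14 * (alpha i)\<^sup>2)"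
      by (rule order_trans[OF stein_identity_bound[OF i] Ex_mono]) (rule energy_flip[OF _ i])
  qed
  also have "\<dots> = Ex (\<lambda>\<sigma>. \<Sum>i<N. 2 * alpha i * U \<sigma> + 10 * (A (u \<sigma>) i)\<^sup>2 + 14 * (alpha i)\<^sup>2)"
    by (rule Ex_sum[symmetric])
  also have "\<dots> \<le> Ex (\<lambda>\<sigma>. 2 * Fr * U \<sigma> + 40 * U \<sigma> + 56 * Fr)"
  proof (rule Ex_mono)
    fix \<sigma>
    have "(\<Sum>i<N. 2 * alpha i * U \<sigma> + 10 * (A (u \<sigma>) i)\<^sup>2 + 14 * (alpha i)\<^sup>2)
      = 2 * Fr * U \<sigma> + 10 * (nm N (A (u \<sigma>)))\<^sup>2 + 14 * (\<Sum>i<N. (alpha i)\<^sup>2)"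
      by (simp add: sum.distrib Fr_def nm_sq ip_self_eq sum_distrib_left sum_distrib_right mult_ac)
    also have "\<dots> \<le> 2 * Fr * U \<sigma> + 10 * (2 * nm N (u \<sigma>))\<^sup>2 + 14 * (4 * Fr)"
      using sum_alpha_sq by (intro add_mono mult_left_mono power_mono nm_A_le_2 order_refl) auto
    also have "\<dots> = 2 * Fr * U \<sigma> + 40 * U \<sigma> + 56 * Fr" by (simp add: power_mult_distrib nm_sq U_def)
    finally show "(\<Sum>i<N. 2 * alpha i * U \<sigma> + 10 * (A (u \<sigma>) i)\<^sup>2 + 14 * (alpha i)\<^sup>2) \<le> 2 * Fr * U \<sigma> + 40 * U \<sigma> + 56 * Fr" .
  qed
  finally show ?thesis .
qed

text \<open>Of the available \<open>\<delta> / 4\<close> times \<open>U^2\<close>, four portions of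
  \<open>\<delta> / 32\<close> absorb the error terms and \<open>\<delta> / 8\<close> remains. The
  row-sum error leaves the fourth moment of \<open>mb\<close> on the right, a feedback that is
  closed only in \<open>H_bound\<close>; \<open>large\<close> absorbs the part of this error that is
  quadratic in \<open>U\<close>.\<close>

lemma energy_second_moment:
  assumes large: "8 * 32 ^ 4 * (real N * \<kappa> ^ 4) / \<delta> ^ 4 \<le> real N"
  shows "\<delta> / 8 * Ex (\<lambda>\<sigma>. (U \<sigma>)\<^sup>2) \<le> 32 / \<delta> * Fr\<^sup>2 + 12800 / \<delta> + 56 * Fr
    + 8 * (32 / \<delta>) ^ 3 * (real N * \<kappa> ^ 4) * (real N * Ex (\<lambda>\<sigma>. (mb \<sigma>) ^ 4))"
proof -
  let ?B = "8 * (32 / \<delta>) ^ 3 * (real N * \<kappa> ^ 4)"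
  let ?n = "real N"
  have n: "0 < ?n" using N_pos by simp
  have path: "\<delta> / 8 * (U \<sigma>)\<^sup>2 + (2 * Fr * U \<sigma> + 40 * U \<sigma> + 56 * Fr) \<le>
     (32 / \<delta> * Fr\<^sup>2 + 12800 / \<delta> + 56 * Fr + ?B * (?n * (mb \<sigma>) ^ 4)) + ip N (res \<sigma>) (A (u \<sigma>)) * U \<sigma>" for \<sigma>
  proof -
    define s where "s = nm N (u \<sigma>)"
    have s0: "0 \<le> s" by (simp add: s_def)
    have sU: "s\<^sup>2 = U \<sigma>" by (simp add: s_def nm_sq U_def)
    let ?x = "\<bar>tb \<sigma>\<bar> * (sqrt ?n * \<kappa>)"
    have id: "ip N (res \<sigma>) (A (u \<sigma>)) * U \<sigma> \<ge> \<delta> / 4 * (U \<sigma>)\<^sup>2 - ?x * s ^ 3"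
    proof -
      have "\<bar>ip N c (u \<sigma>)\<bar> \<le> (sqrt ?n * \<kappa>) * s"
        unfolding s_def by (rule order_trans[OF abs_ip_le mult_right_mono[OF nm_c]]) simp
      then have "\<bar>tb \<sigma>\<bar> * \<bar>ip N c (u \<sigma>)\<bar> \<le> \<bar>tb \<sigma>\<bar> * ((sqrt ?n * \<kappa>) * s)"
        by (rule mult_left_mono) simp
      then have "tb \<sigma> * ip N c (u \<sigma>) \<le> ?x * s"
        unfolding abs_mult[symmetric] by (simp only: mult.assoc abs_le_iff)
      then have "\<delta> / 4 * U \<sigma> - ?x * s \<le> ip N (res \<sigma>) (A (u \<sigma>))"
        unfolding ip_res_A_u using contraction[of \<sigma>] by (simp add: algebra_simps)
      then have "(\<delta> / 4 * U \<sigma> - ?x * s) * U \<sigma> \<le> ip N (res \<sigma>) (A (u \<sigma>)) * U \<sigma>"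
        by (rule mult_right_mono) simp
      moreover have "(\<delta> / 4 * U \<sigma> - ?x * s) * U \<sigma> = \<delta> / 4 * (U \<sigma>)\<^sup>2 - ?x * s ^ 3"
        unfolding sU[symmetric] by (simp add: power2_eq_square power3_eq_cube algebra_simps)
      ultimately show ?thesis by simp
    qed
    \<comment> \<open>\<open>tb\<close> is split into the mean field and a fluctuation of size
      \<open>s / sqrt N\<close>, whose fourth power is again quadratic in \<open>U\<close>.\<close>
    have x4: "?x ^ 4 \<le> 8 * (?n * \<kappa> ^ 4) * (?n * (mb \<sigma>) ^ 4 + (U \<sigma>)\<^sup>2 / ?n)"
    proof -
      have "(sqrt ?n) ^ 4 = ?n\<^sup>2" using n by (simp add: power_numeral_reduce)
      then have "?x ^ 4 = \<bar>tb \<sigma>\<bar> ^ 4 * (?n\<^sup>2 * \<kappa> ^ 4)" by (simp only: power_mult_distrib)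
      also have "\<bar>tb \<sigma>\<bar> ^ 4 \<le> (\<bar>mb \<sigma>\<bar> + s / sqrt ?n) ^ 4"
        unfolding s_def by (intro power_mono tb_le) auto
      also have "\<dots> \<le> 8 * (\<bar>mb \<sigma>\<bar> ^ 4 + (s / sqrt ?n) ^ 4)" by (rule power4_sum_le)
      also have "(s / sqrt ?n) ^ 4 = (U \<sigma>)\<^sup>2 / ?n\<^sup>2"
        unfolding sU[symmetric] power_divide \<open>(sqrt ?n) ^ 4 = ?n\<^sup>2\<close> by (simp add: power_mult[symmetric])
      also have "\<bar>mb \<sigma>\<bar> ^ 4 = (mb \<sigma>) ^ 4" by simp
      also have "8 * ((mb \<sigma>) ^ 4 + (U \<sigma>)\<^sup>2 / ?n\<^sup>2) * (?n\<^sup>2 * \<kappa> ^ 4) = 8 * (?n * \<kappa> ^ 4) * (?n * (mb \<sigma>) ^ 4 + (U \<sigma>)\<^sup>2 / ?n)"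
        using n by (simp add: field_simps power2_eq_square)
      finally show ?thesis by (simp add: mult_right_mono)
    qed
    have "?x * s ^ 3 \<le> \<delta> / 32 * s ^ 4 + ?x ^ 4 / (\<delta> / 32) ^ 3"
      using \<delta>_pos s0 \<kappa>_nonneg by (intro weighted_cube_le) auto
    also have "?x ^ 4 / (\<delta> / 32) ^ 3 = ?x ^ 4 * (32 / \<delta>) ^ 3" using \<delta>_pos by (simp add: power_divide)
    also have "\<dots> \<le> 8 * (?n * \<kappa> ^ 4) * (?n * (mb \<sigma>) ^ 4 + (U \<sigma>)\<^sup>2 / ?n) * (32 / \<delta>) ^ 3"
      using x4 \<delta>_pos by (intro mult_right_mono) auto
    also have "\<dots> = ?B * (?n * (mb \<sigma>) ^ 4) + ?B / ?n * (U \<sigma>)\<^sup>2"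
      by (simp add: algebra_simps)
    also have "?B / ?n * (U \<sigma>)\<^sup>2 \<le> \<delta> / 32 * (U \<sigma>)\<^sup>2"
    proof (rule mult_right_mono)
      have "?B = (8 * 32 ^ 4 * (?n * \<kappa> ^ 4) / \<delta> ^ 4) * (\<delta> / 32)"
      proof -
        have "(32 / \<delta>) ^ 3 = 32 ^ 4 / \<delta> ^ 4 * (\<delta> / 32)"
          using \<delta>_pos by (simp add: power4_eq_xxxx power3_eq_cube)
        moreover have "8 * (p / q * d) * z = (8 * p * z / q) * d" for p q d z :: real by simp
        ultimately show ?thesis by (simp only:)
      qed
      also have "\<dots> \<le> ?n * (\<delta> / 32)" using large \<delta>_pos by (intro mult_right_mono) auto
      finally show "?B / ?n \<le> \<delta> / 32" unfolding pos_divide_le_eq[OF n] by (simp only: mult.commute)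
    qed simp
    also have "s ^ 4 = (U \<sigma>)\<^sup>2" unfolding sU[symmetric] by (simp add: power_mult[symmetric])
    finally have y1: "?x * s ^ 3 \<le> \<delta> / 32 * (U \<sigma>)\<^sup>2 + (?B * (?n * (mb \<sigma>) ^ 4) + \<delta> / 32 * (U \<sigma>)\<^sup>2)" by simp
    have y2: "2 * Fr * U \<sigma> \<le> \<delta> / 32 * (U \<sigma>)\<^sup>2 + 32 / \<delta> * Fr\<^sup>2"
    proof -
      have "0 \<le> (\<delta> * U \<sigma> - 32 * Fr)\<^sup>2 / (32 * \<delta>)" using \<delta>_pos by simp
      also have "\<dots> = \<delta> / 32 * (U \<sigma>)\<^sup>2 + 32 / \<delta> * Fr\<^sup>2 - 2 * Fr * U \<sigma>"
        using \<delta>_pos by (simp add: power2_diff field_simps) (simp add: power2_eq_square)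
      finally show ?thesis by simp
    qed
    have y3: "40 * U \<sigma> \<le> \<delta> / 32 * (U \<sigma>)\<^sup>2 + 12800 / \<delta>"
    proof -
      have "0 \<le> (\<delta> * U \<sigma> - 640)\<^sup>2 / (32 * \<delta>)" using \<delta>_pos by simp
      also have "\<dots> = \<delta> / 32 * (U \<sigma>)\<^sup>2 + 12800 / \<delta> - 40 * U \<sigma>"
        using \<delta>_pos by (simp add: power2_diff field_simps) (simp add: power2_eq_square)
      finally show ?thesis by simp
    qed
    show ?thesis using id y1 y2 y3 by linarith
  qed
  have "Ex (\<lambda>\<sigma>. \<delta> / 8 * (U \<sigma>)\<^sup>2 + (2 * Fr * U \<sigma> + 40 * U \<sigma> + 56 * Fr)) \<le>
    Ex (\<lambda>\<sigma>. (32 / \<delta> * Fr\<^sup>2 + 12800 / \<delta> + 56 * Fr + ?B * (?n * (mb \<sigma>) ^ 4)) + ip N (res \<sigma>) (A (u \<sigma>)) * U \<sigma>)"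
    by (rule Ex_mono) (rule path)
  then have "\<delta> / 8 * Ex (\<lambda>\<sigma>. (U \<sigma>)\<^sup>2) + Ex (\<lambda>\<sigma>. 2 * Fr * U \<sigma> + 40 * U \<sigma> + 56 * Fr) \<le>
    (32 / \<delta> * Fr\<^sup>2 + 12800 / \<delta> + 56 * Fr + ?B * (?n * Ex (\<lambda>\<sigma>. (mb \<sigma>) ^ 4))) + Ex (\<lambda>\<sigma>. ip N (res \<sigma>) (A (u \<sigma>)) * U \<sigma>)"
    by (subst (asm) Ex_add, subst (asm) Ex_cmult, subst (asm) Ex_add[of "\<lambda>\<sigma>. 32 / \<delta> * Fr\<^sup>2 + 12800 / \<delta> + 56 * Fr + ?B * (?n * (mb \<sigma>) ^ 4)"],
        subst (asm) (2) Ex_add, simp only: Ex_const Ex_cmult)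
  then show ?thesis using Ex_energy_res by linarith
qed

section \<open>The supremum of the noise field\<close>

definition hs :: "(nat \<Rightarrow> real) \<Rightarrow> real" where
  "hs \<sigma> = Max ((\<lambda>i. \<bar>A (res \<sigma>) i\<bar>) ` {..<N})"

lemma hs_ge: "i < N \<Longrightarrow> \<bar>A (res \<sigma>) i\<bar> \<le> hs \<sigma>"
  unfolding hs_def by (rule Max_ge) auto

lemma hs_nonneg: "0 \<le> hs \<sigma>"
  using hs_ge[of 0 \<sigma>] N_pos by linarith

lemma hs_attained: obtains i where "i < N" "hs \<sigma> = \<bar>A (res \<sigma>) i\<bar>"
proof -
  have "hs \<sigma> \<in> (\<lambda>i. \<bar>A (res \<sigma>) i\<bar>) ` {..<N}"
    unfolding hs_def using N_pos by (intro Max_in) auto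
  then show ?thesis using that by auto
qed

text \<open>A union bound through moments of order \<open>2p\<close>. With \<open>L\<close> three
  times the moment scale of a single site, each site contributes at most \<open>3^(-p)\<close>, and
  \<open>N <= 3^p\<close> sites contribute at most 1. The fourth power is reached from
  \<open>Y^2 <= 1 + Y^p\<close>.\<close>

lemma hs_fourth_moment:
  assumes al: "\<And>i. i < N \<Longrightarrow> alpha i \<le> \<alpha>" and \<alpha>: "0 < \<alpha>" and p: "2 \<le> p" "real N \<le> 3 ^ p"
  shows "Ex (\<lambda>\<sigma>. (hs \<sigma>) ^ 4) \<le> 2 * (72 * real p * \<alpha>)\<^sup>2"
proof -
  define L where "L = 72 * real p * \<alpha>"
  have L: "0 < L" using \<alpha> p by (simp add: L_def)
  have "Ex (\<lambda>\<sigma>. (hs \<sigma>) ^ 4) \<le> Ex (\<lambda>\<sigma>. L\<^sup>2 * (1 + 1 / L ^ p * (\<Sum>i<N. (A (res \<sigma>) i) ^ (2 * p))))"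
  proof (rule Ex_mono)
    fix \<sigma>
    define Y where "Y = (hs \<sigma>)\<^sup>2 / L"
    have Y0: "0 \<le> Y" using L by (simp add: Y_def)
    have "Y\<^sup>2 \<le> 1 + Y ^ p"
    proof (cases "Y \<le> 1")
      case True
      then have "Y\<^sup>2 \<le> 1" using Y0 by (simp add: power_le_one)
      then show ?thesis using Y0 by (simp add: add_increasing2)
    next
      case False
      then show ?thesis using p(1) by (simp add: add_increasing power_increasing)
    qed
    moreover have "Y ^ p \<le> 1 / L ^ p * (\<Sum>i<N. (A (res \<sigma>) i) ^ (2 * p))"
    proof -
      obtain i where i: "i < N" "hs \<sigma> = \<bar>A (res \<sigma>) i\<bar>" by (rule hs_attained)
      have "(A (res \<sigma>) i) ^ (2 * p) \<le> (\<Sum>i<N. (A (res \<sigma>) i) ^ (2 * p))"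
        using i(1) by (intro member_le_sum) (auto simp: power_mult)
      then have "(A (res \<sigma>) i) ^ (2 * p) / L ^ p \<le> (\<Sum>i<N. (A (res \<sigma>) i) ^ (2 * p)) / L ^ p"
        using L by (intro divide_right_mono) auto
      moreover have "Y ^ p = (A (res \<sigma>) i) ^ (2 * p) / L ^ p"
        by (simp add: Y_def i(2) power_divide power_mult)
      ultimately show ?thesis by (simp only: mult_1_left times_divide_eq_left)
    qed
    ultimately have "L\<^sup>2 * Y\<^sup>2 \<le> L\<^sup>2 * (1 + 1 / L ^ p * (\<Sum>i<N. (A (res \<sigma>) i) ^ (2 * p)))"
      by (intro mult_left_mono) auto
    moreover have "L\<^sup>2 * Y\<^sup>2 = (hs \<sigma>) ^ 4" using L by (simp add: Y_def power_divide power_mult[symmetric])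
    ultimately show "(hs \<sigma>) ^ 4 \<le> L\<^sup>2 * (1 + 1 / L ^ p * (\<Sum>i<N. (A (res \<sigma>) i) ^ (2 * p)))" by simp
  qed
  also have "\<dots> = L\<^sup>2 * (1 + 1 / L ^ p * (\<Sum>i<N. Ex (\<lambda>\<sigma>. (A (res \<sigma>) i) ^ (2 * p))))"
    by (simp only: Ex_cmult Ex_add Ex_const Ex_sum)
  also have "\<dots> \<le> L\<^sup>2 * (1 + 1 / L ^ p * (\<Sum>i<N. (24 * real p * \<alpha>) ^ p))"
  proof (intro mult_left_mono add_left_mono sum_mono)
    fix i assume "i \<in> {..<N}"
    then have i: "i < N" by simp
    have "Ex (\<lambda>\<sigma>. (A (res \<sigma>) i) ^ (2 * p)) = Ex (\<lambda>\<sigma>. (ip N (a i) (res \<sigma>)) ^ (2 * p))"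
      by (simp add: A_def ip_def)
    also have "\<dots> \<le> (24 * real p * ip N (a i) (a i)) ^ p" by (rule noise_moment)
    also have "\<dots> \<le> (24 * real p * \<alpha>) ^ p"
      using al[OF i] by (intro power_mono mult_left_mono) (auto simp: ip_self_eq alpha_def sum_nonneg)
    finally show "Ex (\<lambda>\<sigma>. (A (res \<sigma>) i) ^ (2 * p)) \<le> (24 * real p * \<alpha>) ^ p" .
  qed (use L in auto)
  also have "\<dots> = L\<^sup>2 * (1 + real N / 3 ^ p)"
  proof -
    have L3: "L = 3 * (24 * real p * \<alpha>)" by (simp add: L_def)
    have "L ^ p = 3 ^ p * (24 * real p * \<alpha>) ^ p" unfolding L3 by (rule power_mult_distrib)
    moreover have "(24 * real p * \<alpha>) ^ p \<noteq> 0" using \<alpha> p by simp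
    ultimately show ?thesis by simp
  qed
  also have "\<dots> \<le> L\<^sup>2 * (1 + 1)" using p(2) by (intro mult_left_mono add_left_mono) auto
  finally show ?thesis by (simp add: L_def)
qed

end

section \<open>The remainder in the critical regime\<close>

text \<open>Bookkeeping for the constants: a numerical factor of at most \<open>10^k\<close> costs
  \<open>k\<close> powers of \<open>D\<close>.\<close>

lemma const_times_power_le:
  fixes D :: real
  assumes "10 \<le> D" "x \<le> 10 ^ k" "m + k \<le> n"
  shows "x * D ^ m \<le> D ^ n"
proof -
  have "x \<le> D ^ k" using assms(1,2) power_mono[of 10 D k] by linarith
  then have "x * D ^ m \<le> D ^ k * D ^ m" using assms(1) by (intro mult_right_mono) auto
  also have "\<dots> = D ^ (m + k)" by (simp add: power_add mult.commute)
  also have "\<dots> \<le> D ^ n" using assms by (intro power_increasing) auto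
  finally show ?thesis .
qed

lemma abs_cube_eq: "\<bar>x\<bar> ^ 3 = \<bar>x\<bar> * x\<^sup>2" for x :: real
  using power_Suc[of "\<bar>x\<bar>" 2] by (simp add: eval_nat_numeral)

text \<open>
  All constants are absorbed in \<open>D\<close>. In the application \<open>q = N\<^sup>1\<^sup>/\<^sup>4\<close>, \<open>L = ln N\<close>, \<open>e\<close> is \<open>eps_err\<close>, \<open>r0\<close> is
  the first summand of \<open>r_err\<close>, and \<open>\<nu>\<close> is the last term of the bound without its factor \<open>(ln N)\<^sup>2\<close>. The number \<open>l\<close>
  of steps suffices for \<open>Qc\<close> to contract by \<open>1 / N\<close>, and \<open>p\<close> is a moment exponent for which the supremum over \<open>N\<close>
  indices costs only a constant factor.
\<close>

locale critical = gapped +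
  fixes D q L e r0 \<alpha> \<nu> :: real and l p :: nat
  assumes q_pos: "0 < q" and q4: "q ^ 4 = real N"
    and D: "10 \<le> D" and \<delta>_D: "1 / \<delta> \<le> D" and \<kappa>_q: "\<kappa> * q \<le> D"
    and L: "D ^ 40 \<le> L" and L_le_N: "L \<le> real N"
    and l1: "(1 - \<delta> / 2) ^ l \<le> 1 / real N" and l2: "(1 + \<kappa>) ^ l \<le> 3"
    and l3: "real l * \<kappa> \<le> 1" and l4: "real l \<le> D\<^sup>2 * L"
    and p: "2 \<le> p" "real N \<le> 3 ^ p" "real p \<le> 2 * L"
    and \<alpha>_pos: "0 < \<alpha>" and alpha_le: "i < N \<Longrightarrow> alpha i \<le> \<alpha>"
    and r0_pos: "0 < r0" and r0_sq: "r0\<^sup>2 = L ^ 3 * \<alpha>"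
    and e_Fr: "Fr \<le> e" and e_L: "L \<le> e" and e_q: "e \<le> q\<^sup>2" and e_r0: "e * r0 \<le> q"
    and \<nu>: "0 \<le> \<nu>" "\<nu> \<le> 1" and nm_c_\<nu>: "nm N c \<le> \<nu> * q"
    and sum_c_\<nu>: "\<bar>\<Sum>i<N. c i\<bar> \<le> \<nu> * q\<^sup>2"
begin

text \<open>The first two terms of the target bound, since \<open>q^2 = sqrt N\<close>, with
  \<open>r0\<close> in place of the full \<open>r_err\<close>.\<close>

definition \<omega> :: real where "\<omega> = e / q\<^sup>2 + e * r0 / q"
definition X :: "(nat \<Rightarrow> real) \<Rightarrow> real" where "X \<sigma> = avg N \<sigma>"
definition T :: "(nat \<Rightarrow> real) \<Rightarrow> real" where "T \<sigma> = q * X \<sigma>"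
text \<open>\<open>y\<close> and \<open>z\<close> are energy and supremum noise in units chosen so
  that powers of \<open>D\<close> bound the moments collected in \<open>Lam\<close>.
  \<open>\<beta>\<close> stays on the scale of \<open>Rem\<close>; its moments carry the small
  factor \<open>\<nu>\<close>.\<close>

definition y :: "(nat \<Rightarrow> real) \<Rightarrow> real" where "y \<sigma> = U \<sigma> / e"
definition z :: "(nat \<Rightarrow> real) \<Rightarrow> real" where "z \<sigma> = L * hs \<sigma> / r0"
definition \<beta> :: "(nat \<Rightarrow> real) \<Rightarrow> real" where "\<beta> \<sigma> = \<bar>ip N (neu l) (res \<sigma>)\<bar> / q"
definition S3 :: "(nat \<Rightarrow> real) \<Rightarrow> real" where "S3 \<sigma> = (\<Sum>i<N. \<bar>u \<sigma> i\<bar> ^ 3)"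
text \<open>The drift is kept as the exact \<open>tanh_defect (X \<sigma>)\<close>, to which the
  coercivity bound applies. Replacing it by \<open>T^3/3\<close> is a separate error term of
  \<open>distribution_bound\<close>.\<close>

definition Rem :: "(nat \<Rightarrow> real) \<Rightarrow> real" where
  "Rem \<sigma> = q ^ 3 * (X \<sigma> - tb \<sigma> - tanh_defect (X \<sigma>))"
definition Lam :: "(nat \<Rightarrow> real) \<Rightarrow> real" where
  "Lam \<sigma> = 1 + (y \<sigma>)\<^sup>2 + (z \<sigma>) ^ 4 + (\<beta> \<sigma>)\<^sup>2"

lemma sqrt_N: "sqrt (real N) = q\<^sup>2"
  using q_pos by (simp add: q4[symmetric] real_sqrt_unique power_mult[symmetric])

lemma D_pos: "0 < D" using D by simp

lemma L_ge_1: "1 \<le> L"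
proof -
  have "1 \<le> D ^ 40" using D by (intro one_le_power) simp
  then show ?thesis using L by linarith
qed

lemma e_ge_1: "1 \<le> e" using L_ge_1 e_L by linarith

lemma q_ge_1: "1 \<le> q"
proof (rule ccontr)
  assume "\<not> 1 \<le> q"
  then have "q\<^sup>2 < 1" using q_pos by (simp add: power_less_one_iff)
  then show False using e_ge_1 e_q by linarith
qed

lemma \<omega>_nonneg: "0 \<le> \<omega>"
  using e_ge_1 q_pos r0_pos by (simp add: \<omega>_def)

lemma e_q2_le_\<omega>: "e / q\<^sup>2 \<le> \<omega>" and e_r0_le_\<omega>: "e * r0 / q \<le> \<omega>"
  using e_ge_1 q_pos r0_pos by (simp_all add: \<omega>_def)

lemma \<omega>_le_2: "\<omega> \<le> 2"
proof -
  have "e / q\<^sup>2 \<le> 1" "e * r0 / q \<le> 1" using e_q e_r0 q_pos by simp_all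
  then show ?thesis by (simp add: \<omega>_def)
qed

lemma inv_q2_le_\<omega>: "1 / q\<^sup>2 \<le> \<omega>"
proof -
  have "1 / q\<^sup>2 \<le> e / q\<^sup>2" using e_ge_1 by (intro divide_right_mono) auto
  then show ?thesis using e_q2_le_\<omega> by linarith
qed

lemma y_nonneg: "0 \<le> y \<sigma>" using e_ge_1 by (simp add: y_def)
lemma z_nonneg: "0 \<le> z \<sigma>" using L_ge_1 r0_pos hs_nonneg by (simp add: z_def)
lemma \<beta>_nonneg: "0 \<le> \<beta> \<sigma>" using q_pos by (simp add: \<beta>_def)

lemma U_y: "U \<sigma> = e * y \<sigma>" using e_ge_1 by (simp add: y_def)

lemma nm_u_y: "nm N (u \<sigma>) = sqrt e * sqrt (y \<sigma>)"
  unfolding sqrt_U[symmetric] U_y by (rule real_sqrt_mult)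

lemma sqrt_e_le: "sqrt e \<le> q"
  using real_sqrt_le_mono[OF e_q] q_pos by simp

lemma mb_X: "mb \<sigma> = X \<sigma> + ip N c \<sigma> / real N"
  using N_pos by (simp add: mb_def X_def avg_def sum_A add_divide_distrib)

lemma abs_spin_avg: "\<sigma> \<in> Om \<Longrightarrow> \<bar>X \<sigma>\<bar> \<le> 1"
  unfolding X_def by (rule abs_avg_bound) (auto simp: Om_abs)

lemma abs_gamma: "\<sigma> \<in> Om \<Longrightarrow> \<bar>ip N c \<sigma> / real N\<bar> \<le> \<kappa>"
  using abs_ip_c_le[of \<sigma> 1] Om_abs N_pos by (simp add: field_simps abs_mult)

lemma q_mb: "\<sigma> \<in> Om \<Longrightarrow> q * \<bar>mb \<sigma>\<bar> \<le> \<bar>T \<sigma>\<bar> + D"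
proof -
  assume s: "\<sigma> \<in> Om"
  have "\<bar>mb \<sigma>\<bar> \<le> \<bar>X \<sigma>\<bar> + \<kappa>" using abs_gamma[OF s] mb_X[of \<sigma>] by linarith
  then have "q * \<bar>mb \<sigma>\<bar> \<le> q * (\<bar>X \<sigma>\<bar> + \<kappa>)" using q_pos by (intro mult_left_mono) auto
  also have "\<dots> = \<bar>T \<sigma>\<bar> + \<kappa> * q" using q_pos by (simp add: T_def abs_mult algebra_simps)
  finally show ?thesis using \<kappa>_q by linarith
qed

text \<open>Because \<open>|tanh x| <= |x|\<close>, the absolute field satisfies
  \<open>|A \<sigma>| <= A |A \<sigma>| + hs \<sigma>\<close> entrywise, which is what the maximum
  principle needs. Taking absolute values does not increase differences of entries, so the centred
  norm stays below that of \<open>u\<close>.\<close>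

lemma abs_A_sup:
  assumes s: "\<sigma> \<in> Om" and i: "i < N"
  shows "\<bar>u \<sigma> i\<bar> \<le> 4 * \<bar>mb \<sigma>\<bar> + 2 * real l * hs \<sigma> + 5 * nm N (u \<sigma>) / q\<^sup>2"
proof -
  let ?w = "\<lambda>i. \<bar>A \<sigma> i\<bar>"
  have l1': "(1 - \<delta> / 2) ^ l \<le> 1 / sqrt (real N)"
  proof -
    have "1 \<le> sqrt (real N)" using N_pos by simp
    then have "sqrt (real N) * 1 \<le> sqrt (real N) * sqrt (real N)" by (intro mult_left_mono) auto
    then have "1 / real N \<le> 1 / sqrt (real N)" using N_pos by (intro frac_le) auto
    then show ?thesis using l1 by linarith
  qed
  have "?w i \<le> 3 * avg N ?w + 2 * real l * hs \<sigma> + 2 * nm N (cen N ?w) / sqrt (real N)"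
  proof (rule subharmonic_sup_bound[OF _ _ hs_nonneg l1' l2 i])
    fix j assume j: "j < N"
    have "A \<sigma> j = A (res \<sigma>) j + A (t \<sigma>) j" unfolding A_add[symmetric] by (simp add: res_def)
    moreover have "\<bar>A (t \<sigma>) j\<bar> \<le> A (\<lambda>k. \<bar>t \<sigma> k\<bar>) j" by (rule abs_A_le[OF j])
    moreover have "A (\<lambda>k. \<bar>t \<sigma> k\<bar>) j \<le> A ?w j"
      using j by (intro A_mono) (auto simp: t_def abs_tanh_le)
    ultimately show "?w j \<le> A ?w j + hs \<sigma>" using hs_ge[OF j, of \<sigma>] by linarith
  qed simp
  moreover have "nm N (cen N ?w) \<le> nm N (u \<sigma>)"
    unfolding u_def by (rule nm_cen_lipschitz) (rule abs_triangle_ineq3)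
  moreover have "avg N ?w \<le> \<bar>mb \<sigma>\<bar> + nm N (u \<sigma>) / q\<^sup>2"
  proof -
    have "avg N ?w \<le> avg N (\<lambda>i. \<bar>mb \<sigma>\<bar> + \<bar>u \<sigma> i\<bar>)"
      unfolding avg_def by (intro divide_right_mono sum_mono) (auto simp: A_eq_u)
    also have "\<dots> = \<bar>mb \<sigma>\<bar> + avg N (\<lambda>i. \<bar>u \<sigma> i\<bar>)"
      using N_pos by (simp add: avg_def sum.distrib add_divide_distrib)
    also have "avg N (\<lambda>i. \<bar>u \<sigma> i\<bar>) \<le> nm N (\<lambda>i. \<bar>u \<sigma> i\<bar>) / q\<^sup>2"
      using abs_avg_le[of N "\<lambda>i. \<bar>u \<sigma> i\<bar>"] by (simp add: sqrt_N)
    finally show ?thesis by (simp add: nm_def ip_def)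
  qed
  moreover have "\<bar>u \<sigma> i\<bar> \<le> ?w i + \<bar>mb \<sigma>\<bar>" using A_eq_u[of \<sigma> i] by linarith
  moreover have "2 * nm N (cen N ?w) / q\<^sup>2 \<le> 2 * nm N (u \<sigma>) / q\<^sup>2"
    using calculation(2) by (intro divide_right_mono mult_left_mono) auto
  moreover have "5 * nm N (u \<sigma>) / q\<^sup>2 = 3 * (nm N (u \<sigma>) / q\<^sup>2) + 2 * nm N (u \<sigma>) / q\<^sup>2" by simp
  ultimately show ?thesis unfolding sqrt_N by linarith
qed

text \<open>A cube is a square times the supremum. The mean and energy parts of the supremum scale
  with \<open>e / q^2\<close>, its noise part with \<open>e * r0 / q\<close>: these are the two
  terms of \<open>\<omega>\<close>.\<close>

lemma S3_bound:
  assumes s: "\<sigma> \<in> Om"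
  shows "S3 \<sigma> / q \<le> 5 * D\<^sup>2 * \<omega> * (y \<sigma> * (\<bar>T \<sigma>\<bar> + D + z \<sigma> + sqrt (y \<sigma>)))"
proof -
  let ?M = "4 * \<bar>mb \<sigma>\<bar> + 2 * real l * hs \<sigma> + 5 * nm N (u \<sigma>) / q\<^sup>2"
  have M0: "0 \<le> ?M" using hs_nonneg by simp
  have "S3 \<sigma> \<le> (\<Sum>i<N. (u \<sigma> i)\<^sup>2 * ?M)"
    unfolding S3_def
  proof (rule sum_mono)
    fix i assume "i \<in> {..<N}"
    then have "(u \<sigma> i)\<^sup>2 * \<bar>u \<sigma> i\<bar> \<le> (u \<sigma> i)\<^sup>2 * ?M"
      using abs_A_sup[OF s, of i] by (intro mult_left_mono) auto
    then show "\<bar>u \<sigma> i\<bar> ^ 3 \<le> (u \<sigma> i)\<^sup>2 * ?M" by (simp add: power3_eq_cube power2_eq_square)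
  qed
  also have "\<dots> = e * y \<sigma> * ?M" by (simp add: U_y[symmetric] U_def ip_self_eq sum_distrib_right)
  finally have "S3 \<sigma> / q \<le> e * y \<sigma> * ?M / q" using q_pos by (intro divide_right_mono) auto
  also have "\<dots> = y \<sigma> * (4 * (e / q\<^sup>2) * (q * \<bar>mb \<sigma>\<bar>) + 2 * (e / q) * (real l * hs \<sigma>) + 5 * (e / q\<^sup>2) * (nm N (u \<sigma>) / q))"
    using q_pos by (simp add: field_simps power2_eq_square)
  also have "\<dots> \<le> y \<sigma> * (5 * D\<^sup>2 * \<omega> * (\<bar>T \<sigma>\<bar> + D) + 5 * D\<^sup>2 * \<omega> * z \<sigma> + 5 * D\<^sup>2 * \<omega> * sqrt (y \<sigma>))"
  proof (intro mult_left_mono[OF _ y_nonneg] add_mono)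
    have D2: "1 \<le> D\<^sup>2" using D by (intro one_le_power) simp
    have five: "x \<le> 5 * D\<^sup>2 * w" if "x \<le> 5 * w" "0 \<le> w" for x w
    proof -
      have "1 * w \<le> D\<^sup>2 * w" using D2 that(2) by (intro mult_right_mono)
      then show ?thesis using that(1) by simp
    qed
    have "4 * (e / q\<^sup>2) * (q * \<bar>mb \<sigma>\<bar>) \<le> 5 * \<omega> * (\<bar>T \<sigma>\<bar> + D)"
      using e_q2_le_\<omega> q_mb[OF s] e_ge_1 q_pos \<omega>_nonneg by (intro mult_mono) auto
    then show "4 * (e / q\<^sup>2) * (q * \<bar>mb \<sigma>\<bar>) \<le> 5 * D\<^sup>2 * \<omega> * (\<bar>T \<sigma>\<bar> + D)"
      using five[of _ "\<omega> * (\<bar>T \<sigma>\<bar> + D)"] \<omega>_nonneg D_pos by (simp add: mult.assoc)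
    have "real l * hs \<sigma> \<le> (D\<^sup>2 * L) * hs \<sigma>" by (rule mult_right_mono[OF l4 hs_nonneg])
    also have "\<dots> = D\<^sup>2 * r0 * z \<sigma>" using r0_pos by (simp add: z_def)
    finally have "2 * (e / q) * (real l * hs \<sigma>) \<le> 2 * (e / q) * (D\<^sup>2 * r0 * z \<sigma>)"
      using e_ge_1 q_pos by (intro mult_left_mono) auto
    also have "\<dots> = 2 * D\<^sup>2 * (e * r0 / q) * z \<sigma>" by simp
    also have "\<dots> \<le> 5 * D\<^sup>2 * \<omega> * z \<sigma>"
      using e_r0_le_\<omega> z_nonneg \<omega>_nonneg e_ge_1 r0_pos q_pos by (intro mult_right_mono mult_mono) auto
    finally show "2 * (e / q) * (real l * hs \<sigma>) \<le> 5 * D\<^sup>2 * \<omega> * z \<sigma>" .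
    have "nm N (u \<sigma>) / q \<le> sqrt (y \<sigma>)"
    proof -
      have "nm N (u \<sigma>) \<le> q * sqrt (y \<sigma>)" unfolding nm_u_y
        using y_nonneg by (intro mult_right_mono sqrt_e_le) auto
      then show ?thesis using q_pos by (simp add: field_simps)
    qed
    then have "5 * (e / q\<^sup>2) * (nm N (u \<sigma>) / q) \<le> 5 * \<omega> * sqrt (y \<sigma>)"
      using e_q2_le_\<omega> \<omega>_nonneg q_pos e_ge_1 by (intro mult_mono) auto
    then show "5 * (e / q\<^sup>2) * (nm N (u \<sigma>) / q) \<le> 5 * D\<^sup>2 * \<omega> * sqrt (y \<sigma>)"
      using five[of _ "\<omega> * sqrt (y \<sigma>)"] \<omega>_nonneg y_nonneg by (simp add: mult.assoc)
  qed
  finally show ?thesis by (simp add: algebra_simps)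
qed

lemma mb_U_bound:
  assumes s: "\<sigma> \<in> Om"
  shows "\<bar>mb \<sigma>\<bar> * U \<sigma> / q \<le> \<omega> * (y \<sigma> * (\<bar>T \<sigma>\<bar> + D))"
proof -
  have "\<bar>mb \<sigma>\<bar> * U \<sigma> / q = (e / q\<^sup>2) * (y \<sigma> * (q * \<bar>mb \<sigma>\<bar>))"
    using q_pos by (simp add: U_y power2_eq_square)
  also have "\<dots> \<le> \<omega> * (y \<sigma> * (\<bar>T \<sigma>\<bar> + D))"
  proof (rule mult_mono[OF e_q2_le_\<omega>])
    show "y \<sigma> * (q * \<bar>mb \<sigma>\<bar>) \<le> y \<sigma> * (\<bar>T \<sigma>\<bar> + D)"
      by (rule mult_left_mono[OF q_mb[OF s] y_nonneg])
  qed (use \<omega>_nonneg y_nonneg q_pos in auto)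
  finally show ?thesis .
qed

text \<open>\<open>neu l\<close> has mean zero, so the defect at the mean field may be subtracted.
  The entries of \<open>neu l\<close> are at most 6 because \<open>l * \<kappa>\<close> is at most
  1; hence the factor 12.\<close>

lemma sum_cube_defect:
  "\<bar>ip N (neu l) (\<lambda>i. tanh_defect (A \<sigma> i))\<bar> \<le> 2 * (mb \<sigma>)\<^sup>2 * (nm N (neu l) * nm N (u \<sigma>)) + 12 * S3 \<sigma>"
proof -
  have e: "ip N (neu l) (\<lambda>i. tanh_defect (A \<sigma> i)) = ip N (neu l) (\<lambda>i. tanh_defect (A \<sigma> i) - tanh_defect (mb \<sigma>))"
  proof -
    have "ip N (neu l) (\<lambda>i. tanh_defect (A \<sigma> i) - tanh_defect (mb \<sigma>))
        = ip N (neu l) (\<lambda>i. tanh_defect (A \<sigma> i)) - ip N (neu l) (\<lambda>_. tanh_defect (mb \<sigma>))"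
      by (rule ip_diff_right)
    moreover have "ip N (neu l) (\<lambda>_. tanh_defect (mb \<sigma>)) = tanh_defect (mb \<sigma>) * (\<Sum>i<N. neu l i)"
      by (rule ip_const_right)
    ultimately show ?thesis by (simp only: sum_neu mult_zero_right diff_zero)
  qed
  have "\<bar>ip N (neu l) (\<lambda>i. tanh_defect (A \<sigma> i))\<bar> \<le> (\<Sum>i<N. 2 * (mb \<sigma>)\<^sup>2 * (\<bar>neu l i\<bar> * \<bar>u \<sigma> i\<bar>) + 12 * \<bar>u \<sigma> i\<bar> ^ 3)"
    unfolding e unfolding ip_def
  proof (intro order_trans[OF sum_abs] sum_mono)
    fix i assume "i \<in> {..<N}"
    then have i: "i < N" by simp
    have n6: "\<bar>neu l i\<bar> \<le> 6"
    proof -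
      have "\<bar>neu l i\<bar> \<le> 6 * (real l * \<kappa>)" using neu_sup[OF i l2] by (simp only: mult.assoc)
      then show ?thesis using l3 by linarith
    qed
    have "\<bar>tanh_defect (A \<sigma> i) - tanh_defect (mb \<sigma>)\<bar> \<le> \<bar>u \<sigma> i\<bar> * (2 * (mb \<sigma>)\<^sup>2 + 2 * (u \<sigma> i)\<^sup>2)"
      using tanh_defect_diff_le[of "A \<sigma> i" "mb \<sigma>"] by (simp add: A_eq_u)
    then have "\<bar>neu l i\<bar> * \<bar>tanh_defect (A \<sigma> i) - tanh_defect (mb \<sigma>)\<bar> \<le> \<bar>neu l i\<bar> * (\<bar>u \<sigma> i\<bar> * (2 * (mb \<sigma>)\<^sup>2 + 2 * (u \<sigma> i)\<^sup>2))"
      by (rule mult_left_mono) simp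
    also have "\<dots> = 2 * (mb \<sigma>)\<^sup>2 * (\<bar>neu l i\<bar> * \<bar>u \<sigma> i\<bar>) + \<bar>neu l i\<bar> * (2 * \<bar>u \<sigma> i\<bar> ^ 3)"
    proof -
      have u3: "\<bar>u \<sigma> i\<bar> ^ 3 = \<bar>u \<sigma> i\<bar> * (u \<sigma> i)\<^sup>2" by (rule abs_cube_eq)
      have "x * (v * (2 * m + 2 * w)) = 2 * m * (x * v) + x * (2 * (v * w))" for x v m w :: real
        by (simp add: algebra_simps)
      then show ?thesis unfolding u3 .
    qed
    also have "\<dots> \<le> 2 * (mb \<sigma>)\<^sup>2 * (\<bar>neu l i\<bar> * \<bar>u \<sigma> i\<bar>) + 6 * (2 * \<bar>u \<sigma> i\<bar> ^ 3)"
      using n6 by (intro add_left_mono mult_right_mono) auto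
    also have "6 * (2 * \<bar>u \<sigma> i\<bar> ^ 3) = 12 * \<bar>u \<sigma> i\<bar> ^ 3" by simp
    finally show "\<bar>neu l i * (tanh_defect (A \<sigma> i) - tanh_defect (mb \<sigma>))\<bar> \<le> 2 * (mb \<sigma>)\<^sup>2 * (\<bar>neu l i\<bar> * \<bar>u \<sigma> i\<bar>) + 12 * \<bar>u \<sigma> i\<bar> ^ 3"
      unfolding abs_mult .
  qed
  also have "\<dots> = 2 * (mb \<sigma>)\<^sup>2 * (\<Sum>i<N. \<bar>neu l i\<bar> * \<bar>u \<sigma> i\<bar>) + 12 * S3 \<sigma>"
    by (simp add: sum.distrib sum_distrib_left S3_def)
  also have "\<dots> \<le> 2 * (mb \<sigma>)\<^sup>2 * (nm N (neu l) * nm N (u \<sigma>)) + 12 * S3 \<sigma>"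
    by (intro add_right_mono mult_left_mono sum_abs_mult_le_nm) auto
  finally show ?thesis .
qed

lemma nm_neu_\<nu>: "nm N (neu l) \<le> 2 * D * (\<nu> * q)"
proof -
  have "nm N (neu l) \<le> 2 / \<delta> * nm N c" by (rule nm_neu)
  also have "\<dots> \<le> 2 * D * (\<nu> * q)"
    using \<delta>_D \<delta>_pos nm_c_\<nu> D_pos by (intro mult_mono) auto
  finally show ?thesis .
qed

end

context critical
begin

text \<open>The Neumann identity at a spin vector, where \<open>\<sigma> - A \<sigma>\<close> is the
  residual minus the defect of the field. Its terms are a multiple of the mean, the noise
  \<open>\<beta>\<close>, a cubic part and the tail of the series.\<close>

lemma ip_c_bound:
  assumes s: "\<sigma> \<in> Om"
  shows "\<bar>ip N c \<sigma>\<bar> / q \<le> \<nu> * (2 * D * (\<bar>T \<sigma>\<bar> + (\<bar>T \<sigma>\<bar> + D)\<^sup>2 * sqrt (y \<sigma>) + 1)) + \<beta> \<sigma> / 2 + 6 * (S3 \<sigma> / q)"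
proof -
  let ?g = "\<lambda>i. tanh_defect (A \<sigma> i)"
  have r: "ip N (neu l) (\<lambda>i. \<sigma> i - A \<sigma> i) = ip N (neu l) (res \<sigma>) - ip N (neu l) ?g"
  proof -
    have "ip N (neu l) (\<lambda>i. \<sigma> i - A \<sigma> i) = ip N (neu l) (\<lambda>i. res \<sigma> i - ?g i)"
      by (rule ip_cong) (simp_all add: res_def t_def tanh_defect_def)
    also have "\<dots> = ip N (neu l) (res \<sigma>) - ip N (neu l) ?g" by (rule ip_diff_right)
    finally show ?thesis .
  qed
  have sumX: "(\<Sum>i<N. \<sigma> i) = real N * X \<sigma>" using N_pos by (simp add: X_def avg_def)
  have avgc: "real N * avg N c = (\<Sum>i<N. c i)" using N_pos by (simp add: avg_def)
  have "2 * ip N c \<sigma> = 2 * (real N * avg N c) * X \<sigma> + (ip N (neu l) (res \<sigma>) - ip N (neu l) ?g)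
     + 2 * ip N (it c l) \<sigma> + ip N c (neu l) * X \<sigma>"
    using ip_c_neu[of \<sigma> l] unfolding r sumX X_def[symmetric] by (simp add: mult_ac)
  then have "2 * \<bar>ip N c \<sigma>\<bar> \<le> 2 * \<bar>(\<Sum>i<N. c i) * X \<sigma>\<bar> + \<bar>ip N (neu l) (res \<sigma>)\<bar> + \<bar>ip N (neu l) ?g\<bar>
     + 2 * \<bar>ip N (it c l) \<sigma>\<bar> + \<bar>ip N c (neu l) * X \<sigma>\<bar>"
    unfolding avgc by linarith
  then have "2 * \<bar>ip N c \<sigma>\<bar> / q \<le> (2 * \<bar>(\<Sum>i<N. c i) * X \<sigma>\<bar> + \<bar>ip N (neu l) (res \<sigma>)\<bar> + \<bar>ip N (neu l) ?g\<bar>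
     + 2 * \<bar>ip N (it c l) \<sigma>\<bar> + \<bar>ip N c (neu l) * X \<sigma>\<bar>) / q"
    using q_pos by (intro divide_right_mono) auto
  then have main: "2 * (\<bar>ip N c \<sigma>\<bar> / q) \<le> 2 * (\<bar>(\<Sum>i<N. c i) * X \<sigma>\<bar> / q) + \<beta> \<sigma> + \<bar>ip N (neu l) ?g\<bar> / q
     + 2 * (\<bar>ip N (it c l) \<sigma>\<bar> / q) + \<bar>ip N c (neu l) * X \<sigma>\<bar> / q"
    by (simp add: \<beta>_def add_divide_distrib)
  have Xq: "\<bar>X \<sigma>\<bar> = \<bar>T \<sigma>\<bar> / q" using q_pos by (simp add: T_def abs_mult)
  have b1: "\<bar>(\<Sum>i<N. c i) * X \<sigma>\<bar> / q \<le> \<nu> * \<bar>T \<sigma>\<bar>"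
  proof -
    have "\<bar>(\<Sum>i<N. c i) * X \<sigma>\<bar> / q \<le> (\<nu> * q\<^sup>2) * (\<bar>T \<sigma>\<bar> / q) / q"
      unfolding abs_mult Xq using sum_c_\<nu> q_pos by (intro divide_right_mono mult_right_mono) auto
    also have "\<dots> = \<nu> * \<bar>T \<sigma>\<bar>" using q_pos by (simp add: power2_eq_square)
    finally show ?thesis .
  qed
  have b2: "\<bar>ip N (neu l) ?g\<bar> / q \<le> 4 * D * \<nu> * ((\<bar>T \<sigma>\<bar> + D)\<^sup>2 * sqrt (y \<sigma>)) + 12 * (S3 \<sigma> / q)"
  proof -
    have "(mb \<sigma>)\<^sup>2 * (nm N (neu l) * nm N (u \<sigma>)) \<le> ((\<bar>T \<sigma>\<bar> + D)\<^sup>2 / q\<^sup>2) * ((2 * D * (\<nu> * q)) * (q * sqrt (y \<sigma>)))"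
    proof (intro mult_mono)
      have "\<bar>mb \<sigma>\<bar> \<le> (\<bar>T \<sigma>\<bar> + D) / q" using q_mb[OF s] q_pos by (simp add: field_simps)
      then have "\<bar>mb \<sigma>\<bar>\<^sup>2 \<le> ((\<bar>T \<sigma>\<bar> + D) / q)\<^sup>2" by (intro power_mono) auto
      then show "(mb \<sigma>)\<^sup>2 \<le> (\<bar>T \<sigma>\<bar> + D)\<^sup>2 / q\<^sup>2" by (simp add: power_divide)
      show "nm N (u \<sigma>) \<le> q * sqrt (y \<sigma>)" unfolding nm_u_y
        using y_nonneg by (intro mult_right_mono sqrt_e_le) auto
    qed (use nm_neu_\<nu> D_pos \<nu> q_pos y_nonneg in auto)
    also have "\<dots> = 2 * D * \<nu> * ((\<bar>T \<sigma>\<bar> + D)\<^sup>2 * sqrt (y \<sigma>))"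
      using q_pos by (simp add: power2_eq_square)
    also have "\<dots> \<le> 2 * D * \<nu> * ((\<bar>T \<sigma>\<bar> + D)\<^sup>2 * sqrt (y \<sigma>)) * q"
    proof -
      have "0 \<le> 2 * D * \<nu> * ((\<bar>T \<sigma>\<bar> + D)\<^sup>2 * sqrt (y \<sigma>))" using D_pos \<nu> y_nonneg by simp
      from mult_left_mono[OF q_ge_1 this] show ?thesis by simp
    qed
    finally have "2 * ((mb \<sigma>)\<^sup>2 * (nm N (neu l) * nm N (u \<sigma>))) \<le> 2 * (2 * D * \<nu> * ((\<bar>T \<sigma>\<bar> + D)\<^sup>2 * sqrt (y \<sigma>)) * q)"
      by (rule mult_left_mono) simp
    moreover have "2 * m * n = 2 * (m * n)" "2 * (2 * d * v * w * x) = 4 * d * v * w * x" for m n d v w x :: real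
      by simp_all
    ultimately have "2 * (mb \<sigma>)\<^sup>2 * (nm N (neu l) * nm N (u \<sigma>)) + 12 * S3 \<sigma> \<le> 4 * D * \<nu> * ((\<bar>T \<sigma>\<bar> + D)\<^sup>2 * sqrt (y \<sigma>)) * q + 12 * S3 \<sigma>"
      by (simp only: add_right_mono)
    then have "\<bar>ip N (neu l) ?g\<bar> \<le> 4 * D * \<nu> * ((\<bar>T \<sigma>\<bar> + D)\<^sup>2 * sqrt (y \<sigma>)) * q + 12 * S3 \<sigma>"
      using sum_cube_defect[of \<sigma>] by linarith
    then have "\<bar>ip N (neu l) ?g\<bar> / q \<le> (4 * D * \<nu> * ((\<bar>T \<sigma>\<bar> + D)\<^sup>2 * sqrt (y \<sigma>)) * q + 12 * S3 \<sigma>) / q"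
      using q_pos by (intro divide_right_mono) auto
    also have "\<dots> = 4 * D * \<nu> * ((\<bar>T \<sigma>\<bar> + D)\<^sup>2 * sqrt (y \<sigma>)) + 12 * (S3 \<sigma> / q)"
      using q_pos by (simp add: add_divide_distrib)
    finally show ?thesis .
  qed
  \<comment> \<open>The number \<open>l\<close> of steps was chosen for this tail: its factor
    \<open>1 / N\<close> outweighs the norm \<open>q^2\<close> of the spin vector.\<close>
  have b3: "\<bar>ip N (it c l) \<sigma>\<bar> / q \<le> \<nu>"
  proof -
    have "nm N \<sigma> \<le> q\<^sup>2" using nm_bounded[of 1 N \<sigma>] Om_abs[OF s] by (simp add: sqrt_N)
    moreover have "nm N (it c l) \<le> 1 / real N * (\<nu> * q)"
    proof -
      have "nm N (it c l) \<le> (1 - \<delta> / 2) ^ l * nm N (cen N c)" by (rule nm_it)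
      also have "\<dots> \<le> 1 / real N * (\<nu> * q)"
        using l1 order_trans[OF nm_cen_le nm_c_\<nu>] by (intro mult_mono) auto
      finally show ?thesis .
    qed
    ultimately have "\<bar>ip N (it c l) \<sigma>\<bar> \<le> (1 / real N * (\<nu> * q)) * q\<^sup>2"
      by (intro order_trans[OF abs_ip_le] mult_mono) (use \<nu> q_pos in auto)
    also have "\<dots> = \<nu> / q" unfolding q4[symmetric] using q_pos by (simp add: power_numeral_reduce field_simps)
    also have "\<dots> \<le> \<nu> * q"
    proof -
      have "1 \<le> q * q" using q_ge_1 mult_mono[of 1 q 1 q] by simp
      then have "\<nu> * 1 \<le> \<nu> * (q * q)" using \<nu> by (intro mult_left_mono) auto
      then show ?thesis using q_pos by (simp add: field_simps)
    qed
    finally show ?thesis using q_pos by (simp add: field_simps)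
  qed
  have b4: "\<bar>ip N c (neu l) * X \<sigma>\<bar> / q \<le> 2 * D * \<nu> * \<bar>T \<sigma>\<bar>"
  proof -
    have "\<bar>ip N c (neu l)\<bar> \<le> (\<nu> * q) * (2 * D * (\<nu> * q))"
      by (intro order_trans[OF abs_ip_le] mult_mono nm_c_\<nu> nm_neu_\<nu>) (use \<nu> q_pos in auto)
    then have "\<bar>ip N c (neu l) * X \<sigma>\<bar> / q \<le> (\<nu> * q) * (2 * D * (\<nu> * q)) * (\<bar>T \<sigma>\<bar> / q) / q"
      unfolding abs_mult Xq using q_pos by (intro divide_right_mono mult_right_mono) auto
    also have "\<dots> = 2 * D * \<bar>T \<sigma>\<bar> * (\<nu> * \<nu>)" using q_pos by simp
    also have "\<dots> \<le> 2 * D * \<bar>T \<sigma>\<bar> * (\<nu> * 1)" using \<nu> D_pos by (intro mult_left_mono) auto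
    finally show ?thesis by (simp add: mult_ac)
  qed
  have "\<nu> * \<bar>T \<sigma>\<bar> \<le> D * \<nu> * \<bar>T \<sigma>\<bar>" "\<nu> \<le> 2 * D * \<nu>"
    using D \<nu> mult_right_mono[of 1 D "\<nu> * \<bar>T \<sigma>\<bar>"] mult_right_mono[of 1 "2 * D" \<nu>] by (auto simp: mult.assoc)
  then have "2 * (\<bar>ip N c \<sigma>\<bar> / q) \<le> 4 * D * \<nu> * \<bar>T \<sigma>\<bar> + \<beta> \<sigma> + (4 * D * \<nu> * ((\<bar>T \<sigma>\<bar> + D)\<^sup>2 * sqrt (y \<sigma>)) + 12 * (S3 \<sigma> / q)) + 4 * D * \<nu>"
    using main b1 b2 b3 b4 by linarith
  also have "\<dots> = 2 * (\<nu> * (2 * D * (\<bar>T \<sigma>\<bar> + (\<bar>T \<sigma>\<bar> + D)\<^sup>2 * sqrt (y \<sigma>) + 1)) + \<beta> \<sigma> / 2 + 6 * (S3 \<sigma> / q))"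
  proof -
    have "4 * d * v * t + b + (4 * d * v * w + 12 * s) + 4 * d * v = 2 * (v * (2 * d * (t + w + 1)) + b / 2 + 6 * s)"
      for d v t b w s :: real by (simp add: field_simps)
    then show ?thesis .
  qed
  finally show ?thesis by simp
qed

lemma X_tb:
  "X \<sigma> - tb \<sigma> = avg N (\<lambda>i. tanh_defect (A \<sigma> i)) - ip N c \<sigma> / real N"
proof -
  have "avg N (\<lambda>i. tanh_defect (A \<sigma> i)) = mb \<sigma> - tb \<sigma>"
    unfolding mb_def tb_def avg_diff[symmetric] by (simp add: tanh_defect_def t_def[abs_def])
  then show ?thesis using mb_X[of \<sigma>] by simp
qed

text \<open>Taylor expansion at the mean field; the first-order term disappears because the centred
  field sums to zero.\<close>

lemma avg_defect_bound:
  "\<bar>avg N (\<lambda>i. tanh_defect (A \<sigma> i)) - tanh_defect (mb \<sigma>)\<bar> \<le> (2 * \<bar>mb \<sigma>\<bar> * U \<sigma> + S3 \<sigma>) / real N"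
proof -
  let ?r = "\<lambda>i. tanh_defect (mb \<sigma> + u \<sigma> i) - tanh_defect (mb \<sigma>) - (tanh (mb \<sigma>))\<^sup>2 * u \<sigma> i"
  have "(\<Sum>i<N. ?r i) = (\<Sum>i<N. tanh_defect (A \<sigma> i)) - real N * tanh_defect (mb \<sigma>) - (tanh (mb \<sigma>))\<^sup>2 * (\<Sum>i<N. u \<sigma> i)"
    by (simp add: sum_subtractf A_eq_u[symmetric] sum_distrib_left)
  then have e: "(\<Sum>i<N. ?r i) = (\<Sum>i<N. tanh_defect (A \<sigma> i)) - real N * tanh_defect (mb \<sigma>)"
    unfolding sum_u by simp
  have "\<bar>\<Sum>i<N. ?r i\<bar> \<le> (\<Sum>i<N. 2 * \<bar>mb \<sigma>\<bar> * (u \<sigma> i)\<^sup>2 + \<bar>u \<sigma> i\<bar> ^ 3)"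
    by (intro order_trans[OF sum_abs] sum_mono tanh_defect_taylor)
  also have "\<dots> = 2 * \<bar>mb \<sigma>\<bar> * U \<sigma> + S3 \<sigma>"
    by (simp add: sum.distrib sum_distrib_left S3_def U_def ip_self_eq)
  finally have "\<bar>\<Sum>i<N. ?r i\<bar> / real N \<le> (2 * \<bar>mb \<sigma>\<bar> * U \<sigma> + S3 \<sigma>) / real N" by (intro divide_right_mono) auto
  moreover have "avg N (\<lambda>i. tanh_defect (A \<sigma> i)) - tanh_defect (mb \<sigma>) = (\<Sum>i<N. ?r i) / real N"
    unfolding e avg_def using N_pos by (simp add: diff_divide_distrib)
  ultimately show ?thesis by simp
qed

definition G :: "(nat \<Rightarrow> real) \<Rightarrow> real" where
  "G \<sigma> = \<nu> * (\<bar>T \<sigma>\<bar> + (\<bar>T \<sigma>\<bar> + D)\<^sup>2 * sqrt (y \<sigma>) + 1) + \<omega> * (y \<sigma> * (\<bar>T \<sigma>\<bar> + D + z \<sigma> + sqrt (y \<sigma>)))"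

text \<open>The quantity \<open>ip N c \<sigma> / N\<close> enters twice: in passing from
  \<open>X\<close> to the mean field, and again in comparing the defects at these two points.
  Multiplication by \<open>q^3\<close> turns \<open>1 / N\<close> into \<open>1 / q\<close>.\<close>

lemma Rem_bound:
  assumes s: "\<sigma> \<in> Om"
  shows "\<bar>Rem \<sigma>\<bar> \<le> D ^ 4 * G \<sigma> + \<beta> \<sigma>"
proof -
  let ?W = "y \<sigma> * (\<bar>T \<sigma>\<bar> + D + z \<sigma> + sqrt (y \<sigma>))"
  let ?V = "\<bar>T \<sigma>\<bar> + (\<bar>T \<sigma>\<bar> + D)\<^sup>2 * sqrt (y \<sigma>) + 1"
  have V0: "0 \<le> ?V" and W0: "0 \<le> ?W" using y_nonneg z_nonneg D_pos by auto
  have "\<bar>tanh_defect (mb \<sigma>) - tanh_defect (X \<sigma>)\<bar> \<le> \<bar>ip N c \<sigma>\<bar> / real N"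
    using tanh_defect_lipschitz[of "mb \<sigma>" "X \<sigma>"] by (simp add: mb_X abs_divide)
  then have "\<bar>X \<sigma> - tb \<sigma> - tanh_defect (X \<sigma>)\<bar> \<le> 2 * (\<bar>ip N c \<sigma>\<bar> / real N) + (2 * \<bar>mb \<sigma>\<bar> * U \<sigma> + S3 \<sigma>) / real N"
  proof -
    assume a: "\<bar>tanh_defect (mb \<sigma>) - tanh_defect (X \<sigma>)\<bar> \<le> \<bar>ip N c \<sigma>\<bar> / real N"
    have "\<bar>ip N c \<sigma> / real N\<bar> = \<bar>ip N c \<sigma>\<bar> / real N" by (simp add: abs_divide)
    then show ?thesis using a avg_defect_bound[of \<sigma>] unfolding X_tb by linarith
  qed
  then have "q ^ 3 * \<bar>X \<sigma> - tb \<sigma> - tanh_defect (X \<sigma>)\<bar> \<le> q ^ 3 * (2 * (\<bar>ip N c \<sigma>\<bar> / real N) + (2 * \<bar>mb \<sigma>\<bar> * U \<sigma> + S3 \<sigma>) / real N)"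
    using q_pos by (intro mult_left_mono) auto
  also have "\<dots> = 2 * (\<bar>ip N c \<sigma>\<bar> / q) + 2 * (\<bar>mb \<sigma>\<bar> * U \<sigma> / q) + S3 \<sigma> / q"
    unfolding q4[symmetric] using q_pos by (simp add: field_simps power_numeral_reduce)
  finally have "\<bar>Rem \<sigma>\<bar> \<le> 2 * (\<bar>ip N c \<sigma>\<bar> / q) + 2 * (\<bar>mb \<sigma>\<bar> * U \<sigma> / q) + S3 \<sigma> / q"
    using q_pos by (simp add: Rem_def abs_mult)
  also have "\<dots> \<le> \<nu> * (4 * D * ?V) + \<beta> \<sigma> + 2 * (\<bar>mb \<sigma>\<bar> * U \<sigma> / q) + 13 * (S3 \<sigma> / q)"
  proof -
    have "2 * (v * (2 * d * w) + b / 2 + 6 * s) = v * (4 * d * w) + b + 12 * s" for v d w b s :: real by simp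
    from this[of \<nu> D ?V "\<beta> \<sigma>" "S3 \<sigma> / q"] show ?thesis using ip_c_bound[OF s] by linarith
  qed
  also have "\<dots> \<le> \<nu> * (4 * D * ?V) + \<beta> \<sigma> + 2 * (\<omega> * ?W) + 13 * (5 * D\<^sup>2 * \<omega> * ?W)"
  proof -
    have "\<omega> * (y \<sigma> * (\<bar>T \<sigma>\<bar> + D)) \<le> \<omega> * ?W"
      using \<omega>_nonneg y_nonneg z_nonneg by (intro mult_left_mono) auto
    then have "\<bar>mb \<sigma>\<bar> * U \<sigma> / q \<le> \<omega> * ?W" using mb_U_bound[OF s] by linarith
    then show ?thesis using S3_bound[OF s] by linarith
  qed
  also have "\<dots> = (4 * D ^ 1) * (\<nu> * ?V) + (2 * D ^ 0 + 65 * D ^ 2) * (\<omega> * ?W) + \<beta> \<sigma>"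
  proof -
    have "v * (4 * d * w) + b + 2 * x + 13 * (5 * dd * o' * W) = (4 * d) * (v * w) + (2 * 1 + 65 * dd) * x + b"
      if "x = o' * W" for v d w b x dd o' W :: real using that by (simp add: algebra_simps)
    from this[OF refl] show ?thesis by simp
  qed
  also have "\<dots> \<le> D ^ 4 * (\<nu> * ?V) + D ^ 4 * (\<omega> * ?W) + \<beta> \<sigma>"
  proof (intro add_mono mult_right_mono order_refl)
    show "4 * D ^ 1 \<le> D ^ 4" by (rule const_times_power_le[OF D, of 4 1]) auto
    have "D ^ 0 \<le> D ^ 2" using D by (intro power_increasing) auto
    then have "2 * D ^ 0 + 65 * D ^ 2 \<le> 67 * D ^ 2" by simp
    also have "67 * D ^ 2 \<le> D ^ 4" by (rule const_times_power_le[OF D, of 67 2]) auto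
    finally show "2 * D ^ 0 + 65 * D ^ 2 \<le> D ^ 4" .
  qed (use V0 W0 \<nu> \<omega>_nonneg in auto)
  also have "\<dots> = D ^ 4 * G \<sigma> + \<beta> \<sigma>" by (simp only: G_def distrib_left)
  finally show ?thesis .
qed

lemma X_flip: assumes "i < N" shows "X (flip i \<sigma>) = X \<sigma> - 2 * \<sigma> i / real N"
proof -
  have "(\<Sum>j<N. flip i \<sigma> j) = (\<Sum>j<N. \<sigma> j) - 2 * \<sigma> i"
    using assms by (simp add: flip_eq sum_subtractf sum_distrib_left[symmetric])
  then show ?thesis by (simp add: X_def avg_def diff_divide_distrib)
qed

section \<open>The fourth moment of the rescaled magnetization\<close>

lemma Ex_X_tb_le: "real N * Ex (\<lambda>\<sigma>. X \<sigma> * (X \<sigma> - tb \<sigma>)) \<le> 2"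
proof -
  have "real N * Ex (\<lambda>\<sigma>. X \<sigma> * (X \<sigma> - tb \<sigma>)) = Ex (\<lambda>\<sigma>. \<Sum>i<N. res \<sigma> i * X \<sigma>)"
    unfolding Ex_cmult[symmetric]
  proof (rule Ex_cong)
    fix \<sigma>
    have "X \<sigma> - tb \<sigma> = (\<Sum>i<N. res \<sigma> i) / real N"
      by (simp add: X_def tb_def avg_def res_def sum_subtractf diff_divide_distrib)
    then show "real N * (X \<sigma> * (X \<sigma> - tb \<sigma>)) = (\<Sum>i<N. res \<sigma> i * X \<sigma>)"
      using N_pos by (simp add: sum_distrib_right[symmetric])
  qed
  also have "\<dots> = (\<Sum>i<N. Ex (\<lambda>\<sigma>. res \<sigma> i * X \<sigma>))" by (rule Ex_sum)
  also have "\<dots> \<le> (\<Sum>i<N. 2 / real N)"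
  proof (rule sum_mono)
    fix i assume "i \<in> {..<N}"
    then have i: "i < N" by simp
    have "Ex (\<lambda>\<sigma>. res \<sigma> i * X \<sigma>) \<le> Ex (\<lambda>\<sigma>. \<bar>X \<sigma> - X (flip i \<sigma>)\<bar>)" by (rule stein_identity_bound[OF i])
    also have "\<dots> = Ex (\<lambda>\<sigma>. 2 / real N)"
    proof (rule Ex_cong)
      fix \<sigma> assume s: "\<sigma> \<in> Om"
      show "\<bar>X \<sigma> - X (flip i \<sigma>)\<bar> = 2 / real N" using Om_abs[OF s i] by (simp add: X_flip[OF i] abs_mult abs_divide)
    qed
    finally show "Ex (\<lambda>\<sigma>. res \<sigma> i * X \<sigma>) \<le> 2 / real N" by (simp add: Ex_const)
  qed
  also have "\<dots> = 2" using N_pos by simp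
  finally show ?thesis .
qed

text \<open>The Stein identity with test function \<open>X\<close> itself. The quantity
  \<open>N X (X - tb)\<close> has expectation at most 2 and equals the coercive
  \<open>N X * tanh_defect X\<close>, at least \<open>T^4 / 7\<close>, plus
  \<open>T * Rem\<close>.\<close>

lemma T4_le: "Ex (\<lambda>\<sigma>. (T \<sigma>) ^ 4) \<le> 14 + 7 * Ex (\<lambda>\<sigma>. \<bar>T \<sigma>\<bar> * \<bar>Rem \<sigma>\<bar>)"
proof -
  have "Ex (\<lambda>\<sigma>. (T \<sigma>) ^ 4 / 7) \<le> Ex (\<lambda>\<sigma>. real N * (X \<sigma> * (X \<sigma> - tb \<sigma>)) + \<bar>T \<sigma>\<bar> * \<bar>Rem \<sigma>\<bar>)"
  proof (rule Ex_mono)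
    fix \<sigma> assume s: "\<sigma> \<in> Om"
    have "(X \<sigma>) ^ 4 / 7 \<le> X \<sigma> * tanh_defect (X \<sigma>)" by (rule tanh_defect_lower[OF abs_spin_avg[OF s]])
    then have "real N * ((X \<sigma>) ^ 4 / 7) \<le> real N * (X \<sigma> * tanh_defect (X \<sigma>))" by (intro mult_left_mono) auto
    moreover have "real N * ((X \<sigma>) ^ 4 / 7) = (T \<sigma>) ^ 4 / 7" by (simp add: T_def power_mult_distrib q4)
    moreover have "real N * (X \<sigma> * (X \<sigma> - tb \<sigma>)) = real N * (X \<sigma> * tanh_defect (X \<sigma>)) + T \<sigma> * Rem \<sigma>"
      unfolding q4[symmetric] T_def Rem_def by (simp add: power_numeral_reduce algebra_simps)
    moreover have "- (\<bar>T \<sigma>\<bar> * \<bar>Rem \<sigma>\<bar>) \<le> T \<sigma> * Rem \<sigma>" unfolding abs_mult[symmetric] by linarith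
    ultimately show "(T \<sigma>) ^ 4 / 7 \<le> real N * (X \<sigma> * (X \<sigma> - tb \<sigma>)) + \<bar>T \<sigma>\<bar> * \<bar>Rem \<sigma>\<bar>" by linarith
  qed
  also have "\<dots> = real N * Ex (\<lambda>\<sigma>. X \<sigma> * (X \<sigma> - tb \<sigma>)) + Ex (\<lambda>\<sigma>. \<bar>T \<sigma>\<bar> * \<bar>Rem \<sigma>\<bar>)"
    by (simp only: Ex_add Ex_cmult)
  also have "\<dots> \<le> 2 + Ex (\<lambda>\<sigma>. \<bar>T \<sigma>\<bar> * \<bar>Rem \<sigma>\<bar>)" using Ex_X_tb_le by simp
  finally have "1 / 7 * Ex (\<lambda>\<sigma>. (T \<sigma>) ^ 4) \<le> 2 + Ex (\<lambda>\<sigma>. \<bar>T \<sigma>\<bar> * \<bar>Rem \<sigma>\<bar>)"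
    unfolding Ex_cmult[symmetric] by simp
  then show ?thesis by simp
qed

end

section \<open>Closing the moment estimates\<close>

lemma young_quartic:
  fixes x r s :: real
  assumes "0 \<le> x" "0 < s" "s \<le> 1" "0 \<le> r"
  shows "x * ((x + r)\<^sup>2 * r) \<le> 4 * s * x ^ 4 + 4 * r ^ 4 / s ^ 3"
proof (cases "r \<le> s * x")
  case True
  have "s * x \<le> 1 * x" using assms by (intro mult_right_mono) auto
  then have "r \<le> x" using True by simp
  then have "(x + r)\<^sup>2 \<le> (2 * x)\<^sup>2" using assms by (intro power_mono) auto
  then have "x * ((x + r)\<^sup>2 * r) \<le> x * ((2 * x)\<^sup>2 * (s * x))"
    using assms True by (intro mult_left_mono mult_mono) auto
  also have "\<dots> = 4 * s * x ^ 4" by (simp add: power2_eq_square power4_eq_xxxx)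
  finally show ?thesis using assms by (simp add: add_increasing2)
next
  case False
  then have x: "x \<le> r / s" using assms by (simp add: field_simps)
  have "s * r \<le> 1 * r" using assms by (intro mult_right_mono) auto
  then have r: "r \<le> r / s" using assms by (simp add: field_simps)
  have "(x + r)\<^sup>2 \<le> (2 * (r / s))\<^sup>2" using x r assms by (intro power_mono) auto
  then have "x * ((x + r)\<^sup>2 * r) \<le> (r / s) * ((2 * (r / s))\<^sup>2 * r)"
    using assms x by (intro mult_mono) auto
  also have "\<dots> = 4 * r ^ 4 / s ^ 3" by (simp add: power2_eq_square power4_eq_xxxx power3_eq_cube mult_ac)
  finally show ?thesis using assms by (simp add: add_increasing)
qed

context critical
begin

definition H :: real where "H = Ex (\<lambda>\<sigma>. (T \<sigma>) ^ 4)"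
text \<open>The homogeneous scale: \<open>y\<close> and \<open>\<beta>\<close> are at most
  \<open>r^2\<close> and \<open>z\<close> is at most \<open>r\<close>, so the remainder is dominated
  by a cubic in \<open>|T|\<close> and \<open>r\<close>, and \<open>|T| * |Rem|\<close> by a
  quartic.\<close>

definition r :: "(nat \<Rightarrow> real) \<Rightarrow> real" where "r \<sigma> = sqrt (sqrt (Lam \<sigma>))"

lemma H_nonneg: "0 \<le> H" unfolding H_def by (rule Ex_nonneg) simp

lemma Lam_ge_1: "1 \<le> Lam \<sigma>" by (simp add: Lam_def)

lemma r4: "r \<sigma> ^ 4 = Lam \<sigma>"
proof -
  have "(r \<sigma>)\<^sup>2 = sqrt (Lam \<sigma>)" using Lam_ge_1[of \<sigma>] by (simp add: r_def)
  then have "((r \<sigma>)\<^sup>2)\<^sup>2 = Lam \<sigma>" using Lam_ge_1[of \<sigma>] by simp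
  then show ?thesis by (simp add: power_mult[symmetric])
qed

lemma r_ge_1: "1 \<le> r \<sigma>"
  using Lam_ge_1[of \<sigma>] by (simp add: r_def)

lemma y_le: "y \<sigma> \<le> (r \<sigma>)\<^sup>2" and \<beta>_le: "\<beta> \<sigma> \<le> (r \<sigma>)\<^sup>2" and z_le: "z \<sigma> \<le> r \<sigma>"
proof -
  have r2: "((r \<sigma>)\<^sup>2)\<^sup>2 = Lam \<sigma>" using r4[of \<sigma>] by (simp add: power_mult[symmetric])
  have "(y \<sigma>)\<^sup>2 \<le> ((r \<sigma>)\<^sup>2)\<^sup>2" unfolding r2 Lam_def by simp
  then show "y \<sigma> \<le> (r \<sigma>)\<^sup>2" by (rule power2_le_imp_le) simp
  have "(\<beta> \<sigma>)\<^sup>2 \<le> ((r \<sigma>)\<^sup>2)\<^sup>2" unfolding r2 Lam_def by simp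
  then show "\<beta> \<sigma> \<le> (r \<sigma>)\<^sup>2" by (rule power2_le_imp_le) simp
  have "(z \<sigma>) ^ 4 \<le> (r \<sigma>) ^ 4" unfolding r4 Lam_def by simp
  then show "z \<sigma> \<le> r \<sigma>"
    using power_strict_mono[of "r \<sigma>" "z \<sigma>" 4] r_ge_1[of \<sigma>] by (meson linorder_not_le order_trans zero_le_one zero_less_numeral)
qed

lemma sqrt_y_le: "sqrt (y \<sigma>) \<le> r \<sigma>"
  using real_sqrt_le_mono[OF y_le[of \<sigma>]] r_ge_1[of \<sigma>] by simp

lemma T_D_le: "\<bar>T \<sigma>\<bar> + D \<le> D * (\<bar>T \<sigma>\<bar> + r \<sigma>)"
proof -
  have "1 * \<bar>T \<sigma>\<bar> \<le> D * \<bar>T \<sigma>\<bar>" using D by (intro mult_right_mono) auto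
  moreover have "D * 1 \<le> D * r \<sigma>" using D_pos r_ge_1 by (intro mult_left_mono) auto
  ultimately show ?thesis by (simp add: distrib_left)
qed

text \<open>One cubic dominating every monomial of the remainder bound. The single factor
  \<open>r\<close> matters: it lets Young's inequality make the \<open>T^4\<close> part as small as
  desired.\<close>

definition P :: "(nat \<Rightarrow> real) \<Rightarrow> real" where "P \<sigma> = (\<bar>T \<sigma>\<bar> + r \<sigma>)\<^sup>2 * r \<sigma>"

lemma P_ge: "1 \<le> P \<sigma>" "\<bar>T \<sigma>\<bar> \<le> P \<sigma>" "(r \<sigma>)\<^sup>2 * (\<bar>T \<sigma>\<bar> + r \<sigma>) \<le> P \<sigma>" "(r \<sigma>)\<^sup>2 \<le> P \<sigma>"
proof -
  let ?s = "\<bar>T \<sigma>\<bar> + r \<sigma>"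
  have s1: "1 \<le> ?s" using r_ge_1[of \<sigma>] by linarith
  have rs: "r \<sigma> \<le> ?s" by simp
  have r0: "0 \<le> r \<sigma>" using r_ge_1[of \<sigma>] by linarith
  have "?s * 1 \<le> ?s * ?s" using s1 by (intro mult_left_mono) auto
  then have s2: "?s \<le> ?s\<^sup>2" by (simp add: power2_eq_square)
  have sP: "?s\<^sup>2 \<le> P \<sigma>"
    using mult_left_mono[OF r_ge_1[of \<sigma>], of "?s\<^sup>2"] by (simp add: P_def)
  then show "1 \<le> P \<sigma>" using s1 s2 by linarith
  show "\<bar>T \<sigma>\<bar> \<le> P \<sigma>" using sP s2 r0 by linarith
  have "(r \<sigma> * ?s) * r \<sigma> \<le> (?s * ?s) * r \<sigma>" using rs r0 s1 by (intro mult_right_mono) auto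
  then show a: "(r \<sigma>)\<^sup>2 * ?s \<le> P \<sigma>" by (simp add: P_def power2_eq_square mult_ac)
  have "(r \<sigma>)\<^sup>2 * 1 \<le> (r \<sigma>)\<^sup>2 * ?s" using s1 by (intro mult_left_mono) auto
  then show "(r \<sigma>)\<^sup>2 \<le> P \<sigma>" using a by simp
qed

lemma G_parts:
  "\<bar>T \<sigma>\<bar> + (\<bar>T \<sigma>\<bar> + D)\<^sup>2 * sqrt (y \<sigma>) + 1 \<le> 2 * D\<^sup>2 * P \<sigma>"
  "y \<sigma> * (\<bar>T \<sigma>\<bar> + D + z \<sigma> + sqrt (y \<sigma>)) \<le> 2 * D * P \<sigma>"
proof -
  let ?s = "\<bar>T \<sigma>\<bar> + r \<sigma>"
  have r0: "0 \<le> r \<sigma>" using r_ge_1[of \<sigma>] by linarith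
  have "(\<bar>T \<sigma>\<bar> + D)\<^sup>2 \<le> (D * ?s)\<^sup>2" using D_pos T_D_le[of \<sigma>] by (intro power_mono) auto
  then have "(\<bar>T \<sigma>\<bar> + D)\<^sup>2 * sqrt (y \<sigma>) \<le> (D * ?s)\<^sup>2 * r \<sigma>"
    using y_nonneg sqrt_y_le by (intro mult_mono) auto
  then have a: "(\<bar>T \<sigma>\<bar> + D)\<^sup>2 * sqrt (y \<sigma>) \<le> D\<^sup>2 * P \<sigma>" by (simp add: P_def power_mult_distrib mult_ac)
  have "100 * P \<sigma> \<le> D\<^sup>2 * P \<sigma>"
    using power_mono[OF D, of 2] P_ge(1)[of \<sigma>] by (intro mult_right_mono) auto
  then show "\<bar>T \<sigma>\<bar> + (\<bar>T \<sigma>\<bar> + D)\<^sup>2 * sqrt (y \<sigma>) + 1 \<le> 2 * D\<^sup>2 * P \<sigma>"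
    using a P_ge(1,2)[of \<sigma>] by linarith
  have "2 * r \<sigma> \<le> D * ?s"
    using mult_mono[of 2 D "r \<sigma>" ?s] D r0 by auto
  then have "\<bar>T \<sigma>\<bar> + D + z \<sigma> + sqrt (y \<sigma>) \<le> 2 * D * ?s"
    using T_D_le[of \<sigma>] z_le[of \<sigma>] sqrt_y_le[of \<sigma>] by linarith
  then have "y \<sigma> * (\<bar>T \<sigma>\<bar> + D + z \<sigma> + sqrt (y \<sigma>)) \<le> (r \<sigma>)\<^sup>2 * (2 * D * ?s)"
    using y_le y_nonneg z_nonneg D_pos by (intro mult_mono) auto
  also have "\<dots> = 2 * D * ((r \<sigma>)\<^sup>2 * ?s)" by simp
  also have "\<dots> \<le> 2 * D * P \<sigma>" using P_ge(3) D_pos by (intro mult_left_mono) auto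
  finally show "y \<sigma> * (\<bar>T \<sigma>\<bar> + D + z \<sigma> + sqrt (y \<sigma>)) \<le> 2 * D * P \<sigma>" .
qed

lemma G_le: "G \<sigma> \<le> D ^ 3 * ((\<nu> + \<omega>) * P \<sigma>)"
proof -
  have P0: "0 \<le> P \<sigma>" using P_ge(1)[of \<sigma>] by linarith
  have d: "2 * D\<^sup>2 \<le> D ^ 3" by (rule const_times_power_le[OF D, of 2 1]) auto
  have d': "2 * D \<le> D ^ 3" using const_times_power_le[OF D, of 2 1 1 3] by auto
  have "G \<sigma> \<le> \<nu> * (2 * D\<^sup>2 * P \<sigma>) + \<omega> * (2 * D * P \<sigma>)"
    unfolding G_def using G_parts \<nu> \<omega>_nonneg by (intro add_mono mult_left_mono) auto
  also have "\<dots> \<le> \<nu> * (D ^ 3 * P \<sigma>) + \<omega> * (D ^ 3 * P \<sigma>)"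
    using d d' \<nu> \<omega>_nonneg P0 by (intro add_mono mult_left_mono mult_right_mono) auto
  also have "\<dots> = D ^ 3 * ((\<nu> + \<omega>) * P \<sigma>)" by (simp add: algebra_simps)
  finally show ?thesis .
qed

text \<open>Young's inequality with parameter \<open>1 / D ^ 10\<close> against the prefactor
  \<open>D ^ 8\<close> leaves \<open>4 / D^2\<close> of the fourth power. As \<open>1/14\<close> it
  takes only half of the left side in \<open>T4_le\<close>. The price is
  \<open>D ^ 8 * D ^ 30\<close> in front of \<open>Lam\<close>.\<close>

lemma T_Rem_le:
  assumes s: "\<sigma> \<in> Om"
  shows "\<bar>T \<sigma>\<bar> * \<bar>Rem \<sigma>\<bar> \<le> 1 / 14 * (T \<sigma>) ^ 4 + D ^ 40 * Lam \<sigma>"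
proof -
  have P0: "0 \<le> P \<sigma>" using P_ge(1)[of \<sigma>] by linarith
  have r0: "0 \<le> r \<sigma>" using r_ge_1[of \<sigma>] by linarith
  have "\<bar>Rem \<sigma>\<bar> \<le> D ^ 4 * G \<sigma> + \<beta> \<sigma>" by (rule Rem_bound[OF s])
  also have "\<dots> \<le> D ^ 4 * (D ^ 3 * (3 * P \<sigma>)) + D ^ 7 * P \<sigma>"
  proof (intro add_mono mult_left_mono)
    have "(\<nu> + \<omega>) * P \<sigma> \<le> 3 * P \<sigma>" using \<nu> \<omega>_le_2 P0 by (intro mult_right_mono) auto
    then have "D ^ 3 * ((\<nu> + \<omega>) * P \<sigma>) \<le> D ^ 3 * (3 * P \<sigma>)" using D_pos by (intro mult_left_mono) auto
    then show "G \<sigma> \<le> D ^ 3 * (3 * P \<sigma>)" using G_le[of \<sigma>] by linarith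
    have "1 * P \<sigma> \<le> D ^ 7 * P \<sigma>" using D P0 by (intro mult_right_mono one_le_power) auto
    then show "\<beta> \<sigma> \<le> D ^ 7 * P \<sigma>" using \<beta>_le[of \<sigma>] P_ge(4)[of \<sigma>] by linarith
  qed (use D_pos in auto)
  also have "\<dots> = (4 * D ^ 7) * P \<sigma>" by (simp add: power_add[symmetric] mult.assoc[symmetric])
  also have "\<dots> \<le> D ^ 8 * P \<sigma>"
    using P0 by (intro mult_right_mono const_times_power_le[OF D, of 4 1]) auto
  finally have "\<bar>T \<sigma>\<bar> * \<bar>Rem \<sigma>\<bar> \<le> \<bar>T \<sigma>\<bar> * (D ^ 8 * P \<sigma>)" by (intro mult_left_mono) auto
  also have "\<dots> = D ^ 8 * (\<bar>T \<sigma>\<bar> * ((\<bar>T \<sigma>\<bar> + r \<sigma>)\<^sup>2 * r \<sigma>))" by (simp add: P_def)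
  also have "\<dots> \<le> D ^ 8 * (4 * (1 / D ^ 10) * \<bar>T \<sigma>\<bar> ^ 4 + 4 * r \<sigma> ^ 4 / (1 / D ^ 10) ^ 3)"
    using D r0 by (intro mult_left_mono young_quartic) (auto simp: one_le_power)
  also have "\<dots> = (4 / D ^ 2) * (T \<sigma>) ^ 4 + (4 * D ^ 38) * Lam \<sigma>"
  proof -
    have e1: "D ^ 8 / D ^ 10 = 1 / D ^ 2" using D_pos by (simp add: field_simps power_add[symmetric])
    have e2: "D ^ 8 * (D ^ 10) ^ 3 = D ^ 38" by (simp add: power_mult[symmetric] power_add[symmetric])
    have gen: "d8 * (4 * (1 / d10) * t + 4 * l / (1 / d10) ^ 3) = (4 * (d8 / d10)) * t + (4 * (d8 * d10 ^ 3)) * l"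
      for d8 d10 t l :: real by (simp add: power_divide algebra_simps)
    show ?thesis unfolding gen e1 e2 r4 by simp
  qed
  also have "\<dots> \<le> 1 / 14 * (T \<sigma>) ^ 4 + D ^ 40 * Lam \<sigma>"
  proof (intro add_mono mult_right_mono)
    have "100 \<le> D ^ 2" using power_mono[OF D, of 2] by simp
    then show "4 / D ^ 2 \<le> 1 / 14" using D_pos by (simp add: field_simps)
    show "4 * D ^ 38 \<le> D ^ 40" by (rule const_times_power_le[OF D, of 4 1]) auto
  qed (use Lam_ge_1[of \<sigma>] in auto)
  finally show ?thesis .
qed

lemma H_le_Lam: "H \<le> D ^ 42 * Ex Lam"
proof -
  have "Ex (\<lambda>\<sigma>. \<bar>T \<sigma>\<bar> * \<bar>Rem \<sigma>\<bar>) \<le> Ex (\<lambda>\<sigma>. 1 / 14 * (T \<sigma>) ^ 4 + D ^ 40 * Lam \<sigma>)"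
    by (rule Ex_mono) (rule T_Rem_le)
  also have "\<dots> = 1 / 14 * H + D ^ 40 * Ex Lam" by (simp only: Ex_add Ex_cmult H_def)
  finally have h: "H \<le> 28 + 14 * (D ^ 40 * Ex Lam)" using T4_le unfolding H_def[symmetric] by linarith
  have E1: "1 \<le> Ex Lam" using Ex_mono[of "\<lambda>_. 1" Lam] Lam_ge_1 by (simp add: Ex_const)
  have "1 * 1 \<le> D ^ 40 * Ex Lam" using E1 D by (intro mult_mono one_le_power) auto
  then have "H \<le> (42 * D ^ 40) * Ex Lam" using h by (simp add: mult.assoc)
  also have "\<dots> \<le> D ^ 42 * Ex Lam"
    using E1 by (intro mult_right_mono const_times_power_le[OF D, of 42 2]) auto
  finally show ?thesis .
qed

lemma Ex_mb4: "real N * Ex (\<lambda>\<sigma>. (mb \<sigma>) ^ 4) \<le> 8 * (H + D ^ 4)"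
proof -
  have "real N * Ex (\<lambda>\<sigma>. (mb \<sigma>) ^ 4) = Ex (\<lambda>\<sigma>. real N * (mb \<sigma>) ^ 4)" by (rule Ex_cmult[symmetric])
  also have "\<dots> \<le> Ex (\<lambda>\<sigma>. 8 * ((T \<sigma>) ^ 4 + D ^ 4))"
  proof (rule Ex_mono)
    fix \<sigma> assume s: "\<sigma> \<in> Om"
    have "real N * (mb \<sigma>) ^ 4 = (q * \<bar>mb \<sigma>\<bar>) ^ 4" by (simp add: power_mult_distrib q4)
    also have "\<dots> \<le> (\<bar>T \<sigma>\<bar> + D) ^ 4" using q_mb[OF s] q_pos by (intro power_mono) auto
    also have "\<dots> \<le> 8 * (\<bar>T \<sigma>\<bar> ^ 4 + D ^ 4)" by (rule power4_sum_le)
    finally show "real N * (mb \<sigma>) ^ 4 \<le> 8 * ((T \<sigma>) ^ 4 + D ^ 4)" by simp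
  qed
  also have "\<dots> = 8 * (H + D ^ 4)" by (simp only: Ex_cmult Ex_add Ex_const H_def)
  finally show ?thesis .
qed

lemma Ex_U2: "Ex (\<lambda>\<sigma>. (U \<sigma>)\<^sup>2) \<le> D ^ 21 * e\<^sup>2 + D ^ 16 * H"
proof -
  have k4: "real N * \<kappa> ^ 4 \<le> D ^ 4"
    using power_mono[OF \<kappa>_q, of 4] \<kappa>_nonneg q_pos by (simp add: power_mult_distrib q4 mult.commute)
  have k0: "0 \<le> real N * \<kappa> ^ 4" by simp
  have d1: "1 / \<delta> ^ 4 \<le> D ^ 4" using power_mono[OF \<delta>_D, of 4] \<delta>_pos by (simp add: power_divide)
  have large: "8 * 32 ^ 4 * (real N * \<kappa> ^ 4) / \<delta> ^ 4 \<le> real N"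
  proof -
    have "8 * 32 ^ 4 * (real N * \<kappa> ^ 4) / \<delta> ^ 4 = 8 * 32 ^ 4 * (real N * \<kappa> ^ 4) * (1 / \<delta> ^ 4)" by simp
    also have "\<dots> \<le> 8 * 32 ^ 4 * D ^ 4 * D ^ 4"
      using k4 k0 d1 \<delta>_pos by (intro mult_mono) auto
    also have "\<dots> = 8388608 * D ^ 8" by (simp add: power_add[symmetric])
    also have "\<dots> \<le> D ^ 40" by (rule const_times_power_le[OF D, of _ 7]) auto
    finally show ?thesis using L L_le_N by linarith
  qed
  let ?E = "Ex (\<lambda>\<sigma>. (U \<sigma>)\<^sup>2)"
  let ?rhs = "32 / \<delta> * Fr\<^sup>2 + 12800 / \<delta> + 56 * Fr
    + 8 * (32 / \<delta>) ^ 3 * (real N * \<kappa> ^ 4) * (real N * Ex (\<lambda>\<sigma>. (mb \<sigma>) ^ 4))"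
  have e2: "e \<le> e\<^sup>2" "1 \<le> e\<^sup>2" using e_ge_1 by (simp_all add: power2_eq_square mult_ge1_I mult_left_mono[of 1 e e, simplified])
  have b1: "32 / \<delta> * Fr\<^sup>2 \<le> 32 * D * e\<^sup>2"
    using \<delta>_D \<delta>_pos Fr_nonneg e_Fr D_pos by (intro mult_mono power_mono) auto
  have b2: "12800 / \<delta> \<le> 12800 * D * e\<^sup>2"
  proof -
    have "12800 * (1 / \<delta>) * 1 \<le> 12800 * D * e\<^sup>2"
      using \<delta>_D \<delta>_pos e2 D_pos by (intro mult_mono) auto
    then show ?thesis by simp
  qed
  have b3: "56 * Fr \<le> 6 * D * e\<^sup>2"
  proof -
    have "56 * Fr \<le> (6 * D) * e\<^sup>2" using D e_Fr e2 Fr_nonneg by (intro mult_mono) auto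
    then show ?thesis by simp
  qed
  have b4: "8 * (32 / \<delta>) ^ 3 * (real N * \<kappa> ^ 4) * (real N * Ex (\<lambda>\<sigma>. (mb \<sigma>) ^ 4)) \<le> 8 * (32 * D) ^ 3 * D ^ 4 * (8 * (H + D ^ 4))"
  proof (rule mult_mono[OF mult_mono[OF _ k4] Ex_mb4])
    have "32 / \<delta> \<le> 32 * D" using \<delta>_D by simp
    then show "8 * (32 / \<delta>) ^ 3 \<le> 8 * (32 * D) ^ 3" using \<delta>_pos by (intro mult_left_mono power_mono) auto
    show "0 \<le> 8 * (32 * D) ^ 3" "0 \<le> 8 * (32 * D) ^ 3 * D ^ 4" using D_pos by auto
    show "0 \<le> real N * Ex (\<lambda>\<sigma>. (mb \<sigma>) ^ 4)" by (intro mult_nonneg_nonneg Ex_nonneg) auto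
  qed (rule k0)
  have "?E = (8 / \<delta>) * (\<delta> / 8 * ?E)" using \<delta>_pos by simp
  also have "\<dots> \<le> (8 / \<delta>) * ?rhs" using energy_second_moment[OF large] \<delta>_pos by (intro mult_left_mono) auto
  also have "\<dots> \<le> (8 * D) * (12838 * D * e\<^sup>2 + 8 * (32 * D) ^ 3 * D ^ 4 * (8 * (H + D ^ 4)))"
  proof (rule mult_mono)
    show "?rhs \<le> 12838 * D * e\<^sup>2 + 8 * (32 * D) ^ 3 * D ^ 4 * (8 * (H + D ^ 4))"
    proof -
      have "32 * D * e\<^sup>2 + 12800 * D * e\<^sup>2 + 6 * D * e\<^sup>2 = 12838 * D * e\<^sup>2" by simp
      then show ?thesis using b1 b2 b3 b4 by linarith
    qed
    have "0 \<le> \<delta> / 8 * ?E" using \<delta>_pos by (intro mult_nonneg_nonneg Ex_nonneg) auto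
    then show "0 \<le> ?rhs" using energy_second_moment[OF large] by linarith
  qed (use \<delta>_D D_pos in auto)
  also have "\<dots> = (102704 * D ^ 2) * e\<^sup>2 + (16777216 * D ^ 8) * H + 16777216 * D ^ 12"
  proof -
    have "(8 * D) * (12838 * D * x + 8 * (32 * D) ^ 3 * D ^ 4 * (8 * (h + D ^ 4))) = (102704 * (D * D)) * x + (16777216 * (D * D ^ 3 * D ^ 4)) * h + 16777216 * (D * D ^ 3 * D ^ 4 * D ^ 4)" for x h
      by (simp add: power_mult_distrib algebra_simps)
    moreover have "D * D = D ^ 2" "D * D ^ 3 * D ^ 4 = D ^ 8" "D ^ 8 * D ^ 4 = D ^ 12" by (simp_all add: eval_nat_numeral)
    ultimately show ?thesis by simp
  qed
  also have "\<dots> \<le> D ^ 20 * e\<^sup>2 + D ^ 16 * H + D ^ 20 * e\<^sup>2"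
  proof (intro add_mono mult_right_mono)
    show "102704 * D ^ 2 \<le> D ^ 20" by (rule const_times_power_le[OF D, of _ 6]) auto
    show "16777216 * D ^ 8 \<le> D ^ 16" by (rule const_times_power_le[OF D, of _ 8]) auto
    have "16777216 * D ^ 12 \<le> D ^ 20" by (rule const_times_power_le[OF D, of _ 8]) auto
    moreover have "D ^ 20 * 1 \<le> D ^ 20 * e\<^sup>2" using e2 D_pos by (intro mult_left_mono) auto
    ultimately show "16777216 * D ^ 12 \<le> D ^ 20 * e\<^sup>2" by linarith
  qed (use H_nonneg in auto)
  also have "\<dots> = (2 * D ^ 20) * e\<^sup>2 + D ^ 16 * H" by simp
  also have "\<dots> \<le> D ^ 21 * e\<^sup>2 + D ^ 16 * H"
    by (intro add_right_mono mult_right_mono const_times_power_le[OF D, of 2 1]) auto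
  finally show ?thesis .
qed

text \<open>The decisive gain: division by \<open>e^2 >= D^80\<close> reduces the feedback
  coefficient \<open>D^16\<close> of the energy bound to \<open>D^(-64)\<close>.\<close>

lemma Ex_y2: "Ex (\<lambda>\<sigma>. (y \<sigma>)\<^sup>2) \<le> D ^ 21 + H / D ^ 64"
proof -
  have e2: "D ^ 80 \<le> e\<^sup>2"
  proof -
    have "(D ^ 40)\<^sup>2 \<le> e\<^sup>2" using L e_L D_pos by (intro power_mono) auto
    then show ?thesis by (simp add: power_mult[symmetric])
  qed
  have "Ex (\<lambda>\<sigma>. (y \<sigma>)\<^sup>2) = Ex (\<lambda>\<sigma>. 1 / e\<^sup>2 * (U \<sigma>)\<^sup>2)" by (simp add: y_def power_divide)
  also have "\<dots> = Ex (\<lambda>\<sigma>. (U \<sigma>)\<^sup>2) / e\<^sup>2" by (simp only: Ex_cmult) simp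
  also have "\<dots> \<le> (D ^ 21 * e\<^sup>2 + D ^ 16 * H) / e\<^sup>2" by (intro divide_right_mono Ex_U2) auto
  also have "\<dots> = D ^ 21 + D ^ 16 * H / e\<^sup>2" using e_ge_1 by (simp add: add_divide_distrib)
  also have "D ^ 16 * H / e\<^sup>2 \<le> D ^ 16 * H / D ^ 80"
    using e2 H_nonneg D_pos e_ge_1 by (intro divide_left_mono) auto
  also have "D ^ 16 * H / D ^ 80 = H / D ^ 64"
    using D_pos power_add[of D 16 64] by (simp add: field_simps)
  finally show ?thesis by simp
qed

text \<open>The origin of \<open>L ^ 3\<close> in \<open>r0\<close>: the supremum bound contains
  about \<open>L\<close> copies of \<open>hs\<close>, and \<open>hs^2\<close> is of order
  \<open>p * \<alpha>\<close> with \<open>p\<close> of order \<open>L\<close>, so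
  \<open>(L * hs)^2\<close> is of order \<open>L^3 * \<alpha>\<close>.\<close>

lemma Ex_z4: "Ex (\<lambda>\<sigma>. (z \<sigma>) ^ 4) \<le> D ^ 5"
proof -
  have r04: "r0 ^ 4 = L ^ 6 * \<alpha>\<^sup>2"
  proof -
    have "r0 ^ 4 = (r0\<^sup>2)\<^sup>2" by (simp add: power_mult[symmetric])
    then show ?thesis unfolding r0_sq power_mult_distrib by (simp add: power_mult[symmetric])
  qed
  have L0: "0 < L" using L_ge_1 by linarith
  have "Ex (\<lambda>\<sigma>. (z \<sigma>) ^ 4) = Ex (\<lambda>\<sigma>. (L ^ 4 / r0 ^ 4) * (hs \<sigma>) ^ 4)"
    by (simp add: z_def power_divide power_mult_distrib)
  also have "\<dots> = (L ^ 4 / r0 ^ 4) * Ex (\<lambda>\<sigma>. (hs \<sigma>) ^ 4)" by (rule Ex_cmult)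
  also have "\<dots> \<le> (L ^ 4 / r0 ^ 4) * (2 * (72 * real p * \<alpha>)\<^sup>2)"
    by (intro mult_left_mono hs_fourth_moment alpha_le \<alpha>_pos p(1,2)) auto
  also have "\<dots> \<le> (L ^ 4 / r0 ^ 4) * (2 * (72 * (2 * L) * \<alpha>)\<^sup>2)"
    using p(3) \<alpha>_pos by (intro mult_left_mono power_mono mult_right_mono) auto
  also have "\<dots> = 41472"
    unfolding r04 using L0 \<alpha>_pos by (simp add: power_mult_distrib field_simps eval_nat_numeral)
  also have "41472 \<le> D ^ 5" using const_times_power_le[OF D, of 41472 5 0 5] by simp
  finally show ?thesis .
qed

lemma Ex_\<beta>2: "Ex (\<lambda>\<sigma>. (\<beta> \<sigma>)\<^sup>2) \<le> D ^ 4 * \<nu>\<^sup>2"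
proof -
  have "Ex (\<lambda>\<sigma>. (\<beta> \<sigma>)\<^sup>2) = Ex (\<lambda>\<sigma>. (1 / q\<^sup>2) * (ip N (neu l) (res \<sigma>))\<^sup>2)"
    by (simp add: \<beta>_def power_divide)
  also have "\<dots> = (1 / q\<^sup>2) * Ex (\<lambda>\<sigma>. (ip N (neu l) (res \<sigma>))\<^sup>2)" by (rule Ex_cmult)
  also have "\<dots> \<le> (1 / q\<^sup>2) * (24 * (nm N (neu l))\<^sup>2)"
    unfolding nm_sq by (intro mult_left_mono noise_second_moment) auto
  also have "\<dots> \<le> (1 / q\<^sup>2) * (24 * (2 * D * (\<nu> * q))\<^sup>2)"
    by (intro mult_left_mono power_mono nm_neu_\<nu>) auto
  also have "\<dots> = (96 * D ^ 2) * \<nu>\<^sup>2" using q_pos by (simp add: power_mult_distrib)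
  also have "\<dots> \<le> D ^ 4 * \<nu>\<^sup>2" by (intro mult_right_mono const_times_power_le[OF D, of 96 2]) auto
  finally show ?thesis .
qed

lemma Ex_\<beta>: "Ex \<beta> \<le> D\<^sup>2 * \<nu>"
proof -
  have "(Ex (\<lambda>\<sigma>. \<bar>\<beta> \<sigma>\<bar>))\<^sup>2 \<le> Ex (\<lambda>\<sigma>. (\<beta> \<sigma>)\<^sup>2)" by (rule Ex_abs_sq_le)
  also have "\<dots> \<le> D ^ 4 * \<nu>\<^sup>2" by (rule Ex_\<beta>2)
  also have "\<dots> = (D\<^sup>2 * \<nu>)\<^sup>2" by (simp add: power_mult_distrib power_mult[symmetric])
  finally have "Ex (\<lambda>\<sigma>. \<bar>\<beta> \<sigma>\<bar>) \<le> D\<^sup>2 * \<nu>"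
    by (rule power2_le_imp_le) (use \<nu> in simp)
  moreover have "Ex \<beta> = Ex (\<lambda>\<sigma>. \<bar>\<beta> \<sigma>\<bar>)" using \<beta>_nonneg by (intro Ex_cong) simp
  ultimately show ?thesis by simp
qed

lemma Ex_Lam_H: "Ex Lam \<le> D ^ 22 + H / D ^ 64"
proof -
  have "Ex Lam = 1 + Ex (\<lambda>\<sigma>. (y \<sigma>)\<^sup>2) + Ex (\<lambda>\<sigma>. (z \<sigma>) ^ 4) + Ex (\<lambda>\<sigma>. (\<beta> \<sigma>)\<^sup>2)"
    unfolding Lam_def[abs_def] by (simp only: Ex_add Ex_const)
  moreover have "Ex (\<lambda>\<sigma>. (\<beta> \<sigma>)\<^sup>2) \<le> D ^ 4"
  proof -
    have "D ^ 4 * \<nu>\<^sup>2 \<le> D ^ 4 * 1" using \<nu> D_pos by (intro mult_left_mono) (auto simp: power_le_one)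
    then show ?thesis using Ex_\<beta>2 by linarith
  qed
  moreover have "1 + D ^ 21 + D ^ 5 + D ^ 4 \<le> D ^ 22"
  proof -
    have "1 \<le> D ^ 21" "D ^ 5 \<le> D ^ 21" "D ^ 4 \<le> D ^ 21" using D by (auto intro!: one_le_power power_increasing)
    moreover have "4 * D ^ 21 \<le> D ^ 22" by (rule const_times_power_le[OF D, of 4 1]) auto
    ultimately show ?thesis by linarith
  qed
  ultimately show ?thesis using Ex_y2 Ex_z4 by linarith
qed

text \<open>The loop closes here: \<open>D^42\<close> from \<open>H_le_Lam\<close> meets
  \<open>D^(-64)\<close> from the energy, and \<open>H / D^22\<close> is absorbed on the left.
  Finiteness of \<open>H\<close> is automatic on a finite space.\<close>

lemma H_bound: "H \<le> D ^ 65"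
proof -
  have "H \<le> D ^ 42 * (D ^ 22 + H / D ^ 64)"
    by (rule order_trans[OF H_le_Lam mult_left_mono[OF Ex_Lam_H]]) (use D_pos in simp)
  also have "\<dots> = D ^ 64 + H / D ^ 22"
  proof -
    have e1: "D ^ 42 * D ^ 22 = D ^ 64" and e2: "D ^ 42 / D ^ 64 = 1 / D ^ 22"
      using D_pos power_add[of D 42 22] by (simp_all add: field_simps)
    have gen: "a * (b + h / d) = a * b + h * (a / d)" for a b h d :: real by (simp add: algebra_simps)
    show ?thesis unfolding gen e1 e2 by simp
  qed
  finally have h: "H \<le> D ^ 64 + H / D ^ 22" .
  have "2 \<le> D ^ 22" using const_times_power_le[OF D, of 2 1 0 22] by simp
  then have "H / D ^ 22 \<le> H / 2" using H_nonneg by (intro divide_left_mono) auto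
  then have "H \<le> 2 * D ^ 64" using h by linarith
  also have "\<dots> \<le> D ^ 65" by (rule const_times_power_le[OF D, of 2 1]) auto
  finally show ?thesis .
qed

lemma Ex_Lam: "Ex Lam \<le> D ^ 24"
proof -
  have "H / D ^ 64 \<le> D"
    using H_bound D_pos by (simp add: field_simps power_add[of D 1 64, simplified])
  moreover have "D \<le> D ^ 22" using D power_increasing[of 1 22 D] by simp
  moreover have "2 * D ^ 22 \<le> D ^ 24" by (rule const_times_power_le[OF D, of 2 1]) auto
  ultimately show ?thesis using Ex_Lam_H by linarith
qed

text \<open>The terms of \<open>G\<close> carry \<open>\<nu>\<close> or \<open>\<omega>\<close>
  explicitly. The noise \<open>\<beta>\<close> has no such factor pointwise, so its first moment
  supplies one.\<close>

lemma Ex_Rem: "Ex (\<lambda>\<sigma>. \<bar>Rem \<sigma>\<bar>) \<le> D ^ 80 * (\<nu> + \<omega>)"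
proof -
  have vo: "0 \<le> \<nu> + \<omega>" using \<nu> \<omega>_nonneg by simp
  have "Ex (\<lambda>\<sigma>. \<bar>Rem \<sigma>\<bar>) \<le> Ex (\<lambda>\<sigma>. (D ^ 7 * (\<nu> + \<omega>) * 8) * ((T \<sigma>) ^ 4 + Lam \<sigma>) + \<beta> \<sigma>)"
  proof (rule Ex_mono)
    fix \<sigma> assume s: "\<sigma> \<in> Om"
    have "P \<sigma> \<le> 8 * ((T \<sigma>) ^ 4 + Lam \<sigma>)"
    proof -
      let ?s = "\<bar>T \<sigma>\<bar> + r \<sigma>"
      have s1: "1 \<le> ?s" using r_ge_1[of \<sigma>] by linarith
      have "P \<sigma> \<le> ?s\<^sup>2 * ?s\<^sup>2"
        unfolding P_def
      proof (rule mult_left_mono)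
        have "?s * 1 \<le> ?s * ?s" using s1 by (intro mult_left_mono) auto
        moreover have "r \<sigma> \<le> ?s * 1" by simp
        ultimately show "r \<sigma> \<le> ?s\<^sup>2" unfolding power2_eq_square by (rule order_trans[rotated])
      qed simp
      also have "\<dots> = ?s ^ 4" by (simp add: power_add[symmetric])
      also have "\<dots> \<le> 8 * (\<bar>T \<sigma>\<bar> ^ 4 + r \<sigma> ^ 4)" by (rule power4_sum_le)
      finally show ?thesis by (simp add: r4)
    qed
    then have "(\<nu> + \<omega>) * P \<sigma> \<le> (\<nu> + \<omega>) * (8 * ((T \<sigma>) ^ 4 + Lam \<sigma>))" using vo by (rule mult_left_mono)
    then have "D ^ 3 * ((\<nu> + \<omega>) * P \<sigma>) \<le> D ^ 3 * ((\<nu> + \<omega>) * (8 * ((T \<sigma>) ^ 4 + Lam \<sigma>)))"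
      by (rule mult_left_mono) (use D_pos in simp)
    then have "G \<sigma> \<le> D ^ 3 * ((\<nu> + \<omega>) * (8 * ((T \<sigma>) ^ 4 + Lam \<sigma>)))" by (rule order_trans[OF G_le])
    then have "D ^ 4 * G \<sigma> \<le> D ^ 4 * (D ^ 3 * ((\<nu> + \<omega>) * (8 * ((T \<sigma>) ^ 4 + Lam \<sigma>))))"
      by (rule mult_left_mono) (use D_pos in simp)
    also have "\<dots> = (D ^ 7 * (\<nu> + \<omega>) * 8) * ((T \<sigma>) ^ 4 + Lam \<sigma>)"
      using power_add[of D 4 3] by simp
    finally show "\<bar>Rem \<sigma>\<bar> \<le> (D ^ 7 * (\<nu> + \<omega>) * 8) * ((T \<sigma>) ^ 4 + Lam \<sigma>) + \<beta> \<sigma>"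
      using Rem_bound[OF s] by linarith
  qed
  also have "\<dots> = (D ^ 7 * (\<nu> + \<omega>) * 8) * (H + Ex Lam) + Ex \<beta>"
    by (simp only: Ex_add Ex_cmult H_def)
  also have "\<dots> \<le> (D ^ 7 * (\<nu> + \<omega>) * 8) * (2 * D ^ 65) + D ^ 2 * (\<nu> + \<omega>)"
  proof (intro add_mono mult_left_mono)
    have "D ^ 24 \<le> D ^ 65" using D by (intro power_increasing) auto
    then show "H + Ex Lam \<le> 2 * D ^ 65" using H_bound Ex_Lam by linarith
    have "D\<^sup>2 * \<nu> \<le> D\<^sup>2 * (\<nu> + \<omega>)" using \<omega>_nonneg by (intro mult_left_mono) auto
    then show "Ex \<beta> \<le> D ^ 2 * (\<nu> + \<omega>)" using Ex_\<beta> by linarith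
  qed (use vo D_pos in auto)
  also have "\<dots> = (16 * D ^ 72 + D ^ 2) * (\<nu> + \<omega>)"
    using power_add[of D 7 65] by (simp add: algebra_simps)
  also have "\<dots> \<le> D ^ 80 * (\<nu> + \<omega>)"
  proof (rule mult_right_mono[OF _ vo])
    have "D ^ 2 \<le> D ^ 72" using D by (intro power_increasing) auto
    moreover have "17 * D ^ 72 \<le> D ^ 80" by (rule const_times_power_le[OF D, of 17 2]) auto
    ultimately show "16 * D ^ 72 + D ^ 2 \<le> D ^ 80" by linarith
  qed
  finally show ?thesis .
qed

end

section \<open>The Stein equation of the quartic density\<close>

locale quartic_density = prob_space M for M :: "'a measure" +
  fixes W :: "'a \<Rightarrow> real" and c :: real
  assumes W: "distributed M lborel W (\<lambda>x. ennreal (c * exp (- (x ^ 4) / 12)))"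
begin

definition w :: "real \<Rightarrow> real" where "w x = c * exp (- (x ^ 4) / 12)"

definition F :: "real \<Rightarrow> real" where "F x = measure M {\<omega> \<in> space M. W \<omega> \<le> x}"

lemma W_meas: "W \<in> borel_measurable M"
  using distributed_measurable[OF W] by simp

text \<open>The normalizing constant is not prescribed: a nonpositive one would give density zero,
  hence total mass zero.\<close>

lemma c_pos: "0 < c"
proof (rule ccontr)
  assume "\<not> 0 < c"
  then have z: "ennreal (c * exp (- (x ^ 4) / 12)) = 0" for x
    by (intro ennreal_neg) (simp add: mult_nonpos_nonneg)
  have "emeasure M (W -` UNIV \<inter> space M) = (\<integral>\<^sup>+x. ennreal (c * exp (- (x ^ 4) / 12)) * indicator UNIV x \<partial>lborel)"
    by (rule distributed_emeasure[OF W]) simp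
  then show False using emeasure_space_1 by (simp only: z) simp
qed

lemma w_pos: "0 < w x" using c_pos by (simp add: w_def)

lemma W_le_sets: "{\<omega> \<in> space M. W \<omega> \<le> x} \<in> sets M"
  using W_meas by measurable

lemma F_cdf: "F x = cdf (distr M borel W) x"
  using W_meas by (simp add: cdf_def F_def measure_distr vimage_def Int_def conj_commute)

lemma F_mono: "x \<le> y \<Longrightarrow> F x \<le> F y"
  unfolding F_def using W_meas by (intro finite_measure_mono) auto

lemma F_nonneg: "0 \<le> F x" and F_le_1: "F x \<le> 1"
  unfolding F_def by auto

lemma F_at_top: "(F \<longlongrightarrow> 1) at_top"
proof -
  interpret D: real_distribution "distr M borel W" by (rule real_distribution_distr[OF W_meas])
  show ?thesis using D.cdf_lim_at_top_prob by (simp add: F_cdf[abs_def])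
qed

lemma F_at_bot: "(F \<longlongrightarrow> 0) at_bot"
proof -
  interpret D: real_distribution "distr M borel W" by (rule real_distribution_distr[OF W_meas])
  show ?thesis using D.cdf_lim_at_bot by (simp add: F_cdf[abs_def])
qed

lemma w_deriv: "(w has_real_derivative - (x ^ 3) / 3 * w x) (at x within S)"
  unfolding w_def[abs_def] by (auto intro!: derivative_eq_intros)

lemma w_continuous: "continuous_on S w"
  unfolding w_def[abs_def] by (intro continuous_intros) auto

text \<open>The hypothesis on \<open>W\<close> speaks of integrals only. Locally \<open>w\<close>
  has an antiderivative \<open>g\<close>, and the fundamental theorem identifies increments of
  \<open>F\<close> with those of \<open>g\<close>; a neighbourhood of \<open>x\<close> suffices for
  the derivative at \<open>x\<close>.\<close>

lemma F_deriv: "(F has_real_derivative w x) (at x)"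
proof -
  let ?a = "x - 2" and ?b = "x + 2"
  obtain g where "\<And>t. t \<in> {?a..?b} \<Longrightarrow> (g has_vector_derivative w t) (at t within {?a..?b})"
    by (rule antiderivative_continuous[OF w_continuous[of "{?a..?b}"]]) blast
  then have g: "(g has_real_derivative w t) (at t within {?a..?b})" if "t \<in> {?a..?b}" for t
    using that by (simp add: has_real_derivative_iff_has_vector_derivative)
  have g': "(g has_real_derivative w t) (at t)" if "x - 2 < t" "t < x + 2" for t
    using g[of t] that at_within_interior[of t "{?a..?b}"] by simp
  have diff: "F t - F s = g t - g s" if "x - 2 < s" "s \<le> t" "t < x + 2" for s t
  proof -
    have "ennreal (F t - F s) = emeasure M (W -` {s<..t} \<inter> space M)"
    proof -
      have "F t - F s = measure M ({\<omega> \<in> space M. W \<omega> \<le> t} - {\<omega> \<in> space M. W \<omega> \<le> s})"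
        unfolding F_def using that(2) by (intro finite_measure_Diff[symmetric] W_le_sets) auto
      also have "{\<omega> \<in> space M. W \<omega> \<le> t} - {\<omega> \<in> space M. W \<omega> \<le> s} = W -` {s<..t} \<inter> space M" by auto
      finally show ?thesis by (simp add: emeasure_eq_measure)
    qed
    also have "\<dots> = (\<integral>\<^sup>+y. ennreal (w y) * indicator {s<..t} y \<partial>lborel)"
      unfolding w_def by (rule distributed_emeasure[OF W]) simp
    also have "\<dots> = (\<integral>\<^sup>+y. ennreal (w y) * indicator {s..t} y \<partial>lborel)"
      by (intro nn_integral_cong_AE AE_I[of _ _ "{s}"]) (auto split: split_indicator)
    also have "\<dots> = ennreal (g t - g s)"
    proof (rule nn_integral_FTC_Icc)
      show "w \<in> borel_measurable borel" by (intro borel_measurable_continuous_onI w_continuous)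
    qed (use that g' w_pos in \<open>auto simp: less_imp_le\<close>)
    finally have e: "ennreal (F t - F s) = ennreal (g t - g s)" .
    have "0 \<le> g t - g s"
    proof -
      have "g s \<le> g t"
      proof (rule DERIV_nonneg_imp_nondecreasing[OF that(2)], rule exI, rule conjI)
        fix v assume "s \<le> v" "v \<le> t"
        then show "(g has_real_derivative w v) (at v)" using that by (intro g') auto
        show "0 \<le> w v" using w_pos[of v] by simp
      qed
      then show ?thesis by simp
    qed
    then show ?thesis using e F_mono[OF that(2)] by simp
  qed
  have eq: "F t = g t + (F x - g x)" if "t \<in> {x - 2<..<x + 2}" for t
    using that diff[of t x] diff[of x t] by (cases "t \<le> x") auto
  have "((\<lambda>t. g t + (F x - g x)) has_real_derivative w x) (at x)"
    using g'[of x] by (auto intro!: derivative_eq_intros)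
  then show ?thesis
    by (rule has_field_derivative_transform_within_open[OF _ open_greaterThanLessThan _ eq[symmetric]]) auto
qed

text \<open>A Mills ratio: \<open>3 w / t^3 + F\<close> decreases, because the leading part of the
  derivative of the quotient cancels the density, and \<open>F\<close> tends to 1.\<close>

lemma upper_tail: assumes x: "0 < x" shows "1 - F x \<le> 3 * w x / x ^ 3"
proof -
  have dec: "3 * w t / t ^ 3 + F t \<le> 3 * w x / x ^ 3 + F x" if t: "x \<le> t" for t
  proof (rule DERIV_nonpos_imp_nonincreasing[OF t], rule exI, rule conjI)
    fix s assume s: "x \<le> s" "s \<le> t"
    then have s0: "s \<noteq> 0" using x by simp
    show "((\<lambda>t. 3 * w t / t ^ 3 + F t) has_real_derivative
        ((3 * (- (s ^ 3) / 3 * w s)) * s ^ 3 - 3 * w s * (3 * s\<^sup>2)) / (s ^ 3 * s ^ 3) + w s) (at s)"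
      using s0 by (auto intro!: derivative_eq_intros w_deriv F_deriv)
    have "((3 * (- (s ^ 3) / 3 * w s)) * s ^ 3 - 3 * w s * (3 * s\<^sup>2)) / (s ^ 3 * s ^ 3) + w s = - (9 * w s * s\<^sup>2 / (s ^ 3 * s ^ 3))"
      using s0 by (simp add: field_simps)
    also have "\<dots> \<le> 0" using w_pos[of s] s x by simp
    finally show "((3 * (- (s ^ 3) / 3 * w s)) * s ^ 3 - 3 * w s * (3 * s\<^sup>2)) / (s ^ 3 * s ^ 3) + w s \<le> 0" .
  qed
  have "1 \<le> 3 * w x / x ^ 3 + F x"
  proof (rule tendsto_upperbound[OF F_at_top])
    show "\<forall>\<^sub>F t in at_top. F t \<le> 3 * w x / x ^ 3 + F x"
      using eventually_ge_at_top[of x]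
    proof eventually_elim
      case (elim t)
      have "0 \<le> 3 * w t / t ^ 3" using w_pos[of t] elim x by (simp add: less_imp_le)
      then show ?case using dec[OF elim] by linarith
    qed
  qed simp
  then show ?thesis by simp
qed

lemma lower_tail: assumes x: "x < 0" shows "F x \<le> 3 * w x / \<bar>x\<bar> ^ 3"
proof -
  have inc: "- (3 * w t / t ^ 3) - F t \<le> - (3 * w x / x ^ 3) - F x" if t: "t \<le> x" for t
  proof (rule DERIV_nonneg_imp_nondecreasing[OF t], rule exI, rule conjI)
    fix s assume s: "t \<le> s" "s \<le> x"
    then have s0: "s \<noteq> 0" using x by simp
    show "((\<lambda>t. - (3 * w t / t ^ 3) - F t) has_real_derivative
        - (((3 * (- (s ^ 3) / 3 * w s)) * s ^ 3 - 3 * w s * (3 * s\<^sup>2)) / (s ^ 3 * s ^ 3)) - w s) (at s)"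
      using s0 by (auto intro!: derivative_eq_intros w_deriv F_deriv)
    have "- (((3 * (- (s ^ 3) / 3 * w s)) * s ^ 3 - 3 * w s * (3 * s\<^sup>2)) / (s ^ 3 * s ^ 3)) - w s = 9 * w s * s\<^sup>2 / (s ^ 3)\<^sup>2"
      using s0 by (simp add: field_simps power2_eq_square)
    also have "\<dots> \<ge> 0" using w_pos[of s] by (simp add: less_imp_le)
    finally show "0 \<le> - (((3 * (- (s ^ 3) / 3 * w s)) * s ^ 3 - 3 * w s * (3 * s\<^sup>2)) / (s ^ 3 * s ^ 3)) - w s" .
  qed
  have "0 \<ge> F x + 3 * w x / x ^ 3"
  proof (rule tendsto_lowerbound[OF F_at_bot])
    show "\<forall>\<^sub>F t in at_bot. F x + 3 * w x / x ^ 3 \<le> F t"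
      using eventually_le_at_bot[of x]
    proof eventually_elim
      case (elim t)
      have "3 * w t / t ^ 3 \<le> 0" using w_pos[of t] elim x
        by (intro divide_nonneg_nonpos) (auto simp: less_imp_le power_less_zero_eq)
      then show ?case using inc[OF elim] F_nonneg[of t] by linarith
    qed
  qed simp
  moreover have "\<bar>x\<bar> ^ 3 = - (x ^ 3)" using x by (simp add: power3_eq_cube)
  ultimately show ?thesis by simp
qed

text \<open>Solves \<open>f' = x\<^sup>3/3 f + of_bool (x \<le> \<zeta>) - F \<zeta>\<close> away from \<open>\<zeta>\<close>.\<close>

definition sol :: "real \<Rightarrow> real \<Rightarrow> real" where
  "sol \<zeta> x = F (min x \<zeta>) * (1 - F (max x \<zeta>)) / w x"

text \<open>The tail bounds give 3 outside \<open>[-1, 1]\<close>; inside, the density is at least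
  \<open>c * exp (- 1/12)\<close>.\<close>

definition B0 :: real where "B0 = 3 + exp (1 / 12) / c"

lemma B0_ge: "3 \<le> B0" using c_pos by (simp add: B0_def)

lemma sol_nonneg: "0 \<le> sol \<zeta> x"
  using F_nonneg F_le_1 w_pos[of x] by (simp add: sol_def less_imp_le)

text \<open>On each half line one factor of the numerator is a tail of \<open>F\<close>; the Mills
  ratio cancels the density in the denominator.\<close>

lemma sol_cubic: "\<bar>x\<bar> ^ 3 * sol \<zeta> x \<le> 3"
proof (cases x "0 :: real" rule: linorder_cases)
  case equal
  then show ?thesis by simp
next
  case greater
  have "F (min x \<zeta>) * (1 - F (max x \<zeta>)) \<le> 1 * (3 * w x / x ^ 3)"
    using upper_tail[OF greater] F_mono[of x "max x \<zeta>"] F_le_1 F_nonneg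
    by (intro mult_mono) (auto simp: algebra_simps intro: order_trans)
  then have "sol \<zeta> x \<le> (3 * w x / x ^ 3) / w x"
    unfolding sol_def using w_pos[of x] by (intro divide_right_mono) (auto simp: less_imp_le)
  also have "\<dots> = 3 / x ^ 3" using w_pos[of x] by simp
  finally show ?thesis using greater by (simp add: field_simps)
next
  case less
  have "F (min x \<zeta>) * (1 - F (max x \<zeta>)) \<le> (3 * w x / \<bar>x\<bar> ^ 3) * 1"
    using lower_tail[OF less] F_mono[of "min x \<zeta>" x] F_le_1 F_nonneg w_pos[of x]
    by (intro mult_mono) (auto simp: algebra_simps less_imp_le intro: order_trans)
  then have "sol \<zeta> x \<le> (3 * w x / \<bar>x\<bar> ^ 3) / w x"
    unfolding sol_def using w_pos[of x] by (intro divide_right_mono) (auto simp: less_imp_le)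
  also have "\<dots> = 3 / \<bar>x\<bar> ^ 3" using w_pos[of x] by simp
  finally show ?thesis using less by (simp add: field_simps)
qed

lemma sol_le: "sol \<zeta> x \<le> B0"
proof (cases "1 \<le> \<bar>x\<bar>")
  case True
  have "1 * sol \<zeta> x \<le> \<bar>x\<bar> ^ 3 * sol \<zeta> x" using True sol_nonneg by (intro mult_right_mono one_le_power) auto
  then show ?thesis using sol_cubic[of x \<zeta>] B0_ge by linarith
next
  case False
  have "F (min x \<zeta>) * (1 - F (max x \<zeta>)) \<le> 1 * 1"
    using F_le_1 F_nonneg by (intro mult_mono) auto
  then have "sol \<zeta> x \<le> 1 / w x" unfolding sol_def using w_pos[of x] by (intro divide_right_mono) (auto simp: less_imp_le)
  also have "\<dots> = exp (x ^ 4 / 12) / c" by (simp add: w_def exp_minus field_simps)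
  also have "\<dots> \<le> exp (1 / 12) / c"
  proof -
    have "\<bar>x\<bar> ^ 4 \<le> 1" using False by (intro power_le_one) auto
    then show ?thesis using c_pos by (intro divide_right_mono) auto
  qed
  finally show ?thesis by (simp add: B0_def)
qed

lemma quotient_deriv:
  assumes "(f has_real_derivative f') (at x)"
  shows "((\<lambda>x. f x / w x) has_real_derivative f' / w x + x ^ 3 / 3 * (f x / w x)) (at x)"
proof -
  have "((\<lambda>x. f x / w x) has_real_derivative (f' * w x - f x * (- (x ^ 3) / 3 * w x)) / (w x * w x)) (at x)"
    using w_pos[of x] by (intro DERIV_divide assms w_deriv) auto
  moreover have "(f' * w x - f x * (- (x ^ 3) / 3 * w x)) / (w x * w x) = f' / w x + x ^ 3 / 3 * (f x / w x)"
    using w_pos[of x] by (simp add: field_simps)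
  ultimately show ?thesis by simp
qed

text \<open>The solution has a kink at \<open>\<zeta>\<close>, so the mean value theorem is applied
  to the smooth branch, which is defined on the whole line and agrees with \<open>sol\<close> on
  this side.\<close>

lemma sol_mvt_left:
  assumes "s \<le> t" "t \<le> \<zeta>"
  obtains \<xi> where "s \<le> \<xi>" "\<xi> \<le> t" "sol \<zeta> t - sol \<zeta> s = (t - s) * (\<xi> ^ 3 / 3 * sol \<zeta> \<xi> + 1 - F \<zeta>)"
proof -
  let ?f = "\<lambda>x. F x * (1 - F \<zeta>) / w x"
  have e: "sol \<zeta> x = ?f x" if "x \<le> \<zeta>" for x using that by (simp add: sol_def min_def max_def)
  have d: "(?f has_real_derivative x ^ 3 / 3 * ?f x + 1 - F \<zeta>) (at x)" for x
  proof -
    have "(?f has_real_derivative w x * (1 - F \<zeta>) / w x + x ^ 3 / 3 * ?f x) (at x)"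
      by (rule quotient_deriv) (auto intro!: derivative_eq_intros F_deriv)
    moreover have "w x * (1 - F \<zeta>) / w x + x ^ 3 / 3 * ?f x = x ^ 3 / 3 * ?f x + 1 - F \<zeta>"
      using w_pos[of x] by simp
    ultimately show ?thesis by (simp only:)
  qed
  obtain \<xi> where \<xi>: "min t s \<le> \<xi>" "\<xi> \<le> max t s" "?f t - ?f s = (t - s) * (\<xi> ^ 3 / 3 * ?f \<xi> + 1 - F \<zeta>)"
    by (rule real_mvt[OF d])
  have "s \<le> \<xi>" "\<xi> \<le> t" using \<xi>(1,2) assms by auto
  moreover from this have "sol \<zeta> t = ?f t" "sol \<zeta> s = ?f s" "sol \<zeta> \<xi> = ?f \<xi>" using assms by (intro e; linarith)+
  ultimately show ?thesis using \<xi>(3) by (intro that[of \<xi>]) (simp_all only:)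
qed

lemma sol_mvt_right:
  assumes "\<zeta> \<le> s" "s \<le> t"
  obtains \<xi> where "s \<le> \<xi>" "\<xi> \<le> t" "sol \<zeta> t - sol \<zeta> s = (t - s) * (\<xi> ^ 3 / 3 * sol \<zeta> \<xi> - F \<zeta>)"
proof -
  let ?f = "\<lambda>x. F \<zeta> * (1 - F x) / w x"
  have e: "sol \<zeta> x = ?f x" if "\<zeta> \<le> x" for x using that by (simp add: sol_def min_def max_def)
  have d: "(?f has_real_derivative x ^ 3 / 3 * ?f x - F \<zeta>) (at x)" for x
  proof -
    have "(?f has_real_derivative (- (F \<zeta> * w x)) / w x + x ^ 3 / 3 * ?f x) (at x)"
      by (rule quotient_deriv) (auto intro!: derivative_eq_intros F_deriv)
    moreover have "(- (F \<zeta> * w x)) / w x + x ^ 3 / 3 * ?f x = x ^ 3 / 3 * ?f x - F \<zeta>"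
      using w_pos[of x] by simp
    ultimately show ?thesis by (simp only:)
  qed
  obtain \<xi> where \<xi>: "min t s \<le> \<xi>" "\<xi> \<le> max t s" "?f t - ?f s = (t - s) * (\<xi> ^ 3 / 3 * ?f \<xi> - F \<zeta>)"
    by (rule real_mvt[OF d])
  have "s \<le> \<xi>" "\<xi> \<le> t" using \<xi>(1,2) assms by auto
  moreover from this have "sol \<zeta> t = ?f t" "sol \<zeta> s = ?f s" "sol \<zeta> \<xi> = ?f \<xi>" using assms by (intro e; linarith)+
  ultimately show ?thesis using \<xi>(3) by (intro that[of \<xi>]) (simp_all only:)
qed

lemma sol_slope: "\<bar>x ^ 3 / 3 * sol \<zeta> x\<bar> \<le> 1"
  using sol_cubic[of x \<zeta>] sol_nonneg[of \<zeta> x] by (simp add: abs_mult power_abs)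

lemma sol_lipschitz_aux: assumes "s \<le> t" shows "\<bar>sol \<zeta> t - sol \<zeta> s\<bar> \<le> 2 * (t - s)"
proof -
  have left: "\<bar>sol \<zeta> t - sol \<zeta> s\<bar> \<le> 2 * (t - s)" if st: "s \<le> t" "t \<le> \<zeta>" for s t
  proof -
    obtain \<xi> where "s \<le> \<xi>" "\<xi> \<le> t" and e: "sol \<zeta> t - sol \<zeta> s = (t - s) * (\<xi> ^ 3 / 3 * sol \<zeta> \<xi> + 1 - F \<zeta>)"
      by (rule sol_mvt_left[OF st])
    have "\<bar>\<xi> ^ 3 / 3 * sol \<zeta> \<xi> + 1 - F \<zeta>\<bar> \<le> 2"
      using sol_slope[of \<xi> \<zeta>] F_nonneg[of \<zeta>] F_le_1[of \<zeta>] by linarith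
    then have "\<bar>t - s\<bar> * \<bar>\<xi> ^ 3 / 3 * sol \<zeta> \<xi> + 1 - F \<zeta>\<bar> \<le> \<bar>t - s\<bar> * 2" by (rule mult_left_mono) simp
    then show ?thesis unfolding e abs_mult using st by simp
  qed
  have right: "\<bar>sol \<zeta> t - sol \<zeta> s\<bar> \<le> 2 * (t - s)" if st: "\<zeta> \<le> s" "s \<le> t" for s t
  proof -
    obtain \<xi> where "s \<le> \<xi>" "\<xi> \<le> t" and e: "sol \<zeta> t - sol \<zeta> s = (t - s) * (\<xi> ^ 3 / 3 * sol \<zeta> \<xi> - F \<zeta>)"
      by (rule sol_mvt_right[OF st])
    have "\<bar>\<xi> ^ 3 / 3 * sol \<zeta> \<xi> - F \<zeta>\<bar> \<le> 2"
      using sol_slope[of \<xi> \<zeta>] F_nonneg[of \<zeta>] F_le_1[of \<zeta>] by linarith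
    then have "\<bar>t - s\<bar> * \<bar>\<xi> ^ 3 / 3 * sol \<zeta> \<xi> - F \<zeta>\<bar> \<le> \<bar>t - s\<bar> * 2" by (rule mult_left_mono) simp
    then show ?thesis unfolding e abs_mult using st by simp
  qed
  consider "t \<le> \<zeta>" | "\<zeta> \<le> s" | "s \<le> \<zeta>" "\<zeta> \<le> t" by linarith
  then show ?thesis
  proof cases
    case 3
    then show ?thesis using left[OF 3(1) order_refl] right[OF order_refl 3(2)]
        abs_triangle_ineq[of "sol \<zeta> t - sol \<zeta> \<zeta>" "sol \<zeta> \<zeta> - sol \<zeta> s"] by simp
  qed (use left right assms in auto)
qed

lemma sol_lipschitz: "\<bar>sol \<zeta> t - sol \<zeta> s\<bar> \<le> 2 * \<bar>t - s\<bar>"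
  using sol_lipschitz_aux[of s t \<zeta>] sol_lipschitz_aux[of t s \<zeta>] by (cases "s \<le> t") auto

text \<open>As \<open>|\<xi> - t| <= 2\<close>, \<open>\<xi>^2\<close> is at most
  \<open>2 t^2 + 8\<close>; the error is thus of order \<open>h (1 + |t|^3)\<close>, which the third
  moment of \<open>T\<close> can pay for.\<close>

lemma drift_lipschitz:
  assumes "\<bar>\<xi> - t\<bar> \<le> h" "h \<le> 2"
  shows "\<bar>\<xi> ^ 3 / 3 * sol \<zeta> \<xi> - t ^ 3 / 3 * sol \<zeta> t\<bar> \<le> 7 * B0 * h * (1 + \<bar>t\<bar> ^ 3)"
proof -
  have h0: "0 \<le> h" using assms(1) by linarith
  have t2: "t\<^sup>2 \<le> 1 + \<bar>t\<bar> ^ 3"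
  proof (cases "\<bar>t\<bar> \<le> 1")
    case True
    then have "t\<^sup>2 \<le> 1" by (simp add: abs_square_le_1)
    moreover have "0 \<le> \<bar>t\<bar> ^ 3" by simp
    ultimately show ?thesis by linarith
  next
    case False
    then have "\<bar>t\<bar> ^ 2 \<le> \<bar>t\<bar> ^ 3" by (intro power_increasing) auto
    then show ?thesis by simp
  qed
  have x2: "\<xi>\<^sup>2 \<le> 2 * t\<^sup>2 + 8"
  proof -
    have "\<xi>\<^sup>2 = (t + (\<xi> - t))\<^sup>2" by simp
    also have "\<dots> \<le> 2 * t\<^sup>2 + 2 * (\<xi> - t)\<^sup>2"
      using sum_squares_bound[of t "\<xi> - t"] unfolding power2_sum by linarith
    also have "(\<xi> - t)\<^sup>2 \<le> 2\<^sup>2" using assms by (intro power2_le_iff_abs_le[THEN iffD2]) auto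
    finally show ?thesis by simp
  qed
  have "\<bar>\<xi> * t\<bar> \<le> (\<xi>\<^sup>2 + t\<^sup>2) / 2" using sum_squares_bound[of "\<bar>\<xi>\<bar>" "\<bar>t\<bar>"] by (simp add: abs_mult)
  then have xt: "\<xi> * t \<le> (\<xi>\<^sup>2 + t\<^sup>2) / 2" "- (\<xi> * t) \<le> (\<xi>\<^sup>2 + t\<^sup>2) / 2" by (simp_all only: abs_le_iff)
  define v where "v = \<bar>t\<bar> ^ 3"
  have v: "0 \<le> v" by (simp add: v_def)
  have "\<bar>\<xi>\<^sup>2 + \<xi> * t + t\<^sup>2\<bar> \<le> 33 / 2 * (1 + \<bar>t\<bar> ^ 3)"
    unfolding v_def[symmetric]
  proof (rule abs_leI)
    have t2': "t\<^sup>2 \<le> 1 + v" using t2 by (simp only: v_def)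
    have nn: "0 \<le> \<xi>\<^sup>2" "0 \<le> t\<^sup>2" by simp_all
    show "\<xi>\<^sup>2 + \<xi> * t + t\<^sup>2 \<le> 33 / 2 * (1 + v)" using xt(1) x2 t2' v by argo
    show "- (\<xi>\<^sup>2 + \<xi> * t + t\<^sup>2) \<le> 33 / 2 * (1 + v)" using xt(2) x2 t2' v nn by argo
  qed
  then have "\<bar>\<xi> - t\<bar> * \<bar>\<xi>\<^sup>2 + \<xi> * t + t\<^sup>2\<bar> \<le> h * (33 / 2 * (1 + \<bar>t\<bar> ^ 3))"
    using assms(1) by (intro mult_mono) auto
  moreover have "\<xi> ^ 3 - t ^ 3 = (\<xi> - t) * (\<xi>\<^sup>2 + \<xi> * t + t\<^sup>2)"
    by (simp add: power2_eq_square power3_eq_cube algebra_simps)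
  ultimately have cube: "\<bar>\<xi> ^ 3 - t ^ 3\<bar> \<le> h * (33 / 2 * (1 + \<bar>t\<bar> ^ 3))" by (simp add: abs_mult)
  have "\<xi> ^ 3 / 3 * sol \<zeta> \<xi> - t ^ 3 / 3 * sol \<zeta> t = (\<xi> ^ 3 - t ^ 3) / 3 * sol \<zeta> \<xi> + t ^ 3 / 3 * (sol \<zeta> \<xi> - sol \<zeta> t)"
    by (simp add: algebra_simps diff_divide_distrib)
  then have "\<bar>\<xi> ^ 3 / 3 * sol \<zeta> \<xi> - t ^ 3 / 3 * sol \<zeta> t\<bar> \<le> \<bar>\<xi> ^ 3 - t ^ 3\<bar> / 3 * \<bar>sol \<zeta> \<xi>\<bar> + \<bar>t\<bar> ^ 3 / 3 * \<bar>sol \<zeta> \<xi> - sol \<zeta> t\<bar>"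
    by (metis (no_types, opaque_lifting) abs_divide abs_mult abs_numeral abs_triangle_ineq power_abs)
  also have "\<dots> \<le> (h * (33 / 2 * (1 + \<bar>t\<bar> ^ 3))) / 3 * B0 + \<bar>t\<bar> ^ 3 / 3 * (2 * h)"
  proof (intro add_mono mult_mono divide_right_mono)
    show "\<bar>sol \<zeta> \<xi>\<bar> \<le> B0" using sol_le sol_nonneg by simp
    show "\<bar>sol \<zeta> \<xi> - sol \<zeta> t\<bar> \<le> 2 * h" by (rule order_trans[OF sol_lipschitz]) (use assms(1) in simp)
  qed (use cube h0 in auto)
  also have "\<dots> \<le> 7 * B0 * h * (1 + \<bar>t\<bar> ^ 3)"
  proof -
    have "\<bar>t\<bar> ^ 3 / 3 * (2 * h) \<le> B0 * (h * (1 + \<bar>t\<bar> ^ 3))"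
    proof -
      have "1 * (h * \<bar>t\<bar> ^ 3) \<le> B0 * (h * (1 + \<bar>t\<bar> ^ 3))"
        using B0_ge h0 by (intro mult_mono mult_left_mono) auto
      moreover have "\<bar>t\<bar> ^ 3 / 3 * (2 * h) \<le> 1 * (h * \<bar>t\<bar> ^ 3)"
        using mult_nonneg_nonneg[OF h0, of "\<bar>t\<bar> ^ 3"] by simp
      ultimately show ?thesis by linarith
    qed
    moreover have "(h * (33 / 2 * (1 + \<bar>t\<bar> ^ 3))) / 3 * B0 = 11 / 2 * (B0 * (h * (1 + \<bar>t\<bar> ^ 3)))" by simp
    moreover have "0 \<le> B0 * (h * (1 + \<bar>t\<bar> ^ 3))" using B0_ge h0 by simp
    moreover have "7 * B0 * h * (1 + \<bar>t\<bar> ^ 3) = 7 * (B0 * (h * (1 + \<bar>t\<bar> ^ 3)))" by simp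
    ultimately show ?thesis by linarith
  qed
  finally show ?thesis .
qed

text \<open>The right side of the Stein equation jumps at \<open>\<zeta>\<close>. The error caused
  by the jump is bounded by the step times the drop of the indicator across the cell: it vanishes
  for cells that miss the jump, and its sign is fixed. The evaluation point may be either end,
  according to the current spin.\<close>

lemma sol_increment:
  assumes st: "s \<le> s'" "s' \<le> s + 2" and t: "t = s \<or> t = s'"
  shows "\<bar>sol \<zeta> s' - sol \<zeta> s - (s' - s) * (t ^ 3 / 3 * sol \<zeta> t + of_bool (t \<le> \<zeta>) - F \<zeta>)\<bar>
    \<le> (s' - s) * (of_bool (s \<le> \<zeta>) - of_bool (s' \<le> \<zeta>)) + 7 * B0 * (s' - s)\<^sup>2 * (1 + \<bar>t\<bar> ^ 3)"
proof -
  define h where "h = s' - s"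
  \<comment> \<open>\<open>m\<close> is \<open>\<zeta>\<close> clamped to the interval; to its left
    and right the two smooth branches apply.\<close>
  define m where "m = max s (min s' \<zeta>)"
  let ?d = "\<lambda>x. x ^ 3 / 3 * sol \<zeta> x"
  let ?E = "7 * B0 * h * (1 + \<bar>t\<bar> ^ 3)"
  have h: "0 \<le> h" "h \<le> 2" using st by (auto simp: h_def)
  have m: "s \<le> m" "m \<le> s'" using st by (auto simp: m_def)
  obtain \<xi> where \<xi>: "s \<le> \<xi>" "\<xi> \<le> s'" "sol \<zeta> m - sol \<zeta> s = (m - s) * (?d \<xi> + 1 - F \<zeta>)"
  proof (cases "m = s")
    case True
    then show ?thesis using that[of s] st by simp
  next
    case False
    then have "m \<le> \<zeta>" by (auto simp: m_def max_def split: if_splits)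
    then obtain \<xi> where x: "s \<le> \<xi>" "\<xi> \<le> m" "sol \<zeta> m - sol \<zeta> s = (m - s) * (?d \<xi> + 1 - F \<zeta>)"
      by (rule sol_mvt_left[OF m(1)])
    then show ?thesis by (intro that[OF x(1) order_trans[OF x(2) m(2)]])
  qed
  obtain \<xi>' where \<xi>': "s \<le> \<xi>'" "\<xi>' \<le> s'" "sol \<zeta> s' - sol \<zeta> m = (s' - m) * (?d \<xi>' - F \<zeta>)"
  proof (cases "m = s'")
    case True
    then show ?thesis using that[of s] st by simp
  next
    case False
    then have "\<zeta> \<le> m" using st by (auto simp: m_def max_def min_def split: if_splits)
    then obtain \<xi> where x: "m \<le> \<xi>" "\<xi> \<le> s'" "sol \<zeta> s' - sol \<zeta> m = (s' - m) * (?d \<xi> - F \<zeta>)"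
      by (rule sol_mvt_right[OF _ m(2)])
    then show ?thesis by (intro that[OF order_trans[OF m(1) x(1)] x(2)])
  qed
  have d1: "\<bar>?d \<xi> - ?d t\<bar> \<le> ?E"
    by (rule drift_lipschitz[OF _ h(2)]) (use \<xi>(1,2) t in \<open>auto simp: h_def abs_le_iff\<close>)
  have d2: "\<bar>?d \<xi>' - ?d t\<bar> \<le> ?E"
    by (rule drift_lipschitz[OF _ h(2)]) (use \<xi>'(1,2) t in \<open>auto simp: h_def abs_le_iff\<close>)
  have "sol \<zeta> s' - sol \<zeta> s - h * (?d t + of_bool (t \<le> \<zeta>) - F \<zeta>)
      = (m - s) * (?d \<xi> - ?d t) + (s' - m) * (?d \<xi>' - ?d t) + ((m - s) - h * of_bool (t \<le> \<zeta>))"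
  proof -
    have e: "sol \<zeta> s' - sol \<zeta> s = (m - s) * (?d \<xi> + 1 - F \<zeta>) + (s' - m) * (?d \<xi>' - F \<zeta>)"
      using \<xi>(3) \<xi>'(3) by linarith
    have gen: "(m - s) * (a + 1 - f) + (s' - m) * (b - f) - (s' - s) * (d + i - f)
       = (m - s) * (a - d) + (s' - m) * (b - d) + ((m - s) - (s' - s) * i)" for a b d f i
      by (simp add: algebra_simps)
    show ?thesis unfolding e h_def by (rule gen)
  qed
  moreover have "\<bar>(m - s) * (?d \<xi> - ?d t)\<bar> \<le> (m - s) * ?E"
    unfolding abs_mult using m d1 by (intro mult_mono) auto
  moreover have "\<bar>(s' - m) * (?d \<xi>' - ?d t)\<bar> \<le> (s' - m) * ?E"
    unfolding abs_mult using m d2 by (intro mult_mono) auto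
  moreover have "\<bar>(m - s) - h * of_bool (t \<le> \<zeta>)\<bar> \<le> h * (of_bool (s \<le> \<zeta>) - of_bool (s' \<le> \<zeta>))"
    using t st by (auto simp: m_def h_def min_def max_def split: if_splits)
  moreover have "(m - s) * ?E + (s' - m) * ?E = 7 * B0 * h\<^sup>2 * (1 + \<bar>t\<bar> ^ 3)"
  proof -
    have "(m - s) * ?E + (s' - m) * ?E = h * ?E" by (simp add: h_def algebra_simps)
    then show ?thesis by (simp add: power2_eq_square)
  qed
  moreover have "\<bar>v\<bar> \<le> C + K" if "v = x1 + x2 + x3" "\<bar>x1\<bar> \<le> K1" "\<bar>x2\<bar> \<le> K2" "\<bar>x3\<bar> \<le> C" "K1 + K2 = K"
    for v x1 x2 x3 C K K1 K2 :: real
    using that by linarith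
  ultimately show ?thesis unfolding h_def[symmetric] by blast
qed

end

section \<open>The distribution function of the magnetization\<close>

context critical
begin

text \<open>The lattice spacing of \<open>T\<close>: one flip changes it by
  \<open>2 q / N = 2 / q^3\<close>.\<close>

definition h :: real where "h = 2 / q ^ 3"
text \<open>\<open>Tp\<close> and \<open>Tm\<close> are the values of \<open>T\<close> with spin
  \<open>i\<close> set to \<open>+1\<close> and \<open>-1\<close>. Neither depends on the actual
  spin at \<open>i\<close>, and \<open>T\<close> is always one of the two.\<close>

definition Tp :: "nat \<Rightarrow> (nat \<Rightarrow> real) \<Rightarrow> real" where "Tp i \<sigma> = T \<sigma> + (1 - \<sigma> i) / 2 * h"
definition Tm :: "nat \<Rightarrow> (nat \<Rightarrow> real) \<Rightarrow> real" where "Tm i \<sigma> = T \<sigma> - (1 + \<sigma> i) / 2 * h"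

lemma h_pos: "0 < h" using q_pos by (simp add: h_def)

lemma h_le: "h \<le> 2 / q\<^sup>2" "h \<le> 2"
proof -
  have "q\<^sup>2 \<le> q ^ 3" using q_ge_1 by (intro power_increasing) auto
  then show "h \<le> 2 / q\<^sup>2" unfolding h_def using q_pos by (intro divide_left_mono) auto
  have "1 \<le> q ^ 3" using q_ge_1 by (intro one_le_power)
  then show "h \<le> 2" using q_pos by (simp add: h_def field_simps)
qed

lemma hN: "h * real N = 2 * q"
  unfolding q4[symmetric] h_def using q_pos by (simp add: field_simps eval_nat_numeral)

lemma Tp_Tm: "Tp i \<sigma> - Tm i \<sigma> = h"
  by (simp add: Tp_def Tm_def field_simps)

lemma T_flip: assumes "i < N" shows "T (flip i \<sigma>) = T \<sigma> - \<sigma> i * h"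
proof -
  have "q * (2 / real N) = h" using hN N_pos by (simp add: field_simps)
  then have "q * (2 * \<sigma> i / real N) = \<sigma> i * h" by (metis mult.commute mult.left_commute times_divide_eq_right)
  then show ?thesis unfolding T_def X_flip[OF assms] by (simp add: right_diff_distrib)
qed

lemma Tp_flip: "i < N \<Longrightarrow> Tp i (flip i \<sigma>) = Tp i \<sigma>" and Tm_flip: "i < N \<Longrightarrow> Tm i (flip i \<sigma>) = Tm i \<sigma>"
  by (simp_all add: Tp_def Tm_def T_flip flip_def[of i \<sigma>, THEN fun_cong, of i] field_simps)

text \<open>Averaging over spin \<open>i\<close> given the others; \<open>1 - t^2\<close> is its
  conditional variance. Replacing \<open>\<sigma> i\<close> by \<open>t \<sigma> i\<close> is
  legitimate because the other factors do not change under the flip.\<close>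

lemma Ex_res_T:
  assumes i: "i < N"
  shows "Ex (\<lambda>\<sigma>. res \<sigma> i * g (T \<sigma>)) = 1 / 2 * Ex (\<lambda>\<sigma>. (1 - (t \<sigma> i)\<^sup>2) * (g (Tp i \<sigma>) - g (Tm i \<sigma>)))"
proof -
  let ?d = "\<lambda>\<sigma>. g (Tp i \<sigma>) - g (Tm i \<sigma>)"
  have "Ex (\<lambda>\<sigma>. res \<sigma> i * (g (T \<sigma>) - g (T (flip i \<sigma>)))) = Ex (\<lambda>\<sigma>. ?d \<sigma> - \<sigma> i * (t \<sigma> i * ?d \<sigma>))"
  proof (rule Ex_cong)
    fix \<sigma> assume s: "\<sigma> \<in> Om"
    from Om_spin[OF s i] show "res \<sigma> i * (g (T \<sigma>) - g (T (flip i \<sigma>))) = ?d \<sigma> - \<sigma> i * (t \<sigma> i * ?d \<sigma>)"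
      by (auto simp: Tp_def Tm_def T_flip[OF i] res_def algebra_simps)
  qed
  also have "\<dots> = Ex ?d - Ex (\<lambda>\<sigma>. \<sigma> i * (t \<sigma> i * ?d \<sigma>))" by (rule Ex_diff)
  also have "Ex (\<lambda>\<sigma>. \<sigma> i * (t \<sigma> i * ?d \<sigma>)) = Ex (\<lambda>\<sigma>. t \<sigma> i * (t \<sigma> i * ?d \<sigma>))"
    by (rule Ex_spin_t[OF i]) (simp add: t_flip_same[OF i] Tp_flip[OF i] Tm_flip[OF i])
  also have "Ex ?d - Ex (\<lambda>\<sigma>. t \<sigma> i * (t \<sigma> i * ?d \<sigma>)) = Ex (\<lambda>\<sigma>. (1 - (t \<sigma> i)\<^sup>2) * ?d \<sigma>)"
    unfolding Ex_diff[symmetric] by (simp add: power2_eq_square algebra_simps)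
  finally show ?thesis by (subst stein_identity[OF i]) simp
qed

lemma X_tb_res: "real N * (X \<sigma> - tb \<sigma>) = (\<Sum>i<N. res \<sigma> i)"
  using N_pos by (simp add: X_def tb_def avg_def res_def sum_subtractf field_simps)

text \<open>The noise moment for the constant functional \<open>1 / N\<close>; its square norm is
  \<open>1 / N\<close>, and 24 is rounded up to 25.\<close>

lemma Ex_abs_X_tb: "Ex (\<lambda>\<sigma>. \<bar>X \<sigma> - tb \<sigma>\<bar>) \<le> 5 / q\<^sup>2"
proof -
  have ip: "X \<sigma> - tb \<sigma> = ip N (\<lambda>_. 1 / real N) (res \<sigma>)" for \<sigma>
    using X_tb_res[of \<sigma>] N_pos by (simp add: ip_const_left field_simps)
  have "(Ex (\<lambda>\<sigma>. \<bar>X \<sigma> - tb \<sigma>\<bar>))\<^sup>2 \<le> Ex (\<lambda>\<sigma>. (X \<sigma> - tb \<sigma>)\<^sup>2)" by (rule Ex_abs_sq_le)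
  also have "\<dots> \<le> 24 * ip N (\<lambda>_. 1 / real N) (\<lambda>_. 1 / real N)"
    unfolding ip by (rule noise_second_moment)
  also have "ip N (\<lambda>_. 1 / real N) (\<lambda>_. 1 / real N) = 1 / real N" using N_pos by (simp add: ip_def)
  also have "24 * (1 / real N) \<le> (5 / q\<^sup>2)\<^sup>2"
    unfolding q4[symmetric] using q_pos by (simp add: power_divide power_mult[symmetric] divide_right_mono)
  finally show ?thesis by (rule power2_le_imp_le) simp
qed

lemma T_powers: "(T \<sigma>)\<^sup>2 \<le> 1 + (T \<sigma>) ^ 4" "\<bar>T \<sigma>\<bar> ^ 3 \<le> 1 + (T \<sigma>) ^ 4"
proof -
  have "(T \<sigma>)\<^sup>2 \<le> 1 + (T \<sigma>) ^ 4 \<and> \<bar>T \<sigma>\<bar> ^ 3 \<le> 1 + (T \<sigma>) ^ 4"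
  proof (cases "\<bar>T \<sigma>\<bar> \<le> 1")
    case True
    have "\<bar>T \<sigma>\<bar>\<^sup>2 \<le> 1" by (rule power_le_one[OF abs_ge_zero True])
    moreover have "\<bar>T \<sigma>\<bar> ^ 3 \<le> 1" by (rule power_le_one[OF abs_ge_zero True])
    moreover have "0 \<le> (T \<sigma>) ^ 4" by simp
    ultimately show ?thesis unfolding power2_abs by linarith
  next
    case False
    then have a: "1 \<le> \<bar>T \<sigma>\<bar>" by simp
    have "\<bar>T \<sigma>\<bar>\<^sup>2 \<le> \<bar>T \<sigma>\<bar> ^ 4" by (rule power_increasing[OF _ a]) simp
    moreover have "\<bar>T \<sigma>\<bar> ^ 3 \<le> \<bar>T \<sigma>\<bar> ^ 4" by (rule power_increasing[OF _ a]) simp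
    moreover have "\<bar>T \<sigma>\<bar> ^ 4 = (T \<sigma>) ^ 4" by simp
    ultimately show ?thesis unfolding power2_abs by linarith
  qed
  then show "(T \<sigma>)\<^sup>2 \<le> 1 + (T \<sigma>) ^ 4" "\<bar>T \<sigma>\<bar> ^ 3 \<le> 1 + (T \<sigma>) ^ 4" by auto
qed

lemma Ex_T2: "Ex (\<lambda>\<sigma>. (T \<sigma>)\<^sup>2) \<le> 2 * D ^ 65" and Ex_T3: "Ex (\<lambda>\<sigma>. \<bar>T \<sigma>\<bar> ^ 3) \<le> 2 * D ^ 65"
proof -
  have "1 \<le> D ^ 65" using D by (intro one_le_power) simp
  then have b: "1 + H \<le> 2 * D ^ 65" using H_bound by linarith
  have e: "Ex (\<lambda>\<sigma>. 1 + (T \<sigma>) ^ 4) = 1 + H" by (simp only: Ex_add Ex_const H_def)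
  show "Ex (\<lambda>\<sigma>. (T \<sigma>)\<^sup>2) \<le> 2 * D ^ 65"
    using Ex_mono[of "\<lambda>\<sigma>. (T \<sigma>)\<^sup>2" "\<lambda>\<sigma>. 1 + (T \<sigma>) ^ 4"] T_powers b e by simp
  show "Ex (\<lambda>\<sigma>. \<bar>T \<sigma>\<bar> ^ 3) \<le> 2 * D ^ 65"
    using Ex_mono[of "\<lambda>\<sigma>. \<bar>T \<sigma>\<bar> ^ 3" "\<lambda>\<sigma>. 1 + (T \<sigma>) ^ 4"] T_powers b e by simp
qed

definition tsq :: "(nat \<Rightarrow> real) \<Rightarrow> real" where "tsq \<sigma> = avg N (\<lambda>i. (t \<sigma> i)\<^sup>2)"

lemma tsq_nonneg: "0 \<le> tsq \<sigma>" by (simp add: tsq_def avg_def sum_nonneg)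

text \<open>The mean square of the field is \<open>mb^2 + U / N\<close>. Both parts are of order
  \<open>1 / q^2\<close>: the first by the second moment of \<open>T\<close>, the second because
  \<open>e <= q^2\<close>.\<close>

lemma Ex_tsq: "Ex tsq \<le> D ^ 70 / q\<^sup>2"
proof -
  have "Ex tsq \<le> Ex (\<lambda>\<sigma>. 1 / q\<^sup>2 * (2 * (T \<sigma>)\<^sup>2 + 2 * D\<^sup>2 + Lam \<sigma>))"
  proof (rule Ex_mono)
    fix \<sigma> assume s: "\<sigma> \<in> Om"
    have "tsq \<sigma> \<le> avg N (\<lambda>i. (A \<sigma> i)\<^sup>2)"
      unfolding tsq_def avg_def t_def by (intro divide_right_mono sum_mono tanh_sq_le) auto
    also have "\<dots> = (mb \<sigma>)\<^sup>2 + U \<sigma> / real N"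
    proof -
      have "(\<Sum>i<N. (A \<sigma> i)\<^sup>2) = (\<Sum>i<N. (mb \<sigma>)\<^sup>2 + 2 * mb \<sigma> * u \<sigma> i + (u \<sigma> i)\<^sup>2)"
        unfolding A_eq_u power2_sum by (intro sum.cong) auto
      also have "\<dots> = real N * (mb \<sigma>)\<^sup>2 + 2 * mb \<sigma> * (\<Sum>i<N. u \<sigma> i) + U \<sigma>"
        by (simp add: sum.distrib sum_distrib_left U_def ip_self_eq)
      finally show ?thesis unfolding avg_def sum_u using N_pos by (simp add: field_simps)
    qed
    also have "\<dots> \<le> 1 / q\<^sup>2 * (2 * (T \<sigma>)\<^sup>2 + 2 * D\<^sup>2) + 1 / q\<^sup>2 * Lam \<sigma>"
    proof (rule add_mono)
      have "(q * \<bar>mb \<sigma>\<bar>)\<^sup>2 \<le> (\<bar>T \<sigma>\<bar> + D)\<^sup>2" using q_mb[OF s] q_pos by (intro power_mono) auto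
      also have "\<dots> \<le> 2 * (T \<sigma>)\<^sup>2 + 2 * D\<^sup>2"
        using sum_squares_bound[of "\<bar>T \<sigma>\<bar>" D] by (simp add: power2_sum)
      finally show "(mb \<sigma>)\<^sup>2 \<le> 1 / q\<^sup>2 * (2 * (T \<sigma>)\<^sup>2 + 2 * D\<^sup>2)"
        using q_pos by (simp add: power_mult_distrib field_simps)
      have "y \<sigma> \<le> Lam \<sigma>"
      proof -
        have "y \<sigma> \<le> 1 + (y \<sigma>)\<^sup>2" using sum_squares_bound[of "y \<sigma>" 1] y_nonneg[of \<sigma>] by simp
        moreover have "0 \<le> (z \<sigma>) ^ 4" "0 \<le> (\<beta> \<sigma>)\<^sup>2" by simp_all
        ultimately show ?thesis unfolding Lam_def by linarith
      qed
      then have "e * y \<sigma> \<le> q\<^sup>2 * Lam \<sigma>" using e_q e_ge_1 y_nonneg by (intro mult_mono) auto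
      then have "U \<sigma> / real N \<le> q\<^sup>2 * Lam \<sigma> / real N" unfolding U_y by (intro divide_right_mono) auto
      also have "\<dots> = 1 / q\<^sup>2 * Lam \<sigma>" unfolding q4[symmetric] using q_pos by (simp add: field_simps eval_nat_numeral)
      finally show "U \<sigma> / real N \<le> 1 / q\<^sup>2 * Lam \<sigma>" .
    qed
    finally show "tsq \<sigma> \<le> 1 / q\<^sup>2 * (2 * (T \<sigma>)\<^sup>2 + 2 * D\<^sup>2 + Lam \<sigma>)" by (simp only: distrib_left)
  qed
  also have "\<dots> = 1 / q\<^sup>2 * (2 * Ex (\<lambda>\<sigma>. (T \<sigma>)\<^sup>2) + 2 * D\<^sup>2 + Ex Lam)"
    by (simp only: Ex_cmult Ex_add Ex_const)
  also have "\<dots> \<le> 1 / q\<^sup>2 * D ^ 70"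
  proof (rule mult_left_mono)
    have "D ^ 2 \<le> D ^ 65" "D ^ 24 \<le> D ^ 65" using D by (auto intro!: power_increasing)
    moreover have "7 * D ^ 65 \<le> D ^ 70" by (rule const_times_power_le[OF D, of _ 1]) auto
    ultimately show "2 * Ex (\<lambda>\<sigma>. (T \<sigma>)\<^sup>2) + 2 * D\<^sup>2 + Ex Lam \<le> D ^ 70" using Ex_T2 Ex_Lam by linarith
  qed simp
  finally show ?thesis by simp
qed

text \<open>The indicator in the Stein equation is replaced by its average over a lattice cell. The
  cost is a discrete derivative of the indicator itself, which the Stein identity turns back
  into the mean of \<open>X - tb\<close>.\<close>

lemma stein_error:
  fixes f :: "real \<Rightarrow> real" and B \<zeta> F0 :: real
  defines "\<psi> \<equiv> \<lambda>\<sigma>. (T \<sigma>) ^ 3 / 3 * f (T \<sigma>) + of_bool (T \<sigma> \<le> \<zeta>) - F0"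
  assumes B: "0 \<le> B"
    and inc: "\<And>s s' t. s \<le> s' \<Longrightarrow> s' \<le> s + 2 \<Longrightarrow> t = s \<or> t = s' \<Longrightarrow>
      \<bar>f s' - f s - (s' - s) * (t ^ 3 / 3 * f t + of_bool (t \<le> \<zeta>) - F0)\<bar>
        \<le> (s' - s) * (of_bool (s \<le> \<zeta>) - of_bool (s' \<le> \<zeta>)) + B * (s' - s)\<^sup>2 * (1 + \<bar>t\<bar> ^ 3)"
  shows "\<bar>real N * Ex (\<lambda>\<sigma>. (X \<sigma> - tb \<sigma>) * f (T \<sigma>)) - q * Ex (\<lambda>\<sigma>. (1 - tsq \<sigma>) * \<psi> \<sigma>)\<bar>
    \<le> q * (2 * Ex (\<lambda>\<sigma>. \<bar>X \<sigma> - tb \<sigma>\<bar>) + B * h * Ex (\<lambda>\<sigma>. 1 + \<bar>T \<sigma>\<bar> ^ 3))"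
proof -
  let ?I = "\<lambda>x. of_bool (x \<le> \<zeta>) :: real"
  let ?s = "\<lambda>\<sigma> i. 1 - (t \<sigma> i)\<^sup>2"
  have s01: "0 \<le> ?s \<sigma> i" "?s \<sigma> i \<le> 1" for \<sigma> i using tanh_sq_le_one[of "A \<sigma> i"] by (simp_all add: t_def)
  have sumX: "real N * Ex (\<lambda>\<sigma>. (X \<sigma> - tb \<sigma>) * g (T \<sigma>)) = (\<Sum>i<N. 1 / 2 * Ex (\<lambda>\<sigma>. ?s \<sigma> i * (g (Tp i \<sigma>) - g (Tm i \<sigma>))))" for g
  proof -
    have "real N * Ex (\<lambda>\<sigma>. (X \<sigma> - tb \<sigma>) * g (T \<sigma>)) = Ex (\<lambda>\<sigma>. \<Sum>i<N. res \<sigma> i * g (T \<sigma>))"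
      unfolding Ex_cmult[symmetric] by (rule Ex_cong) (simp add: X_tb_res[symmetric] sum_distrib_right[symmetric])
    also have "\<dots> = (\<Sum>i<N. Ex (\<lambda>\<sigma>. res \<sigma> i * g (T \<sigma>)))" by (rule Ex_sum)
    also have "\<dots> = (\<Sum>i<N. 1 / 2 * Ex (\<lambda>\<sigma>. ?s \<sigma> i * (g (Tp i \<sigma>) - g (Tm i \<sigma>))))"
      by (intro sum.cong refl Ex_res_T) auto
    finally show ?thesis .
  qed
  have psum: "q * Ex (\<lambda>\<sigma>. (1 - tsq \<sigma>) * \<psi> \<sigma>) = (\<Sum>i<N. 1 / 2 * Ex (\<lambda>\<sigma>. ?s \<sigma> i * (h * \<psi> \<sigma>)))"
  proof -
    have "(\<Sum>i<N. 1 / 2 * Ex (\<lambda>\<sigma>. ?s \<sigma> i * (h * \<psi> \<sigma>))) = Ex (\<lambda>\<sigma>. \<Sum>i<N. 1 / 2 * (?s \<sigma> i * (h * \<psi> \<sigma>)))"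
      by (simp only: Ex_sum Ex_cmult)
    also have "\<dots> = Ex (\<lambda>\<sigma>. q * ((1 - tsq \<sigma>) * \<psi> \<sigma>))"
    proof (rule Ex_cong)
      fix \<sigma>
      have "(\<Sum>i<N. ?s \<sigma> i) = real N * (1 - tsq \<sigma>)"
        using N_pos by (simp add: tsq_def avg_def sum_subtractf field_simps)
      then have "(\<Sum>i<N. 1 / 2 * (?s \<sigma> i * (h * \<psi> \<sigma>))) = 1 / 2 * (real N * (1 - tsq \<sigma>) * (h * \<psi> \<sigma>))"
        by (simp only: sum_distrib_left[symmetric] sum_distrib_right[symmetric])
      also have "\<dots> = (h * real N) / 2 * ((1 - tsq \<sigma>) * \<psi> \<sigma>)" by simp
      finally show "(\<Sum>i<N. 1 / 2 * (?s \<sigma> i * (h * \<psi> \<sigma>))) = q * ((1 - tsq \<sigma>) * \<psi> \<sigma>)" unfolding hN by simp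
    qed
    finally show ?thesis by (simp only: Ex_cmult)
  qed
  have step: "\<bar>1 / 2 * Ex (\<lambda>\<sigma>. ?s \<sigma> i * (f (Tp i \<sigma>) - f (Tm i \<sigma>))) - 1 / 2 * Ex (\<lambda>\<sigma>. ?s \<sigma> i * (h * \<psi> \<sigma>))\<bar>
    \<le> - h * (1 / 2 * Ex (\<lambda>\<sigma>. ?s \<sigma> i * (?I (Tp i \<sigma>) - ?I (Tm i \<sigma>)))) + 1 / 2 * (B * h\<^sup>2 * Ex (\<lambda>\<sigma>. 1 + \<bar>T \<sigma>\<bar> ^ 3))"
    if i: "i < N" for i
  proof -
    have "\<bar>Ex (\<lambda>\<sigma>. ?s \<sigma> i * (f (Tp i \<sigma>) - f (Tm i \<sigma>))) - Ex (\<lambda>\<sigma>. ?s \<sigma> i * (h * \<psi> \<sigma>))\<bar>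
      = \<bar>Ex (\<lambda>\<sigma>. ?s \<sigma> i * (f (Tp i \<sigma>) - f (Tm i \<sigma>)) - ?s \<sigma> i * (h * \<psi> \<sigma>))\<bar>" by (simp only: Ex_diff)
    also have "\<dots> \<le> Ex (\<lambda>\<sigma>. \<bar>?s \<sigma> i * (f (Tp i \<sigma>) - f (Tm i \<sigma>)) - ?s \<sigma> i * (h * \<psi> \<sigma>)\<bar>)" by (rule abs_Ex_le)
    also have "\<dots> \<le> Ex (\<lambda>\<sigma>. - h * (?s \<sigma> i * (?I (Tp i \<sigma>) - ?I (Tm i \<sigma>))) + B * h\<^sup>2 * (1 + \<bar>T \<sigma>\<bar> ^ 3))"
    proof (rule Ex_mono)
      fix \<sigma> assume s: "\<sigma> \<in> Om"
      let ?b = "h * (?I (Tm i \<sigma>) - ?I (Tp i \<sigma>))" and ?c = "B * h\<^sup>2 * (1 + \<bar>T \<sigma>\<bar> ^ 3)"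
      have Th: "T \<sigma> = Tm i \<sigma> \<or> T \<sigma> = Tp i \<sigma>"
        using Om_spin[OF s i] by (auto simp: Tp_def Tm_def)
      have "\<bar>f (Tp i \<sigma>) - f (Tm i \<sigma>) - h * \<psi> \<sigma>\<bar> \<le> ?b + ?c"
        using inc[of "Tm i \<sigma>" "Tp i \<sigma>" "T \<sigma>"] Th Tp_Tm[of i \<sigma>] h_pos h_le(2) unfolding \<psi>_def by simp
      then have "?s \<sigma> i * \<bar>f (Tp i \<sigma>) - f (Tm i \<sigma>) - h * \<psi> \<sigma>\<bar> \<le> ?s \<sigma> i * (?b + ?c)"
        using s01 by (intro mult_left_mono) auto
      also have "\<dots> = ?s \<sigma> i * ?b + ?s \<sigma> i * ?c" by (rule distrib_left)
      also have "\<dots> \<le> ?s \<sigma> i * ?b + 1 * ?c"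
        using s01 B by (intro add_left_mono mult_right_mono) auto
      finally have "\<bar>?s \<sigma> i * (f (Tp i \<sigma>) - f (Tm i \<sigma>) - h * \<psi> \<sigma>)\<bar> \<le> ?s \<sigma> i * ?b + ?c"
        using s01(1)[of \<sigma> i] by (simp only: abs_mult abs_of_nonneg mult_1_left)
      then show "\<bar>?s \<sigma> i * (f (Tp i \<sigma>) - f (Tm i \<sigma>)) - ?s \<sigma> i * (h * \<psi> \<sigma>)\<bar>
          \<le> - h * (?s \<sigma> i * (?I (Tp i \<sigma>) - ?I (Tm i \<sigma>))) + B * h\<^sup>2 * (1 + \<bar>T \<sigma>\<bar> ^ 3)"
        by (simp add: algebra_simps)
    qed
    also have "\<dots> = - h * Ex (\<lambda>\<sigma>. ?s \<sigma> i * (?I (Tp i \<sigma>) - ?I (Tm i \<sigma>))) + B * h\<^sup>2 * Ex (\<lambda>\<sigma>. 1 + \<bar>T \<sigma>\<bar> ^ 3)"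
      by (subst Ex_add, subst Ex_cmult, subst Ex_cmult) (rule refl)
    finally have e: "\<bar>Ex (\<lambda>\<sigma>. ?s \<sigma> i * (f (Tp i \<sigma>) - f (Tm i \<sigma>))) - Ex (\<lambda>\<sigma>. ?s \<sigma> i * (h * \<psi> \<sigma>))\<bar>
        \<le> - h * Ex (\<lambda>\<sigma>. ?s \<sigma> i * (?I (Tp i \<sigma>) - ?I (Tm i \<sigma>))) + B * h\<^sup>2 * Ex (\<lambda>\<sigma>. 1 + \<bar>T \<sigma>\<bar> ^ 3)" .
    have "\<bar>1 / 2 * x - 1 / 2 * v\<bar> \<le> - h * (1 / 2 * j) + 1 / 2 * k" if "\<bar>x - v\<bar> \<le> - h * j + k" for x v j k
    proof -
      have "\<bar>1 / 2 * x - 1 / 2 * v\<bar> = \<bar>x - v\<bar> / 2" by (simp add: abs_if field_simps)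
      then show ?thesis using that by (simp add: field_simps)
    qed
    from this[OF e] show ?thesis .
  qed
  have "\<bar>real N * Ex (\<lambda>\<sigma>. (X \<sigma> - tb \<sigma>) * f (T \<sigma>)) - q * Ex (\<lambda>\<sigma>. (1 - tsq \<sigma>) * \<psi> \<sigma>)\<bar>
    \<le> (\<Sum>i<N. - h * (1 / 2 * Ex (\<lambda>\<sigma>. ?s \<sigma> i * (?I (Tp i \<sigma>) - ?I (Tm i \<sigma>)))) + 1 / 2 * (B * h\<^sup>2 * Ex (\<lambda>\<sigma>. 1 + \<bar>T \<sigma>\<bar> ^ 3)))"
    unfolding sumX psum sum_subtractf[symmetric]
    using step by (intro order_trans[OF sum_abs] sum_mono) auto
  also have "\<dots> = - h * (\<Sum>i<N. 1 / 2 * Ex (\<lambda>\<sigma>. ?s \<sigma> i * (?I (Tp i \<sigma>) - ?I (Tm i \<sigma>)))) + real N * (1 / 2 * (B * h\<^sup>2 * Ex (\<lambda>\<sigma>. 1 + \<bar>T \<sigma>\<bar> ^ 3)))"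
    unfolding sum.distrib sum_distrib_left by simp
  \<comment> \<open>The summed indicator differences are read backwards through \<open>sumX\<close>,
    with the indicator as the test function. The jump error thus costs no anticoncentration
    estimate.\<close>
  also have "\<dots> = - h * (real N * Ex (\<lambda>\<sigma>. (X \<sigma> - tb \<sigma>) * ?I (T \<sigma>))) + real N * (1 / 2 * (B * h\<^sup>2 * Ex (\<lambda>\<sigma>. 1 + \<bar>T \<sigma>\<bar> ^ 3)))"
    unfolding sumX[of ?I] ..
  also have "\<dots> = (h * real N) / 2 * (2 * (- Ex (\<lambda>\<sigma>. (X \<sigma> - tb \<sigma>) * ?I (T \<sigma>))) + B * h * Ex (\<lambda>\<sigma>. 1 + \<bar>T \<sigma>\<bar> ^ 3))"
  proof -
    have "- h * (n * x) + n * (1 / 2 * (B * h\<^sup>2 * k)) = (h * n) / 2 * (2 * (- x) + B * h * k)" for n x k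
      by (simp add: power2_eq_square field_simps)
    then show ?thesis .
  qed
  also have "(h * real N) / 2 = q" unfolding hN by simp
  finally have fin: "\<bar>real N * Ex (\<lambda>\<sigma>. (X \<sigma> - tb \<sigma>) * f (T \<sigma>)) - q * Ex (\<lambda>\<sigma>. (1 - tsq \<sigma>) * \<psi> \<sigma>)\<bar>
    \<le> q * (2 * (- Ex (\<lambda>\<sigma>. (X \<sigma> - tb \<sigma>) * ?I (T \<sigma>))) + B * h * Ex (\<lambda>\<sigma>. 1 + \<bar>T \<sigma>\<bar> ^ 3))" .
  have "- Ex (\<lambda>\<sigma>. (X \<sigma> - tb \<sigma>) * ?I (T \<sigma>)) \<le> Ex (\<lambda>\<sigma>. \<bar>X \<sigma> - tb \<sigma>\<bar>)"
  proof -
    have "- Ex (\<lambda>\<sigma>. (X \<sigma> - tb \<sigma>) * ?I (T \<sigma>)) \<le> Ex (\<lambda>\<sigma>. \<bar>(X \<sigma> - tb \<sigma>) * ?I (T \<sigma>)\<bar>)"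
      using abs_Ex_le[of "\<lambda>\<sigma>. (X \<sigma> - tb \<sigma>) * ?I (T \<sigma>)"] by linarith
    also have "\<dots> \<le> Ex (\<lambda>\<sigma>. \<bar>X \<sigma> - tb \<sigma>\<bar>)" by (rule Ex_mono) (simp add: abs_mult)
    finally show ?thesis .
  qed
  then have "q * (2 * (- Ex (\<lambda>\<sigma>. (X \<sigma> - tb \<sigma>) * ?I (T \<sigma>))) + B * h * Ex (\<lambda>\<sigma>. 1 + \<bar>T \<sigma>\<bar> ^ 3))
     \<le> q * (2 * Ex (\<lambda>\<sigma>. \<bar>X \<sigma> - tb \<sigma>\<bar>) + B * h * Ex (\<lambda>\<sigma>. 1 + \<bar>T \<sigma>\<bar> ^ 3))"
    using q_pos by (intro mult_left_mono add_right_mono) auto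
  then show ?thesis using fin by (rule order_trans[rotated])
qed

text \<open>The function \<open>f\<close> enters only through size, decay and increments, so the
  limiting density is not referred to here. Decay like \<open>|x|^(-3)\<close> keeps the drift term
  bounded and lets the quintic Taylor error be paid by a second moment.\<close>

lemma distribution_bound:
  fixes f :: "real \<Rightarrow> real" and B \<zeta> F0 :: real
  assumes B: "1 \<le> B" and F0: "0 \<le> F0" "F0 \<le> 1"
    and fB: "\<And>x. \<bar>f x\<bar> \<le> B" and fc: "\<And>x. \<bar>x\<bar> ^ 3 * \<bar>f x\<bar> \<le> B"
    and inc: "\<And>s s' t. s \<le> s' \<Longrightarrow> s' \<le> s + 2 \<Longrightarrow> t = s \<or> t = s' \<Longrightarrow>
      \<bar>f s' - f s - (s' - s) * (t ^ 3 / 3 * f t + of_bool (t \<le> \<zeta>) - F0)\<bar>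
        \<le> (s' - s) * (of_bool (s \<le> \<zeta>) - of_bool (s' \<le> \<zeta>)) + B * (s' - s)\<^sup>2 * (1 + \<bar>t\<bar> ^ 3)"
  shows "\<bar>Ex (\<lambda>\<sigma>. of_bool (T \<sigma> \<le> \<zeta>)) - F0\<bar> \<le> B * D ^ 82 * (\<nu> + \<omega>)"
proof -
  define \<psi> where "\<psi> \<sigma> = (T \<sigma>) ^ 3 / 3 * f (T \<sigma>) + of_bool (T \<sigma> \<le> \<zeta>) - F0" for \<sigma>
  let ?q3 = "\<lambda>\<sigma>. q ^ 3 * (X \<sigma> - tb \<sigma>)"
  have B0: "0 \<le> B" using B by simp
  define E where "E = Ex (\<lambda>\<sigma>. ?q3 \<sigma> * f (T \<sigma>)) - Ex (\<lambda>\<sigma>. (1 - tsq \<sigma>) * \<psi> \<sigma>)"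
  have qE: "real N * Ex (\<lambda>\<sigma>. (X \<sigma> - tb \<sigma>) * f (T \<sigma>)) - q * Ex (\<lambda>\<sigma>. (1 - tsq \<sigma>) * \<psi> \<sigma>) = q * E"
  proof -
    have "Ex (\<lambda>\<sigma>. ?q3 \<sigma> * f (T \<sigma>)) = q ^ 3 * Ex (\<lambda>\<sigma>. (X \<sigma> - tb \<sigma>) * f (T \<sigma>))"
      by (simp only: Ex_cmult mult.assoc)
    moreover have "real N = q * q ^ 3" unfolding q4[symmetric] by (simp add: eval_nat_numeral)
    ultimately show ?thesis by (simp add: E_def right_diff_distrib)
  qed
  have "\<bar>q * E\<bar> \<le> q * (2 * Ex (\<lambda>\<sigma>. \<bar>X \<sigma> - tb \<sigma>\<bar>) + B * h * Ex (\<lambda>\<sigma>. 1 + \<bar>T \<sigma>\<bar> ^ 3))"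
    unfolding qE[symmetric] \<psi>_def by (rule stein_error[OF B0 inc])
  then have E1: "\<bar>E\<bar> \<le> 2 * Ex (\<lambda>\<sigma>. \<bar>X \<sigma> - tb \<sigma>\<bar>) + B * h * Ex (\<lambda>\<sigma>. 1 + \<bar>T \<sigma>\<bar> ^ 3)"
    using q_pos by (simp add: abs_mult)
  have D65: "1 \<le> D ^ 65" using D by (intro one_le_power) simp
  have iq: "0 \<le> 1 / q\<^sup>2" by simp
  have E2: "\<bar>E\<bar> \<le> B * (16 * D ^ 65) * (1 / q\<^sup>2)"
  proof -
    have "Ex (\<lambda>\<sigma>. 1 + \<bar>T \<sigma>\<bar> ^ 3) \<le> 3 * D ^ 65"
      using Ex_T3 D65 by (simp add: Ex_add Ex_const)
    then have "(B * h) * Ex (\<lambda>\<sigma>. 1 + \<bar>T \<sigma>\<bar> ^ 3) \<le> (B * (2 / q\<^sup>2)) * (3 * D ^ 65)"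
      using B0 h_pos h_le(1) by (intro mult_mono) (auto intro!: Ex_nonneg)
    moreover have "10 * (1 / q\<^sup>2) \<le> (B * (10 * D ^ 65)) * (1 / q\<^sup>2)"
      using mult_mono[of 1 B 10 "10 * D ^ 65"] B D65 iq by (intro mult_right_mono) auto
    moreover have "(B * (2 / q\<^sup>2)) * (3 * D ^ 65) = B * (6 * D ^ 65) * (1 / q\<^sup>2)" by simp
    moreover have "B * (16 * D ^ 65) * (1 / q\<^sup>2) = B * (6 * D ^ 65) * (1 / q\<^sup>2) + (B * (10 * D ^ 65)) * (1 / q\<^sup>2)"
      by (simp add: add_divide_distrib[symmetric])
    moreover have "2 * Ex (\<lambda>\<sigma>. \<bar>X \<sigma> - tb \<sigma>\<bar>) \<le> 10 * (1 / q\<^sup>2)" using Ex_abs_X_tb by simp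
    ultimately show ?thesis using E1 by linarith
  qed
  let ?P = "Ex (\<lambda>\<sigma>. of_bool (T \<sigma> \<le> \<zeta>))"
  let ?g = "\<lambda>\<sigma>. (q ^ 3 * tanh_defect (X \<sigma>) - (T \<sigma>) ^ 3 / 3) * f (T \<sigma>)"
  \<comment> \<open>Four errors: the remainder, the replacement of the defect by a cube, the
    conditional variance \<open>1 - tsq\<close> instead of 1, and the lattice error
    \<open>E\<close>.\<close>
  have decomp: "?P - F0 = Ex (\<lambda>\<sigma>. Rem \<sigma> * f (T \<sigma>)) + Ex ?g + Ex (\<lambda>\<sigma>. tsq \<sigma> * \<psi> \<sigma>) - E"
  proof -
    have "Ex (\<lambda>\<sigma>. Rem \<sigma> * f (T \<sigma>)) + Ex ?g + Ex (\<lambda>\<sigma>. tsq \<sigma> * \<psi> \<sigma>)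
       = Ex (\<lambda>\<sigma>. ?q3 \<sigma> * f (T \<sigma>) - (1 - tsq \<sigma>) * \<psi> \<sigma> + (of_bool (T \<sigma> \<le> \<zeta>) - F0))"
      unfolding Ex_add[symmetric] by (rule Ex_cong) (simp add: \<psi>_def Rem_def algebra_simps, simp add: diff_divide_distrib)
    also have "\<dots> = E + (?P - F0)" by (simp only: Ex_add Ex_diff Ex_const E_def)
    finally show ?thesis by simp
  qed
  have b1: "\<bar>Ex (\<lambda>\<sigma>. Rem \<sigma> * f (T \<sigma>))\<bar> \<le> B * (D ^ 80 * (\<nu> + \<omega>))"
  proof -
    have "\<bar>Ex (\<lambda>\<sigma>. Rem \<sigma> * f (T \<sigma>))\<bar> \<le> Ex (\<lambda>\<sigma>. B * \<bar>Rem \<sigma>\<bar>)"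
    proof (rule order_trans[OF abs_Ex_le Ex_mono])
      fix \<sigma>
      have "\<bar>f (T \<sigma>)\<bar> * \<bar>Rem \<sigma>\<bar> \<le> B * \<bar>Rem \<sigma>\<bar>" by (intro mult_right_mono fB) auto
      then show "\<bar>Rem \<sigma> * f (T \<sigma>)\<bar> \<le> B * \<bar>Rem \<sigma>\<bar>" by (simp add: abs_mult mult.commute)
    qed
    also have "\<dots> = B * Ex (\<lambda>\<sigma>. \<bar>Rem \<sigma>\<bar>)" by (rule Ex_cmult)
    also have "\<dots> \<le> B * (D ^ 80 * (\<nu> + \<omega>))" by (intro mult_left_mono Ex_Rem B0)
    finally show ?thesis .
  qed
  have b2: "\<bar>Ex ?g\<bar> \<le> B * (2 * D ^ 65) * (1 / q\<^sup>2)"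
  proof -
    have "\<bar>Ex ?g\<bar> \<le> Ex (\<lambda>\<sigma>. (B * (1 / q\<^sup>2)) * (T \<sigma>)\<^sup>2)"
    proof (rule order_trans[OF abs_Ex_le Ex_mono])
      fix \<sigma>
      have "q ^ 3 * tanh_defect (X \<sigma>) - (T \<sigma>) ^ 3 / 3 = q ^ 3 * (tanh_defect (X \<sigma>) - (X \<sigma>) ^ 3 / 3)"
        by (simp add: T_def power_mult_distrib algebra_simps)
      then have "\<bar>?g \<sigma>\<bar> = q ^ 3 * \<bar>tanh_defect (X \<sigma>) - (X \<sigma>) ^ 3 / 3\<bar> * \<bar>f (T \<sigma>)\<bar>"
        using q_pos by (simp add: abs_mult)
      also have "\<dots> \<le> q ^ 3 * \<bar>X \<sigma>\<bar> ^ 5 * \<bar>f (T \<sigma>)\<bar>"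
        using q_pos by (intro mult_right_mono mult_left_mono tanh_defect_cubic) auto
      also have "q ^ 3 * \<bar>X \<sigma>\<bar> ^ 5 = 1 / q\<^sup>2 * ((T \<sigma>)\<^sup>2 * \<bar>T \<sigma>\<bar> ^ 3)"
      proof -
        have "\<bar>T \<sigma>\<bar>\<^sup>2 * \<bar>T \<sigma>\<bar> ^ 3 = \<bar>T \<sigma>\<bar> ^ 5" by (simp only: power_add[symmetric]) simp
        also have "\<dots> = q ^ 5 * \<bar>X \<sigma>\<bar> ^ 5" using q_pos by (simp add: T_def X_def[symmetric] abs_mult power_mult_distrib)
        also have "q ^ 5 = q\<^sup>2 * q ^ 3" by (simp only: power_add[symmetric]) simp
        finally have e: "(T \<sigma>)\<^sup>2 * \<bar>T \<sigma>\<bar> ^ 3 = q\<^sup>2 * (q ^ 3 * \<bar>X \<sigma>\<bar> ^ 5)"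
          unfolding power2_abs mult.assoc .
        have "1 / q\<^sup>2 * (q\<^sup>2 * v) = v" for v using q_pos by simp
        then show ?thesis unfolding e by (rule sym)
      qed
      also have "1 / q\<^sup>2 * ((T \<sigma>)\<^sup>2 * \<bar>T \<sigma>\<bar> ^ 3) * \<bar>f (T \<sigma>)\<bar> = (1 / q\<^sup>2 * (T \<sigma>)\<^sup>2) * (\<bar>T \<sigma>\<bar> ^ 3 * \<bar>f (T \<sigma>)\<bar>)" by simp
      also have "\<dots> \<le> (1 / q\<^sup>2 * (T \<sigma>)\<^sup>2) * B" by (intro mult_left_mono fc) simp
      also have "\<dots> = (B * (1 / q\<^sup>2)) * (T \<sigma>)\<^sup>2" by simp
      finally show "\<bar>?g \<sigma>\<bar> \<le> (B * (1 / q\<^sup>2)) * (T \<sigma>)\<^sup>2" .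
    qed
    also have "\<dots> = (B * (1 / q\<^sup>2)) * Ex (\<lambda>\<sigma>. (T \<sigma>)\<^sup>2)" by (rule Ex_cmult)
    also have "\<dots> \<le> (B * (1 / q\<^sup>2)) * (2 * D ^ 65)" using B0 by (intro mult_left_mono Ex_T2) auto
    finally show ?thesis by (simp only: mult_ac)
  qed
  have b3: "\<bar>Ex (\<lambda>\<sigma>. tsq \<sigma> * \<psi> \<sigma>)\<bar> \<le> B * (2 * D ^ 70) * (1 / q\<^sup>2)"
  proof -
    have "\<bar>Ex (\<lambda>\<sigma>. tsq \<sigma> * \<psi> \<sigma>)\<bar> \<le> Ex (\<lambda>\<sigma>. (2 * B) * tsq \<sigma>)"
    proof (rule order_trans[OF abs_Ex_le Ex_mono])
      fix \<sigma>
      have "\<bar>(T \<sigma>) ^ 3 / 3 * f (T \<sigma>)\<bar> \<le> B"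
      proof -
        have "\<bar>(T \<sigma>) ^ 3 / 3 * f (T \<sigma>)\<bar> = (\<bar>T \<sigma>\<bar> ^ 3 * \<bar>f (T \<sigma>)\<bar>) / 3" by (simp add: abs_mult power_abs)
        also have "\<dots> \<le> B / 3" by (intro divide_right_mono fc) simp
        finally show ?thesis using B0 by simp
      qed
      moreover have "\<bar>of_bool (T \<sigma> \<le> \<zeta>) - F0\<bar> \<le> 1" using F0 by (auto simp: abs_le_iff)
      ultimately have "\<bar>\<psi> \<sigma>\<bar> \<le> 2 * B" unfolding \<psi>_def using B by linarith
      then show "\<bar>tsq \<sigma> * \<psi> \<sigma>\<bar> \<le> (2 * B) * tsq \<sigma>"
        using tsq_nonneg[of \<sigma>] mult_left_mono[of "\<bar>\<psi> \<sigma>\<bar>" "2 * B" "tsq \<sigma>"] by (simp add: abs_mult mult.commute)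
    qed
    also have "\<dots> = (2 * B) * Ex tsq" by (rule Ex_cmult)
    also have "\<dots> \<le> (2 * B) * (D ^ 70 / q\<^sup>2)" using B0 by (intro mult_left_mono Ex_tsq) auto
    finally show ?thesis by (simp add: mult_ac)
  qed
  have "\<bar>?P - F0\<bar> \<le> B * (D ^ 80 * (\<nu> + \<omega>)) + (B * (2 * D ^ 65) * (1 / q\<^sup>2) + B * (2 * D ^ 70) * (1 / q\<^sup>2) + B * (16 * D ^ 65) * (1 / q\<^sup>2))"
    unfolding decomp using b1 b2 b3 E2 by linarith
  also have "B * (2 * D ^ 65) * (1 / q\<^sup>2) + B * (2 * D ^ 70) * (1 / q\<^sup>2) + B * (16 * D ^ 65) * (1 / q\<^sup>2)
      = B * (18 * D ^ 65 + 2 * D ^ 70) * (1 / q\<^sup>2)" by (simp add: algebra_simps add_divide_distrib)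
  also have "\<dots> \<le> B * D ^ 80 * (\<nu> + \<omega>)"
  proof -
    have "D ^ 65 \<le> D ^ 70" using D by (intro power_increasing) auto
    moreover have "20 * D ^ 70 \<le> D ^ 80" by (rule const_times_power_le[OF D, of _ 2]) auto
    ultimately have a: "18 * D ^ 65 + 2 * D ^ 70 \<le> D ^ 80" by linarith
    have b: "1 / q\<^sup>2 \<le> \<nu> + \<omega>" using inv_q2_le_\<omega> \<nu> by linarith
    show ?thesis by (rule mult_mono[OF mult_left_mono[OF a B0] b _ iq]) (use B0 D_pos in simp)
  qed
  finally have "\<bar>?P - F0\<bar> \<le> (B * (\<nu> + \<omega>)) * (2 * D ^ 80)" by (simp only: mult_ac) simp
  also have "\<dots> \<le> (B * (\<nu> + \<omega>)) * D ^ 82"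
    using B0 \<nu> \<omega>_nonneg by (intro mult_left_mono const_times_power_le[OF D, of 2 1]) auto
  finally show ?thesis by (simp only: mult_ac)
qed

end

lemma (in critical) cdf_bound:
  assumes "quartic_density M W c'"
  shows "\<bar>Ex (\<lambda>\<sigma>. of_bool (q * avg N \<sigma> \<le> \<zeta>)) - measure M {\<omega> \<in> space M. W \<omega> \<le> \<zeta>}\<bar>
    \<le> 7 * quartic_density.B0 c' * D ^ 82 * (\<nu> + \<omega>)"
proof -
  interpret W: quartic_density M W c' by fact
  have B: "3 \<le> W.B0" by (rule W.B0_ge)
  have B1: "1 \<le> 7 * W.B0" using B by linarith
  have B2: "\<bar>W.sol \<zeta> x\<bar> \<le> 7 * W.B0" for x using W.sol_nonneg[of \<zeta> x] W.sol_le[of \<zeta> x] B by linarith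
  have B3: "\<bar>x\<bar> ^ 3 * \<bar>W.sol \<zeta> x\<bar> \<le> 7 * W.B0" for x
    unfolding abs_of_nonneg[OF W.sol_nonneg] using W.sol_cubic[of x \<zeta>] B by linarith
  have "\<bar>Ex (\<lambda>\<sigma>. of_bool (T \<sigma> \<le> \<zeta>)) - W.F \<zeta>\<bar> \<le> 7 * W.B0 * D ^ 82 * (\<nu> + \<omega>)"
    by (rule distribution_bound[where f = "W.sol \<zeta>", OF B1 W.F_nonneg W.F_le_1 B2 B3 W.sol_increment])
  then show ?thesis unfolding T_def X_def W.F_def .
qed

section \<open>Transfer to matrices and to the Ising distribution\<close>

locale coupling_model =
  fixes N :: nat and B :: "real mat"
  assumes cm: "coupling_matrix N B" and N2: "2 \<le> N"
begin

sublocale coupling N "\<lambda>i j. B $$ (i, j)"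
proof
  show "0 < N" using N2 by simp
  have "transpose_mat B = B" and B: "B \<in> carrier_mat N N" using cm by (auto simp: coupling_matrix_def)
  then show "B $$ (i, j) = B $$ (j, i)" if "i < N" "j < N" for i j
    using that index_transpose_mat(1)[of i B j] by auto
qed (use cm in \<open>auto simp: coupling_matrix_def\<close>)

lemma carrier: "B \<in> carrier_mat N N" and dims [simp]: "dim_row B = N" "dim_col B = N"
  using cm by (auto simp: coupling_matrix_def)

lemma row_sum_R: "row_sum B i = R i"
  by (simp add: row_sum_def R_def)

lemma row_sum_c: "row_sum B i - 1 = c i"
  by (simp add: row_sum_R c_def)

lemma frobenius_Fr: "(frobenius_norm B)\<^sup>2 = Fr"
  by (simp add: frobenius_norm_def Fr_def alpha_def sum_nonneg)

lemma quad_form: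
  assumes "x \<in> carrier_vec N"
  shows "x \<bullet> (B *\<^sub>v x) = ip N (\<lambda>i. x $ i) (A (\<lambda>i. x $ i))"
  using assms by (auto simp: scalar_prod_def ip_def A_def atLeast0LessThan intro!: sum.cong)

lemma bij_vec: "bij_betw (vec N) Om (spin_configs N)"
proof (rule bij_betw_byWitness[where f' = "\<lambda>v. restrict (\<lambda>i. v $ i) {..<N}"])
  show "\<forall>\<sigma>\<in>Om. restrict (\<lambda>i. vec N \<sigma> $ i) {..<N} = \<sigma>"
    by (auto simp: Om_def PiE_iff extensional_def fun_eq_iff)
  show "\<forall>v\<in>spin_configs N. vec N (restrict (\<lambda>i. v $ i) {..<N}) = v"
  proof
    fix v assume "v \<in> spin_configs N"
    then have "dim_vec v = N" unfolding spin_configs_def carrier_vec_def by blast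
    then show "vec N (restrict (\<lambda>i. v $ i) {..<N}) = v" by (intro eq_vecI) simp_all
  qed
  show "vec N ` Om \<subseteq> spin_configs N"
  proof
    fix v assume "v \<in> vec N ` Om"
    then obtain \<sigma> where s: "\<sigma> \<in> Om" and v: "v = vec N \<sigma>" by blast
    have "v $ i \<in> {-1, 1}" if "i < N" for i using Om_spin[OF s that] that by (simp add: v)
    then show "v \<in> spin_configs N" unfolding spin_configs_def by (simp add: v)
  qed
  show "(\<lambda>v. restrict (\<lambda>i. v $ i) {..<N}) ` spin_configs N \<subseteq> Om"
  proof
    fix \<sigma> assume "\<sigma> \<in> (\<lambda>v. restrict (\<lambda>i. v $ i) {..<N}) ` spin_configs N"
    then obtain v where "v \<in> spin_configs N" and e: "\<sigma> = restrict (\<lambda>i. v $ i) {..<N}" by blast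
    then have "v $ i \<in> {-1, 1}" if "i < N" for i using that unfolding spin_configs_def by blast
    then show "\<sigma> \<in> Om" unfolding Om_def e by (intro restrict_PiE_iff[THEN iffD2]) auto
  qed
qed

lemma weight_vec: "ising_weight B 1 0 (vec N \<sigma>) = wt \<sigma>"
proof -
  have "ip N (\<lambda>i. vec N \<sigma> $ i) (A (\<lambda>i. vec N \<sigma> $ i)) = ip N \<sigma> (A \<sigma>)"
    by (intro ip_cong A_cong) auto
  then show ?thesis by (simp add: ising_weight_def wt_def quad_form)
qed

lemma Z_vec: "ising_Z B 1 0 = Z"
  unfolding ising_Z_def Z_def dims
  by (subst sum.reindex_bij_betw[OF bij_vec, symmetric]) (simp add: weight_vec)

lemma mean_spin_vec: "mean_spin N (vec N \<sigma>) = avg N \<sigma>"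
  by (simp add: mean_spin_def avg_def)

lemma ising_prob:
  "measure (measure_pmf (ising_pmf B 1 0)) {\<sigma>. P (mean_spin N \<sigma>)} = Ex (\<lambda>\<sigma>. of_bool (P (avg N \<sigma>)))"
proof -
  let ?p = "ising_pmf B 1 0"
  have sub: "set_pmf ?p \<subseteq> spin_configs N" by (auto simp: set_pmf_iff pmf_ising_pmf split: if_splits)
  have "measure (measure_pmf ?p) {\<sigma>. P (mean_spin N \<sigma>)} = measure (measure_pmf ?p) {\<sigma> \<in> spin_configs N. P (mean_spin N \<sigma>)}"
    by (rule measure_pmf.finite_measure_eq_AE) (use sub in \<open>auto simp: AE_measure_pmf_iff\<close>)
  also have "\<dots> = (\<Sum>\<sigma>\<in>{\<sigma> \<in> spin_configs N. P (mean_spin N \<sigma>)}. pmf ?p \<sigma>)"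
    by (rule measure_measure_pmf_finite) (simp add: spin_configs_finite)
  also have "\<dots> = (\<Sum>\<sigma>\<in>spin_configs N. ising_weight B 1 0 \<sigma> / Z * of_bool (P (mean_spin N \<sigma>)))"
    unfolding sum.inter_filter[OF spin_configs_finite] by (intro sum.cong) (auto simp: pmf_ising_pmf Z_vec)
  also have "\<dots> = (\<Sum>\<sigma>\<in>Om. wt \<sigma> / Z * of_bool (P (avg N \<sigma>)))"
    by (subst sum.reindex_bij_betw[OF bij_vec, symmetric]) (simp add: weight_vec mean_spin_vec)
  finally show ?thesis by (simp add: Ex_def sum_divide_distrib)
qed

lemma top_eigenvector:
  obtains w where "ip N w w = 1" "ip N w (A w) = eigenvalue_desc B 1"
    "eigenvalue_desc B 2 \<le> eigenvalue_desc B 1"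
    "\<And>x. ip N x (A x) \<le> eigenvalue_desc B 2 * ip N x x
      + (eigenvalue_desc B 1 - eigenvalue_desc B 2) * (ip N w x)\<^sup>2"
proof -
  have "transpose_mat B = B" using cm by (simp add: coupling_matrix_def)
  then obtain v where v: "v \<in> carrier_vec N" "v \<bullet> v = 1" "v \<bullet> (B *\<^sub>v v) = eigenvalue_desc B 1"
    and le: "eigenvalue_desc B 2 \<le> eigenvalue_desc B 1"
    and bd: "\<And>x. x \<in> carrier_vec N \<Longrightarrow> x \<bullet> (B *\<^sub>v x) \<le>
       eigenvalue_desc B 2 * (x \<bullet> x) + (eigenvalue_desc B 1 - eigenvalue_desc B 2) * (v \<bullet> x)\<^sup>2"
    using symmetric_two_eigenvalue_bound[OF carrier _ N2] by blast
  have sp: "x \<bullet> y = ip N (\<lambda>i. x $ i) (\<lambda>i. y $ i)" if "y \<in> carrier_vec N" for x y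
    using that by (simp add: scalar_prod_def ip_def atLeast0LessThan)
  show ?thesis
  proof (rule that)
    show "ip N (\<lambda>i. v $ i) (\<lambda>i. v $ i) = 1" using v sp by metis
    show "ip N (\<lambda>i. v $ i) (A (\<lambda>i. v $ i)) = eigenvalue_desc B 1" using v quad_form by metis
    show "ip N x (A x) \<le> eigenvalue_desc B 2 * ip N x x
      + (eigenvalue_desc B 1 - eigenvalue_desc B 2) * (ip N (\<lambda>i. v $ i) x)\<^sup>2" for x
    proof -
      have c: "vec N x \<in> carrier_vec N" by simp
      have "ip N (\<lambda>i. vec N x $ i) (A (\<lambda>i. vec N x $ i)) = ip N x (A x)"
        "ip N (\<lambda>i. vec N x $ i) (\<lambda>i. vec N x $ i) = ip N x x"
        "ip N (\<lambda>i. v $ i) (\<lambda>i. vec N x $ i) = ip N (\<lambda>i. v $ i) x"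
        by (intro ip_cong A_cong; simp)+
      then show ?thesis using bd[OF c] unfolding quad_form[OF c] sp[OF c] by simp
    qed
  qed (rule le)
qed

text \<open>The hypothesis concerns eigenvalues, while the operator part needs the form on mean-zero
  vectors. The constant vector has Rayleigh quotient at least \<open>1 - \<kappa>\<close>, close to
  the maximal \<open>1 + \<kappa>\<close>, so the top eigenvector nearly points along the constants
  and a mean-zero vector has little overlap with it.\<close>

lemma spectral_gap:
  assumes c: "\<And>i. i < N \<Longrightarrow> \<bar>c i\<bar> \<le> \<kappa>" and \<kappa>: "\<kappa> < 1" and k: "0 \<le> k"
    and ratio: "eigenvalue_desc B 2 / eigenvalue_desc B 1 \<le> k"
    and x: "(\<Sum>i<N. x i) = 0"
  shows "ip N x (A x) \<le> (k * (1 + \<kappa>) + 2 * \<kappa>) * ip N x x"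
proof -
  define l1 l2 where "l1 = eigenvalue_desc B 1" and "l2 = eigenvalue_desc B 2"
  obtain w where w: "ip N w w = 1" "ip N w (A w) = l1" and l21: "l2 \<le> l1"
    and bd: "\<And>x. ip N x (A x) \<le> l2 * ip N x x + (l1 - l2) * (ip N w x)\<^sup>2"
    unfolding l1_def l2_def by (rule top_eigenvector) blast
  \<comment> \<open>\<open>s\<close> is the squared cosine of the angle between the top eigenvector
    and the constants.\<close>
  define s where "s = 1 - ip N (cen N w) (cen N w)"
  have N0: "0 < real N" using N2 by simp
  have s1: "s \<le> 1" by (simp add: s_def)
  have s_eq: "real N * s = (\<Sum>i<N. w i)\<^sup>2"
  proof -
    have "ip N (cen N w) (cen N w) = ip N (cen N w) w" by (simp only: ip_cen_left[of N w w])
    also have "\<dots> = ip N w w - avg N w * (\<Sum>i<N. w i)"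
      unfolding cen_def ip_diff_left ip_const_left ..
    finally have "s = avg N w * (\<Sum>i<N. w i)" by (simp add: s_def w(1))
    then show ?thesis using N0 by (simp add: avg_def power2_eq_square)
  qed
  have l1_le: "l1 \<le> 1 + \<kappa>"
  proof -
    have "R i \<le> 1 + \<kappa>" if "i < N" for i using c[OF that] by (simp add: c_def abs_le_iff)
    then have "\<bar>ip N w (A w)\<bar> \<le> (1 + \<kappa>) * (ip N w w + ip N w w) / 2" by (rule schur_test)
    then show ?thesis by (simp add: w)
  qed
  have one: "1 - \<kappa> \<le> l2 + (l1 - l2) * s"
  proof -
    have "real N * (1 - \<kappa>) = (\<Sum>i<N. 1 - \<kappa>)" by simp
    also have "\<dots> \<le> (\<Sum>i<N. 1 + c i)"
    proof (rule sum_mono)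
      show "1 - \<kappa> \<le> 1 + c i" if "i \<in> {..<N}" for i using c[of i] that by (simp add: abs_le_iff)
    qed
    also have "\<dots> = ip N (\<lambda>_. 1) (A (\<lambda>_. 1))" by (simp add: A_const ip_def)
    also have "\<dots> \<le> l2 * ip N (\<lambda>_. 1) (\<lambda>_. 1) + (l1 - l2) * (ip N w (\<lambda>_. 1))\<^sup>2" by (rule bd)
    also have "\<dots> = real N * (l2 + (l1 - l2) * s)"
      unfolding ip_const_right mult_1 s_eq[symmetric] by (simp add: algebra_simps)
    finally show ?thesis using N0 by simp
  qed
  \<comment> \<open>Bounding \<open>s\<close> by 1 in \<open>one\<close> gives
    \<open>l1 > 0\<close>, which turns the bound on the ratio into
    \<open>l2 \<le> k * l1\<close>.\<close>
  have "(l1 - l2) * s \<le> (l1 - l2) * 1" using s1 l21 by (intro mult_left_mono) auto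
  then have "0 < l1" using one \<kappa> by simp
  then have l2_le: "l2 \<le> k * l1" using ratio by (simp add: l1_def l2_def field_simps)
  have "k * l1 \<le> k * (1 + \<kappa>)" using k l1_le by (rule mult_left_mono[rotated])
  then have l2': "l2 \<le> k * (1 + \<kappa>)" using l2_le by simp
  have wx: "(ip N w x)\<^sup>2 \<le> (1 - s) * ip N x x"
  proof -
    have "ip N w x = ip N (cen N w) x" unfolding cen_def ip_diff_left ip_const_left x by simp
    moreover have "\<bar>ip N (cen N w) x\<bar>\<^sup>2 \<le> (nm N (cen N w) * nm N x)\<^sup>2"
      by (rule power_mono[OF abs_ip_le]) simp
    ultimately show ?thesis by (simp add: s_def power_mult_distrib nm_sq)
  qed
  have "ip N x (A x) \<le> l2 * ip N x x + (l1 - l2) * ((1 - s) * ip N x x)"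
    using bd[of x] mult_left_mono[OF wx, of "l1 - l2"] l21 by simp
  also have "\<dots> = (l2 + (l1 - l2) * (1 - s)) * ip N x x" by (simp add: algebra_simps)
  also have "\<dots> \<le> (k * (1 + \<kappa>) + 2 * \<kappa>) * ip N x x"
  proof (rule mult_right_mono)
    have "(l1 - l2) * (1 - s) = l1 - (l2 + (l1 - l2) * s)" by (simp add: algebra_simps)
    then show "l2 + (l1 - l2) * (1 - s) \<le> k * (1 + \<kappa>) + 2 * \<kappa>" using one l1_le l2' by simp
  qed simp
  finally show ?thesis .
qed

end

section \<open>The rate and the choice of parameters\<close>

definition rate :: "nat \<Rightarrow> real mat \<Rightarrow> real" where
  "rate N A = eps_err N A / sqrt (real N)
     + eps_err N A * r_err N A / real N powr (1/4)
     + (ln (real N))\<^sup>2 / real N powr (1/4) *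
         sqrt ((\<Sum>i<N. (row_sum A i - 1)\<^sup>2)
               + real N powr (-1/2) * (\<Sum>i<N. row_sum A i - 1)\<^sup>2)"

lemma KS_dist_leI:
  assumes "\<And>x. \<bar>measure P {\<omega> \<in> space P. X \<omega> \<le> x} - measure Q {\<omega> \<in> space Q. Y \<omega> \<le> x}\<bar> \<le> K"
  shows "KS_dist P X Q Y \<le> K"
  unfolding KS_dist_def by (rule cSUP_least) (use assms in auto)

lemma KS_dist_le_1:
  assumes "prob_space P" "prob_space Q"
  shows "KS_dist P X Q Y \<le> 1"
proof (rule KS_dist_leI)
  interpret P: prob_space P by fact
  interpret Q: prob_space Q by fact
  show "\<bar>measure P {\<omega> \<in> space P. X \<omega> \<le> x} - measure Q {\<omega> \<in> space Q. Y \<omega> \<le> x}\<bar> \<le> 1" for x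
    using P.prob_le_1[of "{\<omega> \<in> space P. X \<omega> \<le> x}"] Q.prob_le_1[of "{\<omega> \<in> space Q. Y \<omega> \<le> x}"]
      measure_nonneg[of P "{\<omega> \<in> space P. X \<omega> \<le> x}"] measure_nonneg[of Q "{\<omega> \<in> space Q. Y \<omega> \<le> x}"]
    by linarith
qed

context coupling_model
begin

lemma max_row_dev_ge: "i < N \<Longrightarrow> \<bar>c i\<bar> \<le> max_row_dev N B"
  unfolding max_row_dev_def row_sum_c by (intro Max_ge) auto

lemma max_row_dev_nonneg: "0 \<le> max_row_dev N B"
  using max_row_dev_ge[of 0] N_pos by linarith

definition max_alpha :: real where "max_alpha = (MAX i\<in>{..<N}. \<Sum>j<N. (B $$ (i, j))\<^sup>2)"

lemma alpha_le_max: "i < N \<Longrightarrow> alpha i \<le> max_alpha"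
  unfolding max_alpha_def alpha_def by (intro Max_ge) auto

lemma ln_N_pos: "0 < ln (real N)" using N2 by (intro ln_gt_zero) simp

lemma r_err_eq: "r_err N B = sqrt (ln (real N) ^ 3 * max_alpha) + ln (real N) * max_row_dev N B"
  by (simp add: r_err_def max_alpha_def)

lemma max_alpha_nonneg: "0 \<le> max_alpha"
proof (rule order_trans)
  show "0 \<le> alpha 0" by (simp add: alpha_def sum_nonneg)
qed (rule alpha_le_max[OF N_pos])

lemma r_err_nonneg: "0 \<le> r_err N B"
  unfolding r_err_eq using ln_N_pos max_row_dev_nonneg max_alpha_nonneg by simp

lemma eps_err_ge: "ln (real N) \<le> eps_err N B" "Fr \<le> eps_err N B"
proof -
  have "0 \<le> Fr" by (simp add: frobenius_Fr[symmetric])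
  moreover have "0 \<le> 1 / real N * (\<Sum>i<N. row_sum B i - 1)\<^sup>2"
    "0 \<le> 1 / real N * (\<Sum>i<N. (row_sum B i - 1)\<^sup>2)" by (simp_all add: sum_nonneg)
  ultimately show "ln (real N) \<le> eps_err N B" "Fr \<le> eps_err N B"
    using ln_N_pos unfolding eps_err_def frobenius_Fr by linarith+
qed

lemma rate_terms:
  shows "0 < eps_err N B / sqrt (real N)"
    and "0 \<le> eps_err N B * r_err N B / real N powr (1/4)"
    and "0 \<le> (ln (real N))\<^sup>2 / real N powr (1/4) *
         sqrt ((\<Sum>i<N. (row_sum B i - 1)\<^sup>2) + real N powr (-1/2) * (\<Sum>i<N. row_sum B i - 1)\<^sup>2)"
proof -
  have "0 < eps_err N B" using ln_N_pos eps_err_ge(1) by linarith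
  then show "0 < eps_err N B / sqrt (real N)" "0 \<le> eps_err N B * r_err N B / real N powr (1/4)"
    using N_pos r_err_nonneg by (auto intro!: divide_nonneg_nonneg mult_nonneg_nonneg)
qed (auto intro!: divide_nonneg_nonneg mult_nonneg_nonneg add_nonneg_nonneg sum_nonneg)

lemma rate_pos: "0 < rate N B"
  using rate_terms unfolding rate_def by linarith

lemma ks_le_1:
  assumes "prob_space M"
  shows "KS_dist (measure_pmf (ising_pmf B 1 0)) Y M W \<le> 1"
  by (intro KS_dist_le_1 assms measure_pmf.prob_space_axioms)

text \<open>If the rate is at least 1, the trivial bound 1 suffices. Otherwise each of its terms is
  below 1, and this yields \<open>e <= q^2\<close>, \<open>e * r0 <= q\<close> and
  \<open>\<nu> <= 1\<close>, as \<open>critical\<close> requires.\<close>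

lemma ks_le_rate:
  fixes M :: "'a measure"
  assumes qd: "quartic_density M W c'"
    and \<delta>: "0 < \<delta>" "\<delta> \<le> 1 / 2" and D: "10 \<le> D" "3 / \<delta> \<le> D"
    and dev: "real N powr (1/4) * max_row_dev N B \<le> D"
    and ratio: "eigenvalue_desc B 2 / eigenvalue_desc B 1 \<le> 1 - 2 * \<delta>"
    and large: "D ^ 40 \<le> ln (real N)" "D / real N powr (1/4) \<le> \<delta> / 4"
      "3 / \<delta> * ln (real N) * (D / real N powr (1/4)) \<le> 1"
  shows "KS_dist (measure_pmf (ising_pmf B 1 0)) (\<lambda>\<sigma>. real N powr (1/4) * mean_spin N \<sigma>) M W
    \<le> 7 * quartic_density.B0 c' * D ^ 82 * rate N B"
proof (cases "1 \<le> rate N B")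
  case True
  have "3 \<le> quartic_density.B0 c'" by (rule quartic_density.B0_ge[OF qd])
  moreover have "1 \<le> D ^ 82" using D by (intro one_le_power) simp
  ultimately have "1 * 1 \<le> 7 * quartic_density.B0 c' * D ^ 82" by (intro mult_mono) auto
  then have "1 * 1 \<le> 7 * quartic_density.B0 c' * D ^ 82 * rate N B" using True by (intro mult_mono) auto
  then have "1 \<le> 7 * quartic_density.B0 c' * D ^ 82 * rate N B" by simp
  then show ?thesis by (rule order_trans[OF ks_le_1[OF quartic_density.axioms(1)[OF qd]]])
next
  case False
  define q L e \<kappa> r0 where "q = real N powr (1/4)" and "L = ln (real N)" and "e = eps_err N B"
    and "\<kappa> = D / q" and "r0 = sqrt (L ^ 3 * max_alpha)"
  \<comment> \<open>\<open>l\<close> gives \<open>(1 - \<delta>/2)^l <= exp (- L) = 1 / N\<close>,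
    yet is short enough for \<open>(1 + \<kappa>)^l <= e <= 3\<close> with Euler's number;
    \<open>p\<close> gives \<open>N = exp L <= 3^p\<close>.\<close>
  define l p where "l = nat \<lceil>2 / \<delta> * L\<rceil>" and "p = nat \<lceil>L\<rceil>"
  define \<nu> where "\<nu> = sqrt ((\<Sum>i<N. (c i)\<^sup>2) + (\<Sum>i<N. c i)\<^sup>2 / q\<^sup>2) / q"
  have N1: "1 < real N" using N2 by simp
  have q: "0 < q" using N1 by (simp add: q_def)
  have q4: "q ^ 4 = real N" using N1 by (simp add: q_def powr_power)
  have q2: "q\<^sup>2 = sqrt (real N)" using N1 by (simp add: q_def powr_power powr_half_sqrt)
  have q2': "real N powr (-1/2) = 1 / q\<^sup>2"
    using N1 by (simp add: q2 powr_half_sqrt[symmetric] powr_minus_divide)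
  have "10 ^ 1 \<le> D ^ 40" by (rule order_trans[OF power_increasing[of 1 40 10] power_mono]) (use D in auto)
  then have L10: "10 \<le> L" and LD: "D ^ 40 \<le> L" using large(1) by (auto simp: L_def)
  have \<kappa>: "\<kappa> \<le> \<delta> / 4" "0 < \<kappa>" using large(2) q D by (auto simp: \<kappa>_def q_def)
  have cb: "\<bar>c i\<bar> \<le> \<kappa>" if "i < N" for i
  proof -
    have "q * \<bar>c i\<bar> \<le> D"
      using dev mult_left_mono[OF max_row_dev_ge[OF that], of q] q unfolding q_def by linarith
    then show ?thesis using q by (simp add: \<kappa>_def field_simps)
  qed
  have l_ge: "2 / \<delta> * L \<le> real l" and l_le: "real l \<le> 3 / \<delta> * L"
  proof -
    have "0 \<le> 2 / \<delta> * L" using \<delta> L10 by simp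
    then show "2 / \<delta> * L \<le> real l" by (simp add: l_def)
    have "real l \<le> 2 / \<delta> * L + 1" unfolding l_def using \<open>0 \<le> 2 / \<delta> * L\<close> by linarith
    also have "1 \<le> 1 / \<delta> * L" using \<delta> L10 by (simp add: field_simps)
    finally show "real l \<le> 3 / \<delta> * L" by (simp add: field_simps)
  qed
  have l\<kappa>: "real l * \<kappa> \<le> 1"
  proof -
    have "real l * \<kappa> \<le> 3 / \<delta> * L * \<kappa>" using l_le \<kappa>(2) by (intro mult_right_mono) auto
    also have "\<dots> \<le> 1" using large(3) by (simp add: L_def \<kappa>_def q_def)
    finally show ?thesis .
  qed
  \<comment> \<open>A zero row would have deviation \<open>-1\<close>, beyond
    \<open>\<kappa>\<close>. Positivity makes \<open>r0\<close> a legitimate divisor.\<close>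
  have \<alpha>0: "0 < max_alpha"
  proof -
    have "alpha 0 \<noteq> 0"
    proof
      assume "alpha 0 = 0"
      then have "B $$ (0, j) = 0" if "j < N" for j
        using that by (simp add: alpha_def sum_nonneg_eq_0_iff)
      then have "c 0 = -1" by (simp add: c_def R_def)
      then show False using cb[OF N_pos] \<kappa> \<delta> by simp
    qed
    moreover have "0 \<le> alpha 0" by (simp add: alpha_def sum_nonneg)
    ultimately show ?thesis using alpha_le_max[OF N_pos] by linarith
  qed
  have r0: "0 < r0" "r0 \<le> r_err N B"
    using \<alpha>0 L10 ln_N_pos max_row_dev_nonneg by (simp_all add: r0_def r_err_eq L_def)
  have e0: "0 < e" and eL: "L \<le> e" using eps_err_ge(1) ln_N_pos by (simp_all add: e_def L_def)
  have \<nu>0: "0 \<le> \<nu>" using q by (simp add: \<nu>_def sum_nonneg)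
  have terms: "e / q\<^sup>2 + e * r_err N B / q + L\<^sup>2 * \<nu> = rate N B"
    unfolding rate_def row_sum_c q2' q2[symmetric] q_def[symmetric] e_def[symmetric] L_def[symmetric] \<nu>_def by simp
  have t0: "0 \<le> e / q\<^sup>2" "0 \<le> e * r_err N B / q" "0 \<le> L\<^sup>2 * \<nu>"
    using e0 q r_err_nonneg \<nu>0 by simp_all
  have er: "e * r0 / q \<le> e * r_err N B / q"
    using r0 e0 q by (intro divide_right_mono mult_left_mono) auto
  have "1 \<le> L\<^sup>2" using L10 by (intro one_le_power) simp
  then have L\<nu>: "\<nu> \<le> L\<^sup>2 * \<nu>" using mult_right_mono[of 1 "L\<^sup>2" \<nu>] \<nu>0 by simp
  have cN: "nm N c \<le> \<nu> * q" "\<bar>\<Sum>i<N. c i\<bar> \<le> \<nu> * q\<^sup>2"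
  proof -
    have s0: "0 \<le> (\<Sum>i<N. (c i)\<^sup>2)" by (simp add: sum_nonneg)
    have \<nu>q: "\<nu> * q = sqrt ((\<Sum>i<N. (c i)\<^sup>2) + (\<Sum>i<N. c i)\<^sup>2 / q\<^sup>2)" using q by (simp add: \<nu>_def)
    show "nm N c \<le> \<nu> * q" unfolding \<nu>q nm_def ip_self_eq by (intro real_sqrt_le_mono) simp
    have "\<bar>\<Sum>i<N. c i\<bar> / q = sqrt ((\<Sum>i<N. c i)\<^sup>2 / q\<^sup>2)" using q by (simp add: real_sqrt_divide)
    also have "\<dots> \<le> \<nu> * q" unfolding \<nu>q using s0 by (intro real_sqrt_le_mono) simp
    finally show "\<bar>\<Sum>i<N. c i\<bar> \<le> \<nu> * q\<^sup>2" using q by (simp add: field_simps power2_eq_square)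
  qed
  interpret cr: critical N "\<lambda>i j. B $$ (i, j)" \<kappa> \<delta> D q L e r0 max_alpha \<nu> l p
  proof
    \<comment> \<open>Starting from \<open>k = 1 - 2 * \<delta>\<close>, the deviation of the row
      sums costs at most \<open>3 * \<kappa>\<close>, less than \<open>\<delta>\<close>.\<close>
    show "ip N x (A x) \<le> (1 - \<delta>) * ip N x x" if "(\<Sum>i<N. x i) = 0" for x
    proof (rule order_trans)
      show "ip N x (A x) \<le> ((1 - 2 * \<delta>) * (1 + \<kappa>) + 2 * \<kappa>) * ip N x x"
        by (rule spectral_gap) (use cb \<kappa> \<delta> ratio that in auto)
      have "0 \<le> \<delta> * \<kappa>" using \<delta> \<kappa> by simp
      moreover have "(1 - 2 * \<delta>) * (1 + \<kappa>) + 2 * \<kappa> = 1 - 2 * \<delta> + 3 * \<kappa> - 2 * (\<delta> * \<kappa>)"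
        by (simp add: algebra_simps)
      ultimately have "(1 - 2 * \<delta>) * (1 + \<kappa>) + 2 * \<kappa> \<le> 1 - \<delta>" using \<kappa> by linarith
      then show "((1 - 2 * \<delta>) * (1 + \<kappa>) + 2 * \<kappa>) * ip N x x \<le> (1 - \<delta>) * ip N x x"
        by (rule mult_right_mono) simp
    qed
    show "\<kappa> * q \<le> D" using q by (simp add: \<kappa>_def)
    have "1 / \<delta> \<le> 3 / \<delta>" using \<delta> by (intro divide_right_mono) auto
    then show "1 / \<delta> \<le> D" using D by linarith
    show "L \<le> real N" using ln_le_minus_one[of "real N"] N1 by (simp add: L_def)
    have "1 - \<delta> / 2 \<le> exp (- \<delta> / 2)" using exp_ge_add_one_self[of "- \<delta> / 2"] by simp
    then have "(1 - \<delta> / 2) ^ l \<le> exp (- \<delta> / 2) ^ l" using \<delta> by (intro power_mono) auto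
    also have "\<dots> = exp (- (real l * \<delta> / 2))" by (simp add: exp_of_nat_mult[symmetric])
    also have "\<dots> \<le> exp (- L)" using l_ge \<delta> by (simp add: field_simps)
    also have "\<dots> = 1 / real N" using N1 by (simp add: L_def exp_minus inverse_eq_divide)
    finally show "(1 - \<delta> / 2) ^ l \<le> 1 / real N" .
    have "(1 + \<kappa>) ^ l \<le> exp \<kappa> ^ l" using \<kappa> by (intro power_mono) auto
    also have "\<dots> = exp (real l * \<kappa>)" by (simp add: exp_of_nat_mult[symmetric])
    also have "\<dots> \<le> exp 1" using l\<kappa> by simp
    also have "\<dots> \<le> 3" by (rule exp_le)
    finally show "(1 + \<kappa>) ^ l \<le> 3" .
    have "D * 1 \<le> D * D" using D by (intro mult_left_mono) auto
    then have "3 / \<delta> \<le> D\<^sup>2" unfolding power2_eq_square using D by linarith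
    then have "3 / \<delta> * L \<le> D\<^sup>2 * L" using L10 by (intro mult_right_mono) auto
    then show "real l \<le> D\<^sup>2 * L" using l_le by simp
    show "2 \<le> p" unfolding p_def using L10 by linarith
    show "real p \<le> 2 * L" unfolding p_def using L10 by linarith
    have "real N = exp L" using N1 by (simp add: L_def)
    also have "\<dots> \<le> exp (real p)" unfolding p_def using L10 by simp
    also have "\<dots> = exp 1 ^ p" by (simp add: exp_of_nat_mult[symmetric])
    also have "\<dots> \<le> 3 ^ p" by (intro power_mono exp_le) auto
    finally show "real N \<le> 3 ^ p" .
    show "r0\<^sup>2 = L ^ 3 * max_alpha" using L10 \<alpha>0 by (simp add: r0_def)
    have "e / q\<^sup>2 \<le> 1" using False terms t0 by linarith
    then show "e \<le> q\<^sup>2" using q by (simp add: field_simps)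
    have "e * r0 / q \<le> 1" using False terms t0 er by linarith
    then show "e * r0 \<le> q" using q by (simp add: field_simps)
    show "\<nu> \<le> 1" using False terms t0 L\<nu> by linarith
    show "Fr \<le> e" unfolding e_def by (rule eps_err_ge)
    show "i < N \<Longrightarrow> alpha i \<le> max_alpha" for i by (rule alpha_le_max)
  qed (fact cb \<kappa> \<delta> q q4 D LD l\<kappa> \<alpha>0 r0 eL \<nu>0 cN | use \<delta> in linarith)+
  have le: "\<nu> + cr.\<omega> \<le> rate N B" unfolding cr.\<omega>_def using terms L\<nu> er by linarith
  have B0: "0 \<le> 7 * quartic_density.B0 c' * D ^ 82" using quartic_density.B0_ge[OF qd] D by simp
  show ?thesis
  proof (rule KS_dist_leI)
    fix x
    have "\<bar>Ex (\<lambda>\<sigma>. of_bool (q * avg N \<sigma> \<le> x)) - measure M {\<omega> \<in> space M. W \<omega> \<le> x}\<bar>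
      \<le> 7 * quartic_density.B0 c' * D ^ 82 * (\<nu> + cr.\<omega>)" by (rule cr.cdf_bound[OF qd])
    also have "\<dots> \<le> 7 * quartic_density.B0 c' * D ^ 82 * rate N B" using le B0 by (rule mult_left_mono)
    finally show "\<bar>measure (measure_pmf (ising_pmf B 1 0)) {\<sigma> \<in> space (measure_pmf (ising_pmf B 1 0)). real N powr (1/4) * mean_spin N \<sigma> \<le> x}
      - measure M {\<omega> \<in> space M. W \<omega> \<le> x}\<bar> \<le> 7 * quartic_density.B0 c' * D ^ 82 * rate N B"
      using ising_prob[of "\<lambda>m. q * m \<le> x"] by (simp add: q_def)
  qed
qed

end

section \<open>From bounds for large sizes to all sizes\<close>

theorem theorem1p3:
  fixes A :: "nat \<Rightarrow> real mat"
    and M :: "'a measure" and W :: "'a \<Rightarrow> real" and c :: real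
  assumes coupling: "\<And>N. N \<ge> 2 \<Longrightarrow> coupling_matrix N (A N)"
    and gap: "limsup (\<lambda>N. ereal (eigenvalue_desc (A N) 2 / eigenvalue_desc (A N) 1)) < 1"
    and regular: "limsup (\<lambda>N. ereal (real N powr (1/4) * max_row_dev N (A N))) < \<infinity>"
    and M: "prob_space M"
    and W: "distributed M lborel W (\<lambda>x. ennreal (c * exp (- (x ^ 4) / 12)))"
  shows "\<exists>C. \<forall>N\<ge>2.
    KS_dist (measure_pmf (ising_pmf (A N) 1 0)) (\<lambda>\<sigma>. real N powr (1/4) * mean_spin N \<sigma>) M W
    \<le> C * (eps_err N (A N) / sqrt (real N)
          + eps_err N (A N) * r_err N (A N) / real N powr (1/4)
          + (ln (real N))\<^sup>2 / real N powr (1/4) *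
              sqrt ((\<Sum>i<N. (row_sum (A N) i - 1)\<^sup>2)
                    + real N powr (-1/2) * (\<Sum>i<N. row_sum (A N) i - 1)\<^sup>2))"
proof -
  let ?KS = "\<lambda>N. KS_dist (measure_pmf (ising_pmf (A N) 1 0)) (\<lambda>\<sigma>. real N powr (1/4) * mean_spin N \<sigma>) M W"
  have qd: "quartic_density M W c" using M W by (intro quartic_density.intro quartic_density_axioms.intro)
  have cm: "coupling_model N (A N)" if "2 \<le> N" for N using coupling that by unfold_locales
  obtain g where g: "limsup (\<lambda>N. ereal (eigenvalue_desc (A N) 2 / eigenvalue_desc (A N) 1)) < ereal g" "ereal g < 1"
    using ereal_dense2[OF gap] by blast
  obtain K where K: "limsup (\<lambda>N. ereal (real N powr (1/4) * max_row_dev N (A N))) < ereal K"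
    using ereal_dense2[OF regular] by blast
  \<comment> \<open>Half of the distance from \<open>g\<close> to 1 is kept as the gap, the other
    half pays for unequal row sums. The cap at 1/2 keeps \<open>1 - 2 * \<delta>\<close>
    nonnegative, as \<open>spectral_gap\<close> requires of \<open>k\<close>.\<close>
  define \<delta> where "\<delta> = min (1 / 2) ((1 - g) / 2)"
  have \<delta>: "0 < \<delta>" "\<delta> \<le> 1 / 2" "g \<le> 1 - 2 * \<delta>" using g(2) by (auto simp: \<delta>_def min_def field_simps)
  define D where "D = max 10 (max K (3 / \<delta>))"
  have D: "10 \<le> D" "3 / \<delta> \<le> D" "K \<le> D" by (auto simp: D_def)
  have "\<forall>\<^sub>F N in sequentially. ereal (eigenvalue_desc (A N) 2 / eigenvalue_desc (A N) 1) < ereal g"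
    by (rule Limsup_lessD[OF g(1)])
  moreover have "\<forall>\<^sub>F N in sequentially. ereal (real N powr (1/4) * max_row_dev N (A N)) < ereal K"
    by (rule Limsup_lessD[OF K])
  moreover have "\<forall>\<^sub>F N in sequentially. x \<le> ln (real N)" for x by real_asymp
  then have "\<forall>\<^sub>F N in sequentially. D ^ 40 \<le> ln (real N)" .
  moreover have "\<forall>\<^sub>F N in sequentially. D / real N powr (1/4) < \<delta> / 4"
    by (rule order_tendstoD(2)[of _ 0]) (real_asymp, use \<delta> in simp)
  moreover have "\<forall>\<^sub>F N in sequentially. 3 / \<delta> * ln (real N) * (D / real N powr (1/4)) < 1"
    by (rule order_tendstoD(2)[of _ 0]) (real_asymp, simp)
  ultimately have "\<forall>\<^sub>F N in sequentially. 2 \<le> N \<longrightarrow> ?KS N \<le> 7 * quartic_density.B0 c * D ^ 82 * rate N (A N)"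
  proof eventually_elim
    case (elim N)
    show ?case
    proof
      assume "2 \<le> N"
      then interpret coupling_model N "A N" by (rule cm)
      show "?KS N \<le> 7 * quartic_density.B0 c * D ^ 82 * rate N (A N)"
        by (rule ks_le_rate[OF qd]) (use \<delta> D elim in auto)
    qed
  qed
  then obtain n where n: "\<And>N. n \<le> N \<Longrightarrow> 2 \<le> N \<Longrightarrow> ?KS N \<le> 7 * quartic_density.B0 c * D ^ 82 * rate N (A N)"
    unfolding eventually_sequentially by blast
  \<comment> \<open>For the finitely many sizes below \<open>n\<close> only the trivial bound 1 is
    at hand. Every rate is positive, thanks to the \<open>ln N\<close> in \<open>eps_err\<close>, so
    adding all reciprocals to the constant covers these sizes.\<close>
  define S where "S = (\<Sum>N\<in>{2..<n}. 1 / rate N (A N))"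
  have pos: "0 < rate N (A N)" if "2 \<le> N" for N using coupling_model.rate_pos[OF cm[OF that]] .
  have S0: "0 \<le> S" unfolding S_def using pos by (intro sum_nonneg) (auto simp: less_imp_le)
  have C0: "0 \<le> 7 * quartic_density.B0 c * D ^ 82" using quartic_density.B0_ge[OF qd] D by simp
  have "?KS N \<le> (7 * quartic_density.B0 c * D ^ 82 + S) * rate N (A N)" if N: "2 \<le> N" for N
  proof (cases "n \<le> N")
    case True
    have "0 \<le> S * rate N (A N)" using S0 pos[OF N] by simp
    then show ?thesis using n[OF True N] by (simp add: distrib_right)
  next
    case False
    have "1 / rate N (A N) \<le> S"
      unfolding S_def using False N pos by (intro member_le_sum) (auto simp: less_imp_le)
    then have "1 \<le> S * rate N (A N)" using pos[OF N] by (simp add: field_simps)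
    moreover have "0 \<le> 7 * quartic_density.B0 c * D ^ 82 * rate N (A N)" by (rule mult_nonneg_nonneg[OF C0 less_imp_le[OF pos[OF N]]])
    moreover have "?KS N \<le> 1" by (rule coupling_model.ks_le_1[OF cm[OF N] M])
    ultimately show ?thesis unfolding distrib_right by linarith
  qed
  then show ?thesis unfolding rate_def by blast
qed

end
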